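(* Let $1 \leq n < \omega$. Let $\kappa, \nu < \lambda$ be infinite cardinals such that $\lambda$ is regular and $\theta^{<\kappa} < \lambda$ for every cardinal $\theta < \lambda$, and let $\mu = \sigma(\lambda, n)$. Let $g : [\mu]^n \to \nu$, and for each $b \in [\mu]^n$ let $u_b$ be a set of ordinals with $|u_b| < \kappa$. Then there are $H \subseteq \mu$ with $|H| = \lambda$ and $k < \nu$ such that (1) $g(b) = k$ for all $b \in [H]^n$; (2) $\langle u_b \mid b \in [H]^n \rangle$ is a uniform $n$-dimensional $\Delta$-system. Moreover, $H$ can be chosen so that, in addition: for all $a, b \in [H]^n$ and all $m < n$, if $a$ and $b$ are aligned above $m$ and $a(m) = b(m)$, then for every ordinal $\alpha \in H$ that is $m$-possible for both $a$ and $b$, we have $\mathrm{tp}_{\mathrm{int}}(u_a, u_b) = \mathrm{tp}_{\mathrm{int}}(u_{a_{m \mapsto \alpha}}, u_{b_{m \mapsto \alpha}})$.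
   Context: For an infinite regular cardinal $\lambda$, define $\sigma(\lambda,1) := \lambda$ and $\sigma(\lambda, n+1) := (2^{<\sigma(\lambda,n)})^+$ for $1 \le n < \omega$. Natural numbers are von Neumann ordinals, so $n = \{0,\dots,n-1\}$; $[X]^k$ is the set of $k$-element subsets of $X$. For a set $u$ of ordinals, $\mathrm{otp}(u)$ is its order type; for $i < \mathrm{otp}(u)$, $u(i)$ is the unique $\alpha \in u$ with $\mathrm{otp}(u \cap \alpha) = i$; for $\mathbf{i} \subseteq \mathrm{otp}(u)$, $u[\mathbf{i}] := \{u(i) \mid i \in \mathbf{i}\}$. Sets of ordinals $a,b$ are aligned if $\mathrm{otp}(a) = \mathrm{otp}(b)$ and for every $\gamma \in a \cap b$, $\mathrm{otp}(a \cap \gamma) = \mathrm{otp}(b \cap \gamma)$. Let $\mathbf{r}(a,b) := \{i < \mathrm{otp}(a) \mid a(i) \in b\}$. A family $\langle u_b \mid b \in [H]^n \rangle$ of sets of ordinals ($H$ a set of ordinals) is a uniform $n$-dimensional $\Delta$-system if there are an ordinal $\rho$ and sets $\mathbf{r}_{\mathbf{m}} \subseteq \rho$ for $\mathbf{m} \subseteq n$ such that: (i) $\mathrm{otp}(u_b) = \rho$ for all $b \in [H]^n$; (ii) for all $a,b \in [H]^n$ and $\mathbf{m} \subseteq n$, if $a,b$ are aligned with $\mathbf{r}(a,b) = \mathbf{m}$ then $u_a, u_b$ are aligned with $\mathbf{r}(u_a,u_b) = \mathbf{r}_{\mathbf{m}}$; (iii) $\mathbf{r}_{\mathbf{m}_0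 \cap \mathbf{m}_1} = \mathbf{r}_{\mathbf{m}_0} \cap \mathbf{r}_{\mathbf{m}_1}$ for all $\mathbf{m}_0, \mathbf{m}_1 \subseteq n$. For $a, b$ of order type $n$ and $m < n$: $a$ and $b$ are aligned above $m$ if $a[n \setminus m]$ and $b[n \setminus m]$ are aligned. For sets of ordinals $a,b$, $\mathrm{tp}_{\mathrm{int}}(a,b) := \{(i,j) \in \mathrm{otp}(a) \times \mathrm{otp}(b) \mid a(i) = b(j)\}$. For a nonempty set of ordinals $a$ and $i < \mathrm{otp}(a)$, an ordinal $\alpha$ is $i$-possible for $a$ if ($i > 0 \Rightarrow \alpha > a(i-1)$) and ($i+1 < \mathrm{otp}(a) \Rightarrow \alpha < a(i+1)$); in that case $a_{i \mapsto \alpha} := (a \setminus \{a(i)\}) \cup \{\alpha\}$. *)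

theory Defs
  imports Main "HOL-Library.Ramsey"
begin

unbundle cardinal_syntax

text \<open>Cardinals are represented by sets, compared via card_of and the
  BNF cardinal orderings.  X has cardinality the supremum of the cardinalities
  of the members of F (least upper bound among the cardinalities of sets of
  X's type).\<close>
definition is_sup_card :: "'b set set \<Rightarrow> 'a set \<Rightarrow> bool" where
  "is_sup_card F X \<longleftrightarrow>
     (\<forall>A\<in>F. |A| \<le>o |X| ) \<and> (\<forall>Y::'a set. (\<forall>A\<in>F. |A| \<le>o |Y| ) \<longrightarrow> |X| \<le>o |Y| )"

text \<open>sigma_card L n S: the cardinality of S equals sigma(|L|, n), where
  sigma(lambda,1) = lambda and sigma(lambda,n+1) = (2^{<sigma(lambda,n)})^+,
  with 2^{<theta} = sup of 2^rho for rho < theta.\<close>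
fun sigma_card :: "'l set \<Rightarrow> nat \<Rightarrow> 'a set \<Rightarrow> bool" where
  "sigma_card L 0 S = False"
| "sigma_card L (Suc 0) S = ( |S| =o |L| )"
| "sigma_card L (Suc (Suc n)) S =
     (\<exists>T X :: 'a set. sigma_card L (Suc n) T
        \<and> is_sup_card {Pow A | A :: 'a set. |A| <o |T| } X
        \<and> |S| =o cardSuc |X| )"

definition exp_lt_below :: "'l set \<Rightarrow> 'k set \<Rightarrow> 'l set \<Rightarrow> bool" where
  "exp_lt_below \<Theta> K L \<longleftrightarrow>
     (\<exists>X :: 'l set. is_sup_card {BNF_Wellorder_Constructions.Func R \<Theta> | R :: 'k set. |R| <o |K| } X
        \<and> |X| <o |L| )"

text \<open>Ordinals are represented by positions in a well-ordered (linearly ordered)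
  index type: an index i denotes the ordinal otp({..<i}).  For the index type nat
  this is the von Neumann natural number i.\<close>

definition otp_eq :: "'a::linorder set \<Rightarrow> 'b::linorder set \<Rightarrow> bool" where
  "otp_eq A B \<longleftrightarrow> (\<exists>f. bij_betw f A B \<and> strict_mono_on A f)"

text \<open>is_pos u i  means  i < otp(u).\<close>
definition is_pos :: "'a::linorder set \<Rightarrow> 'i::linorder \<Rightarrow> bool" where
  "is_pos u i \<longleftrightarrow> (\<exists>\<alpha>\<in>u. otp_eq (u \<inter> {..<\<alpha>}) {..<i})"

definition elem_at :: "'a::linorder set \<Rightarrow> 'i::linorder \<Rightarrow> 'a" where
  "elem_at u i = (THE \<alpha>. \<alpha> \<in> u \<and> otp_eq (u \<inter> {..<\<alpha>}) {..<i})"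

text \<open>positions u = the ordinal otp(u), as the set of ordinals below it.\<close>
definition positions :: "'a::linorder set \<Rightarrow> 'i::linorder set" where
  "positions u = {i. is_pos u i}"

definition aligned :: "'a::linorder set \<Rightarrow> 'a set \<Rightarrow> bool" where
  "aligned a b \<longleftrightarrow> otp_eq a b \<and>
     (\<forall>\<gamma>\<in>a \<inter> b. otp_eq (a \<inter> {..<\<gamma>}) (b \<inter> {..<\<gamma>}))"

definition rset :: "'a::linorder set \<Rightarrow> 'a set \<Rightarrow> 'i::linorder set" where
  "rset a b = {i. is_pos a i \<and> elem_at a i \<in> b}"

definition sub_at :: "'a::linorder set \<Rightarrow> 'i::linorder set \<Rightarrow> 'a set" where
  "sub_at u I = (\<lambda>i. elem_at u i) ` I"

text \<open>Uniform n-dimensional Delta-system; rho is represented by the set of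
  ordinals below it, the r_m by subsets of the ordinal rho.\<close>
definition uniform_delta_system ::
  "nat \<Rightarrow> 'a::linorder set \<Rightarrow> ('a set \<Rightarrow> 'o::linorder set) \<Rightarrow> bool" where
  "uniform_delta_system n H u \<longleftrightarrow>
     (\<exists>(\<rho>::'o set) (r :: nat set \<Rightarrow> 'o set).
        (\<forall>b\<in>[H]\<^bsup>n\<^esup>. positions (u b) = \<rho>) \<and>
        (\<forall>m. m \<subseteq> {..<n} \<longrightarrow> r m \<subseteq> \<rho>) \<and>
        (\<forall>a\<in>[H]\<^bsup>n\<^esup>. \<forall>b\<in>[H]\<^bsup>n\<^esup>. \<forall>m. m \<subseteq> {..<n} \<longrightarrow>
            aligned a b \<and> rset a b = m \<longrightarrow>
            aligned (u a) (u b) \<and> rset (u a) (u b) = r m) \<and>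
        (\<forall>m0 m1. m0 \<subseteq> {..<n} \<longrightarrow> m1 \<subseteq> {..<n} \<longrightarrow> r (m0 \<inter> m1) = r m0 \<inter> r m1))"

definition aligned_above :: "nat \<Rightarrow> 'a::linorder set \<Rightarrow> 'a set \<Rightarrow> nat \<Rightarrow> bool" where
  "aligned_above n a b m \<longleftrightarrow> aligned (sub_at a ({..<n} - {..<m})) (sub_at b ({..<n} - {..<m}))"

definition tp_int :: "'a::linorder set \<Rightarrow> 'a set \<Rightarrow> ('i::linorder \<times> 'i) set" where
  "tp_int a b = {(i, j). is_pos a i \<and> is_pos b j \<and> elem_at a i = elem_at b j}"

definition possible :: "'a::linorder set \<Rightarrow> nat \<Rightarrow> 'a \<Rightarrow> bool" where
  "possible a i \<alpha> \<longleftrightarrow> a \<noteq> {} \<and> is_pos a i \<and>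
     (i > 0 \<longrightarrow> \<alpha> > elem_at a (i - 1)) \<and>
     (is_pos a (i + 1) \<longrightarrow> \<alpha> < elem_at a (i + 1))"

definition replace_at :: "'a::linorder set \<Rightarrow> nat \<Rightarrow> 'a \<Rightarrow> 'a set" where
  "replace_at a i \<alpha> = (a - {elem_at a i}) \<union> {\<alpha>}"

end

(*
  All order types of the sets u b are absorbed into the colouring, so that u b becomes an increasing
  enumeration f b of a fixed index set D of positions. One shows, by induction on n, that on some H
  of size lambda the value f b i is a one-to-one function of the coordinates of b in some m i, and
  that values at distinct indices differ, as long as the tuples compared are aligned; then
  r M = {i. m i <= M}.

  For n = 1 this is the classical Delta-system lemma. For the step from n to n + 1, the Erdos-Rado
  ramification tree on M has more than 2^{<sigma(lambda,n)} nodes and hence a node delta with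
  sigma(lambda,n) predecessors A. Each predecessor x looks like delta over the predecessors below x.
  The induction hypothesis applied to F a = f (a with delta on top) controls the lower coordinates.
  Whether i depends on the top coordinate is decided by whether F a i is a value already attained
  on tuples from A, which is made part of the colouring.
*)
theory Submission
  imports Defs
begin

section \<open>Cardinals of well-ordered sets\<close>

text \<open>The obstacle in the inductive step is a comparison of two values of different kinds: one
  that is new at its top \<open>\<alpha>\<close>, and one of the form \<open>F b j\<close> that does
  not depend on its top. Here \<open>b\<close> may have members on both sides of
  \<open>\<alpha>\<close>, so end-homogeneity below \<open>\<alpha>\<close> says nothing about the
  pair. For this reason \<open>canonical\<close> also demands, for tuples that need not be aligned,
  that \<open>f b j\<close> is determined by the coordinates in \<open>m j\<close>. The other
  members of \<open>b\<close> may then be replaced freely: either \<open>b\<close> moves below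
  \<open>\<alpha>\<close> and its value is old there, or its last relevant coordinate lies above
  \<open>\<alpha>\<close> and was chosen to avoid the value. The last conclusion concerns tuples
  aligned only above some position. It is carried along as a second invariant,
  \<open>shift_invariant\<close>, which survives the step because end-homogeneity compares two
  tuples under a common top with no alignment at all. The bound on powers enters twice: in the
  Delta-system lemma, and in counting the index sets that record independence of the top.\<close>

lemma ordLess_not_ordLeq: "|A| <o |B| \<longleftrightarrow> \<not> |B| \<le>o |A|"
  using not_ordLeq_iff_ordLess[OF card_of_Well_order card_of_Well_order] by blast

text \<open>If \<open>|B|\<close> were smaller than \<open>|A|\<close>, it would be smaller than the
  well-order of \<open>A\<close>, hence isomorphic to a proper initial segment of it, which then has
  size \<open>|B|\<close>.\<close>

lemma card_le_if_initial_small: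
  fixes A :: "'a::wellorder set"
  assumes small: "\<And>x. x \<in> A \<Longrightarrow> |A \<inter> {..<x}| <o |B|"
  shows "|A| \<le>o |B|"
proof (rule ccontr)
  assume "\<not> |A| \<le>o |B|"
  then have BA: "|B| <o |A|" by (simp add: ordLess_not_ordLeq)
  define w where "w = {(x,y). x \<in> A \<and> y \<in> A \<and> x \<le> y}"
  have F: "Field w = A" unfolding w_def Field_def by auto
  have "wf (w - Id)"
    by (rule wf_subset[OF wf]) (auto simp: w_def)
  then have w: "well_order_on A w"
    unfolding well_order_on_def linear_order_on_def partial_order_on_def preorder_on_def
      refl_on_def trans_def antisym_def total_on_def
    by (auto simp: w_def)
  have wo: "Well_order w" using w F by simp
  have "|B| <o w" using BA card_of_least[OF w] ordLess_ordLeq_trans by blast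
  then obtain a where a: "a \<in> A" and iso: "|B| =o Restr w (underS w a)"
    using ordLess_iff_ordIso_Restr[OF wo card_of_Well_order] F by blast
  have u: "underS w a = A \<inter> {..<a}" using a unfolding underS_def w_def by auto
  have "Field (Restr w (underS w a)) = A \<inter> {..<a}"
    unfolding u unfolding Field_def w_def by auto
  then have "|B| =o |A \<inter> {..<a}|" using card_of_cong[OF iso] by (simp add: Field_card_of)
  then show False using small[OF a] not_ordLess_ordIso ordIso_symmetric by blast
qed

text \<open>Cutting \<open>T\<close> at the least point below which it already has full size leaves
  a set whose order type is its cardinal. A set known only by its cardinality thus becomes usable as
  an index set of heights.\<close>

lemma obtain_initial_of_same_card:
  fixes T :: "'a::wellorder set"
  obtains T' where "T' \<subseteq> T" "|T'| =o |T|" "\<And>x. x \<in> T' \<Longrightarrow> |T' \<inter> {..<x}| <o |T'|"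
proof (cases "\<forall>x\<in>T. |T \<inter> {..<x}| <o |T|")
  case True
  then show ?thesis using that[of T] card_of_refl by blast
next
  case False
  define x where "x = (LEAST x. x \<in> T \<and> \<not> |T \<inter> {..<x}| <o |T| )"
  have x: "x \<in> T" "\<not> |T \<inter> {..<x}| <o |T|"
    using LeastI_ex[of "\<lambda>x. x \<in> T \<and> \<not> |T \<inter> {..<x}| <o |T|"] False unfolding x_def by blast+
  have least: "|T \<inter> {..<y}| <o |T|" if "y \<in> T" "y < x" for y
    using not_less_Least[of y "\<lambda>x. x \<in> T \<and> \<not> |T \<inter> {..<x}| <o |T|"] that unfolding x_def by blast
  have eq: "|T \<inter> {..<x}| =o |T|"
    using x(2) card_of_mono1[of "T \<inter> {..<x}" T] by (auto simp: ordLess_not_ordLeq ordIso_iff_ordLeq)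
  show ?thesis
  proof (rule that[of "T \<inter> {..<x}"])
    fix y assume y: "y \<in> T \<inter> {..<x}"
    then have "T \<inter> {..<x} \<inter> {..<y} = T \<inter> {..<y}" by auto
    then show "|T \<inter> {..<x} \<inter> {..<y}| <o |T \<inter> {..<x}|"
      using least[of y] y eq ordLess_ordIso_trans ordIso_symmetric by fastforce
  qed (use eq in auto)
qed

lemma obtain_subset_of_card:
  assumes "|A| \<le>o |T|"
  obtains B where "B \<subseteq> T" "|A| =o |B|"
  using iffD1[OF internalize_card_of_ordLeq2 assms] by blast

text \<open>This is \<theta> \<le> 2^{<\<theta>}: if \<open>|X|\<close> were below
  \<open>|T|\<close>, a copy of \<open>X\<close> inside \<open>T\<close> would contradict Cantor's
  theorem.\<close>

lemma card_le_if_Pow_le: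
  assumes "\<And>A. \<lbrakk>A \<subseteq> T; |A| <o |T|\<rbrakk> \<Longrightarrow> |Pow A| \<le>o |X|"
  shows "|T| \<le>o |X|"
proof (rule ccontr)
  assume "\<not> |T| \<le>o |X|"
  then have XT: "|X| <o |T|" by (simp add: ordLess_not_ordLeq)
  obtain A where A: "A \<subseteq> T" "|X| =o |A|"
    using obtain_subset_of_card[OF ordLess_imp_ordLeq[OF XT]] by metis
  have "|Pow A| \<le>o |X|"
    by (rule assms[OF A(1) ordIso_ordLess_trans[OF ordIso_symmetric[OF A(2)] XT]])
  then have "|Pow A| \<le>o |A|" by (rule ordLeq_ordIso_trans[OF _ A(2)])
  then show False using card_of_Pow ordLess_not_ordLeq by blast
qed

lemma card_of_Pow_mono: "|A| \<le>o |B| \<Longrightarrow> |Pow A| \<le>o |Pow B|"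
  unfolding card_of_ordLeq[symmetric] using inj_on_image_Pow image_Pow_mono by meson

text \<open>\<open>stable\<close> is regularity in the form used throughout: a small sum of small
  sets is small. Uncountability is included so that countable unions stay small, which bounds the
  finite lists and finite subsets of a small set.\<close>

definition uncountable_regular :: "'a set \<Rightarrow> bool" where
  "uncountable_regular M \<longleftrightarrow> stable |M| \<and> |UNIV :: nat set| <o |M|"

context
  fixes M :: "'m set"
  assumes reg: "uncountable_regular M"
begin

lemma reg_infinite: "infinite M"
  using reg unfolding uncountable_regular_def
  using infinite_iff_card_of_nat ordLess_imp_ordLeq by blast

lemma finite_ordLess_reg: "finite A \<Longrightarrow> |A| <o |M|"
  using reg_infinite card_of_ordLeq_finite ordLess_not_ordLeq by blast

lemma UN_small: "\<lbrakk>|I| <o |M|; \<And>i. i \<in> I \<Longrightarrow> |A i| <o |M|\<rbrakk> \<Longrightarrow> |\<Union>i\<in>I. A i| <o |M|"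
  by (rule stable_UNION) (use reg in \<open>auto simp: uncountable_regular_def\<close>)

lemma Sigma_small: "\<lbrakk>|I| <o |M|; \<And>i. i \<in> I \<Longrightarrow> |A i| <o |M|\<rbrakk> \<Longrightarrow> |Sigma I A| <o |M|"
  by (rule stable_elim) (use reg in \<open>auto simp: uncountable_regular_def\<close>)

lemma Un_small: "\<lbrakk>|A| <o |M|; |B| <o |M|\<rbrakk> \<Longrightarrow> |A \<union> B| <o |M|"
  using card_of_Un_ordLess_infinite[OF reg_infinite] by blast

lemma lists_small:
  assumes B: "|B| <o |M|"
  shows "|lists B| <o |M|"
proof -
  have len: "|{l \<in> lists B. length l = n}| <o |M|" for n
  proof (induction n)
    case 0
    have "finite {l \<in> lists B. length l = 0}"
      by (rule finite_subset[of _ "{[]}"]) auto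
    then show ?case using finite_ordLess_reg by blast
  next
    case (Suc n)
    have "{l \<in> lists B. length l = Suc n} \<subseteq> (\<lambda>(x, l). x # l) ` (B \<times> {l \<in> lists B. length l = n})"
      by (auto simp: length_Suc_conv image_iff)
    then have "|{l \<in> lists B. length l = Suc n}| \<le>o |B \<times> {l \<in> lists B. length l = n}|"
      by (rule surj_imp_ordLeq)
    then show ?case using Sigma_small[OF B Suc.IH] ordLeq_ordLess_trans by blast
  qed
  have "lists B = (\<Union>n. {l \<in> lists B. length l = n})" by auto
  moreover have "|UNIV :: nat set| <o |M|" using reg unfolding uncountable_regular_def by blast
  ultimately show ?thesis using UN_small[of UNIV "\<lambda>n. {l \<in> lists B. length l = n}"] len by simp
qed

lemma Fpow_small:
  assumes B: "|B| <o |M|"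
  shows "|Fpow B| <o |M|"
proof -
  have "Fpow B \<subseteq> set ` lists B"
    unfolding Fpow_def using finite_list by (fastforce simp: image_iff)
  then show ?thesis
    by (rule ordLeq_ordLess_trans[OF surj_imp_ordLeq lists_small[OF B]])
qed

end

lemma uncountable_regular_cong:
  assumes "uncountable_regular M" "|M'| =o |M|"
  shows "uncountable_regular M'"
  using assms unfolding uncountable_regular_def
  using stable_ordIso1 ordLess_ordIso_trans ordIso_symmetric by blast

section \<open>Greedy thinning of a well-ordered set\<close>

context
  notes conj_cong [fundef_cong]
begin

text \<open>The conjunct \<open>x \<in> {..<y}\<close> stands before the recursive call so that
  \<open>conj_cong\<close> hands it to the termination proof.\<close>

function greedy_mem :: "('a::wellorder set \<Rightarrow> 'a \<Rightarrow> bool) \<Rightarrow> 'a \<Rightarrow> bool" where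
  "greedy_mem \<Phi> y = \<Phi> {x \<in> {..<y}. greedy_mem \<Phi> x} y"
  by auto
termination
  by (relation "inv_image {(x, y). x < y} snd") (auto intro: wf)

end

declare greedy_mem.simps [simp del]

text \<open>Scan the points in order and take each one that fits those taken before. Were
  \<open>H\<close> smaller than \<open>L\<close>, \<open>ext\<close> would give a fitting point
  above all of \<open>H\<close>, and the scan would have taken it.\<close>

lemma greedy_subset:
  fixes M :: "'a::wellorder set"
  assumes ext: "\<And>B. \<lbrakk>B \<subseteq> M; |B| <o |L|\<rbrakk> \<Longrightarrow> \<exists>y\<in>M. (\<forall>x\<in>B. x < y) \<and> \<Phi> B y"
  obtains H where "H \<subseteq> M" "|L| \<le>o |H|" "\<And>y. y \<in> H \<Longrightarrow> \<Phi> (H \<inter> {..<y}) y"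
proof -
  define \<Psi> where "\<Psi> B y \<longleftrightarrow> y \<in> M \<and> \<Phi> B y" for B y
  define H where "H = {y. greedy_mem \<Psi> y}"
  have H: "y \<in> H \<longleftrightarrow> y \<in> M \<and> \<Phi> (H \<inter> {..<y}) y" for y
  proof -
    have "{x \<in> {..<y}. greedy_mem \<Psi> x} = H \<inter> {..<y}" unfolding H_def by auto
    then show ?thesis unfolding H_def using greedy_mem.simps[of \<Psi> y] \<Psi>_def by simp
  qed
  have "\<not> |H| <o |L|"
  proof
    assume "|H| <o |L|"
    then obtain y where y: "y \<in> M" "\<forall>x\<in>H. x < y" "\<Phi> H y"
      using ext[of H] H by blast
    then have "H \<inter> {..<y} = H" by auto
    then have "y \<in> H" using y H by simp
    then show False using y by blast
  qed
  then show ?thesis using that[of H] H by (auto simp: ordLess_not_ordLeq)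
qed

text \<open>\<open>X q\<close> collects the points that must not be added above the finite set \<open>q\<close>.\<close>

lemma greedy_avoid:
  fixes M :: "'a::wellorder set"
  assumes reg: "uncountable_regular M"
    and init: "\<And>x. x \<in> M \<Longrightarrow> |M \<inter> {..<x}| <o |M|"
    and X: "\<And>q. \<lbrakk>finite q; q \<subseteq> M\<rbrakk> \<Longrightarrow> |M \<inter> X q| <o |M|"
  shows "\<exists>H\<subseteq>M. |H| =o |M| \<and> (\<forall>y\<in>H. \<forall>q. finite q \<and> q \<subseteq> H \<and> (\<forall>x\<in>q. x < y) \<longrightarrow> y \<notin> X q)"
proof -
  define \<Phi> where "\<Phi> B y \<longleftrightarrow> (\<forall>q. finite q \<and> q \<subseteq> B \<longrightarrow> y \<notin> X q)" for B y
  have "\<exists>y\<in>M. (\<forall>x\<in>B. x < y) \<and> \<Phi> B y" if B: "B \<subseteq> M" "|B| <o |M|" for B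
  proof -
    \<comment> \<open>The points not above all of \<open>B\<close>, and those excluded by some
      finite subset of \<open>B\<close>; there are few such subsets by
      \<open>Fpow_small\<close>.\<close>
    define bad where "bad = (\<Union>x\<in>B. M \<inter> {..<x} \<union> {x}) \<union> (\<Union>q\<in>Fpow B. M \<inter> X q)"
    have "|\<Union>x\<in>B. M \<inter> {..<x} \<union> {x}| <o |M|"
      by (rule UN_small[OF reg B(2)], rule Un_small[OF reg])
        (use B init finite_ordLess_reg[OF reg, of "{_}"] in auto)
    moreover have "|\<Union>q\<in>Fpow B. M \<inter> X q| <o |M|"
      by (rule UN_small[OF reg Fpow_small[OF reg B(2)]], rule X) (use B in \<open>auto simp: Fpow_def\<close>)
    ultimately have "|bad| <o |M|" unfolding bad_def using Un_small[OF reg] by blast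
    then have "\<not> M \<subseteq> bad" using card_of_mono1 ordLess_not_ordLeq by blast
    then obtain y where y: "y \<in> M" "y \<notin> bad" by blast
    have "x < y" if "x \<in> B" for x
    proof -
      have "y \<notin> M \<inter> {..<x} \<union> {x}" using y(2) that unfolding bad_def by blast
      then show ?thesis using y(1) by auto
    qed
    moreover have "\<Phi> B y" unfolding \<Phi>_def using y unfolding bad_def Fpow_def by blast
    ultimately show ?thesis using y by blast
  qed
  then obtain H where H: "H \<subseteq> M" "|M| \<le>o |H|" "\<And>y. y \<in> H \<Longrightarrow> \<Phi> (H \<inter> {..<y}) y"
    using greedy_subset[of M M \<Phi>] by metis
  show ?thesis
  proof (intro exI[of _ H] conjI ballI allI impI)
    show "|H| =o |M|" using H(1,2) card_of_mono1 ordIso_iff_ordLeq by blast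
    fix y q assume "y \<in> H" "finite q \<and> q \<subseteq> H \<and> (\<forall>x\<in>q. x < y)"
    then show "y \<notin> X q" using H(3)[of y] unfolding \<Phi>_def by blast
  qed (rule H(1))
qed

section \<open>End-homogeneous sets\<close>

context
  notes conj_cong [fundef_cong]
begin

text \<open>Whether \<open>y\<close> lies below \<open>x\<close> is tested against the path of
  \<open>y\<close>, not that of \<open>x\<close>, so the recursion only descends to smaller
  points.\<close>

function tree_path :: "('a::wellorder set \<Rightarrow> 'a \<Rightarrow> 'a \<Rightarrow> bool) \<Rightarrow> 'a \<Rightarrow> 'a set" where
  "tree_path E x = {y \<in> {..<x}. E (tree_path E y) y x}"
  by auto
termination
  by (relation "inv_image {(x, y). x < y} snd") (auto intro: wf)

text \<open>Height measured inside \<open>T\<close>. With \<open>T\<close> the whole type and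
  \<open>P\<close> constant the same recursion computes order types of initial segments, which is
  how \<open>ordinal_rank\<close> uses it.\<close>

function tree_rank :: "'t::wellorder set \<Rightarrow> ('a::wellorder \<Rightarrow> 'a set) \<Rightarrow> 'a \<Rightarrow> 't" where
  "tree_rank T P x = (LEAST t. t \<in> T \<and> t \<notin> tree_rank T P ` {y \<in> {..<x}. y \<in> P x})"
  by auto
termination
  by (relation "inv_image {(x, y). x < y} (\<lambda>(T, P, x). x)") (auto intro: wf)

end

declare tree_path.simps [simp del] tree_rank.simps [simp del]

context
  fixes M :: "'a::wellorder set"
    and sat :: "'a \<Rightarrow> 'a list \<Rightarrow> 'q \<Rightarrow> bool"
    and Q :: "'q set"
begin

text \<open>\<open>sat x l q\<close> is to be read as: \<open>x\<close> satisfies the formula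
  \<open>q\<close> with parameters \<open>l\<close>. Then \<open>same_type\<close> is equality of
  types over \<open>B\<close>; lists let formulas of all arities share one predicate.\<close>

definition same_type :: "'a set \<Rightarrow> 'a \<Rightarrow> 'a \<Rightarrow> bool" where
  "same_type B x y \<longleftrightarrow> (\<forall>l\<in>lists B. \<forall>q\<in>Q. sat x l q \<longleftrightarrow> sat y l q)"

text \<open>The predecessors of \<open>x\<close> in the Erdos--Rado ramification tree.\<close>

definition preds :: "'a \<Rightarrow> 'a set" where
  "preds = tree_path (\<lambda>B y x. y \<in> M \<and> same_type B y x)"

lemma preds_iff: "y \<in> preds x \<longleftrightarrow> y \<in> M \<and> y < x \<and> same_type (preds y) y x"
  unfolding preds_def by (subst tree_path.simps) auto

lemma same_type_mono: "same_type B x y \<Longrightarrow> A \<subseteq> B \<Longrightarrow> same_type A x y"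
  unfolding same_type_def using lists_mono by blast

lemma same_type_trans: "same_type B x y \<Longrightarrow> same_type B y z \<Longrightarrow> same_type B x z"
  unfolding same_type_def by blast

lemma same_type_sym: "same_type B x y \<Longrightarrow> same_type B y x"
  unfolding same_type_def by blast

text \<open>This makes the relation a tree. Over \<open>preds z\<close> the points \<open>z\<close>
  and \<open>x\<close> have the same type, so a smaller \<open>y\<close> with \<open>preds y\<close>
  inside \<open>preds z\<close> looks like one exactly if it looks like the other. The inner
  induction provides that inclusion.\<close>

lemma preds_of_pred: "z \<in> preds x \<Longrightarrow> preds z = preds x \<inter> {..<z}"
proof (induction z arbitrary: x rule: less_induct)
  case (less z)
  have z: "same_type (preds z) z x" using less.prems by (simp add: preds_iff)
  have "y \<in> preds z" if "y \<in> preds x" "y < z" for y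
    using that
  proof (induction y rule: less_induct)
    case (less y)
    have "preds y = preds x \<inter> {..<y}" using \<open>\<And>y x. y < z \<Longrightarrow> y \<in> preds x \<Longrightarrow> _\<close> less.prems by blast
    then have "preds y \<subseteq> preds z" using less.IH less.prems by auto
    then have "same_type (preds y) y z"
      using less.prems(1) z same_type_mono same_type_trans same_type_sym by (meson preds_iff)
    then show ?case using less.prems by (simp add: preds_iff)
  qed
  moreover have "y \<in> preds x" if "y \<in> preds z" for y
  proof -
    have "y < z" using that by (simp add: preds_iff)
    then have "preds y \<subseteq> preds z" using less.IH that by blast
    then have "same_type (preds y) y x"
      using that z same_type_mono same_type_trans by (meson preds_iff)
    then show ?thesis using that \<open>y < z\<close> less.prems by (auto simp: preds_iff)
  qed
  moreover have "y < z" if "y \<in> preds z" for y using that preds_iff by blast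
  ultimately show ?case by blast
qed

text \<open>Along a branch the rank is the height in the tree, so a node is determined by its rank
  together with the type it realises over its predecessors, transported along the ranks. This
  bounds the size of a tree all of whose branches are short.\<close>

lemma card_le_if_short_branches:
  fixes T :: "'t::wellorder set"
  assumes init: "\<And>t. t \<in> T \<Longrightarrow> |T \<inter> {..<t}| <o |T|"
    and short: "\<And>x. x \<in> M \<Longrightarrow> |preds x| <o |T|"
  shows "|M| \<le>o |SIGMA t:T. Pow (lists (T \<inter> {..<t}) \<times> Q)|"
proof -
  define rk where "rk = tree_rank T preds"
  have rk_eq: "rk x = (LEAST t. t \<in> T \<and> t \<notin> rk ` preds x)" for x
  proof -
    have "{y \<in> {..<x}. y \<in> preds x} = preds x" by (auto simp: preds_iff)
    then show ?thesis unfolding rk_def by (subst tree_rank.simps) simp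
  qed
  have ex: "\<exists>t. t \<in> T \<and> t \<notin> rk ` preds x" if "x \<in> M" for x
  proof (rule ccontr)
    assume "\<not> ?thesis"
    then have "T \<subseteq> rk ` preds x" by blast
    then have "|T| \<le>o |preds x|" by (rule surj_imp_ordLeq)
    then show False using short[OF that] by (simp add: ordLess_not_ordLeq)
  qed
  have rk: "rk x \<in> T" "rk x \<notin> rk ` preds x" if "x \<in> M" for x
    using LeastI_ex[OF ex[OF that]] unfolding rk_eq[of x] by blast+
  have rk_le: "rk x \<le> t" if "t \<in> T" "t \<notin> rk ` preds x" for x t
    unfolding rk_eq[of x] by (rule Least_le) (use that in blast)
  have predM: "y \<in> M" if "y \<in> preds x" for x y using that by (simp add: preds_iff)
  have rk_less: "rk z < rk x" if "x \<in> M" "z \<in> preds x" for x z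
  proof -
    have "preds z \<subseteq> preds x" using preds_of_pred that by blast
    then have "rk x \<notin> rk ` preds z" using rk[OF that(1)] by blast
    then have "rk z \<le> rk x" using rk_le rk[OF that(1)] by blast
    moreover have "rk z \<noteq> rk x" using rk(2)[OF that(1)] that(2) by (metis imageI)
    ultimately show ?thesis by simp
  qed
  have inj: "inj_on rk (preds x)" for x
  proof (rule inj_onI)
    fix y z assume yz: "y \<in> preds x" "z \<in> preds x" "rk y = rk z"
    have "rk y < rk z" if "y < z" "y \<in> preds x" "z \<in> preds x" for y z
      using rk_less[of z y] preds_of_pred[OF that(3)] that predM by blast
    then show "y = z" using yz by (metis less_irrefl neqE)
  qed
  have rk_image: "rk ` preds x = T \<inter> {..<rk x}" if "x \<in> M" for x
    using rk_less[OF that] rk(1) predM rk_le by (force simp: not_le)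
  define code where "code x = (rk x, {(map rk l, q) |l q. l \<in> lists (preds x) \<and> q \<in> Q \<and> sat x l q})" for x
  have sat_code: "sat x l q \<longleftrightarrow> (map rk l, q) \<in> snd (code x)"
    if "l \<in> lists (preds x)" "q \<in> Q" for x l q
  proof -
    have "l' = l" if "map rk l = map rk l'" "l' \<in> lists (preds x)" for l'
    proof -
      have "set l' \<union> set l \<subseteq> preds x" using that \<open>l \<in> lists (preds x)\<close> by auto
      then show ?thesis using map_inj_on that(1) inj_on_subset[OF inj] by metis
    qed
    then show ?thesis using that unfolding code_def by auto
  qed
  have "inj_on code M"
  proof (rule inj_onI)
    fix x y assume x: "x \<in> M" and y: "y \<in> M" and eq: "code x = code y"
    have rkxy: "rk x = rk y" using eq by (simp add: code_def)
    have agree: "same_type B x y" if "B \<subseteq> preds x" "B \<subseteq> preds y" for B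
      unfolding same_type_def
    proof (intro ballI)
      fix l q assume "l \<in> lists B" "q \<in> Q"
      then show "sat x l q = sat y l q"
        using sat_code[of l x q] sat_code[of l y q] eq that by (auto simp: in_lists_conv_set subset_iff)
    qed
    have image_eq: "A = B" if "rk ` A = rk ` B" "\<And>a b. \<lbrakk>a \<in> A; b \<in> B; rk a = rk b\<rbrakk> \<Longrightarrow> a = b"
      for A B
    proof (intro equalityI subsetI)
      fix a assume "a \<in> A"
      then have "rk a \<in> rk ` B" using that(1) by blast
      then obtain b where "b \<in> B" "rk a = rk b" by blast
      then show "a \<in> B" using that(2)[of a b] \<open>a \<in> A\<close> by simp
    next
      fix b assume "b \<in> B"
      then have "rk b \<in> rk ` A" using that(1) by blast
      then obtain a where "a \<in> A" "rk b = rk a" by blast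
      then show "b \<in> A" using that(2)[of a b] \<open>b \<in> B\<close> by simp
    qed
    \<comment> \<open>Otherwise the smaller of the two would be a predecessor of the larger, hence
      of itself.\<close>
    have step: "z = w" if "z \<in> M" "w \<in> M" "preds z = preds w" "same_type (preds z) z w" for z w
    proof (rule ccontr)
      assume "z \<noteq> w"
      then have "z < w \<or> w < z" by auto
      then have "z \<in> preds z \<or> w \<in> preds w" using that by (metis preds_iff same_type_sym)
      then show False by (simp add: preds_iff)
    qed
    \<comment> \<open>Bottom-up along both branches: \<open>z\<close> has the type of
      \<open>x\<close> over \<open>preds z\<close>, \<open>w\<close> that of \<open>y\<close>, and
      equal codes make \<open>x\<close> and \<open>y\<close> agree over the common part.\<close>
    have same: "z = w" if "z \<in> preds x" "w \<in> preds y" "rk z = rk w" for z w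
      using that
    proof (induction z arbitrary: w rule: less_induct)
      case (less z)
      have zM: "z \<in> M" and wM: "w \<in> M" using less.prems predM by blast+
      have im: "rk ` preds z = rk ` preds w" using rk_image zM wM less.prems by simp
      have sub: "preds z \<subseteq> preds x" "preds w \<subseteq> preds y" using preds_of_pred less.prems by blast+
      have "a = b" if "a \<in> preds z" "b \<in> preds w" "rk a = rk b" for a b
      proof -
        have "a < z" using that preds_iff by blast
        then show ?thesis using less.IH[of a b] that sub by blast
      qed
      then have eqp: "preds z = preds w" using image_eq[OF im] by blast
      have "same_type (preds z) z x" using less.prems(1) preds_iff by blast
      moreover have "same_type (preds w) y w" using less.prems(2) preds_iff same_type_sym by blast
      then have "same_type (preds z) y w" by (simp only: eqp)
      moreover have "same_type (preds z) x y" using agree sub eqp by simp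
      ultimately show ?case using step[OF zM wM eqp] same_type_trans by blast
    qed
    have "rk ` preds x = rk ` preds y" using rk_image x y rkxy by simp
    then have "preds x = preds y" using image_eq same by blast
    then show "x = y" using step[OF x y] agree by simp
  qed
  moreover have "code ` M \<subseteq> (SIGMA t:T. Pow (lists (T \<inter> {..<t}) \<times> Q))"
  proof -
    have "map rk l \<in> lists (T \<inter> {..<rk x})" if "x \<in> M" "l \<in> lists (preds x)" for x l
      using rk_image[OF that(1)] that(2) by (auto simp: in_lists_conv_set)
    then show ?thesis unfolding code_def using rk(1) by auto
  qed
  ultimately show ?thesis using card_of_ordLeq by blast
qed

end

text \<open>If all branches were shorter than \<open>|T|\<close>, there would be at most
  \<open>|T| \<le>o |X|\<close> ranks with at most \<open>|X|\<close> types at each, so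
  \<open>|M| \<le>o |X|\<close>. Here \<open>X\<close> plays the role of 2^{<|T|}.\<close>

lemma end_homogeneous:
  fixes M :: "'a::wellorder set" and T :: "'t::wellorder set"
    and sat :: "'a \<Rightarrow> 'a list \<Rightarrow> 'q \<Rightarrow> bool"
  assumes reg: "uncountable_regular T"
    and init: "\<And>t. t \<in> T \<Longrightarrow> |T \<inter> {..<t}| <o |T|"
    and Q: "|Q| <o |T|"
    and X: "\<And>A. \<lbrakk>A \<subseteq> T; |A| <o |T|\<rbrakk> \<Longrightarrow> |Pow A| \<le>o |X|"
    and M: "|X| <o |M|"
  obtains \<delta> A where "\<delta> \<in> M" "A \<subseteq> M" "|A| =o |T|" "\<And>x. x \<in> A \<Longrightarrow> x < \<delta>"
    "\<And>x. x \<in> A \<Longrightarrow> |A \<inter> {..<x}| <o |A|"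
    "\<And>x l q. \<lbrakk>x \<in> A; set l \<subseteq> A \<inter> {..<x}; q \<in> Q\<rbrakk> \<Longrightarrow> sat x l q \<longleftrightarrow> sat \<delta> l q"
proof -
  let ?P = "preds M sat Q"
  have TX: "|T| \<le>o |X|" by (rule card_le_if_Pow_le[OF X])
  then have Xinf: "infinite X" using reg_infinite[OF reg] card_of_ordLeq_finite by blast
  have "\<exists>x. x \<in> M \<and> \<not> |?P x| <o |T|"
  proof (rule ccontr)
    assume "\<not> ?thesis"
    then have short: "\<And>x. x \<in> M \<Longrightarrow> |?P x| <o |T|" by blast
    have "|Pow (lists (T \<inter> {..<t}) \<times> Q)| \<le>o |X|" if "t \<in> T" for t
    proof -
      have small: "|lists (T \<inter> {..<t}) \<times> Q| <o |T|"
        by (rule Sigma_small[OF reg lists_small[OF reg init[OF that]] Q])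
      obtain A where A: "A \<subseteq> T" "|lists (T \<inter> {..<t}) \<times> Q| =o |A|"
        using obtain_subset_of_card[OF ordLess_imp_ordLeq[OF small]] by metis
      then have AT: "|A| <o |T|" using small ordIso_ordLess_trans ordIso_symmetric by blast
      have "|Pow (lists (T \<inter> {..<t}) \<times> Q)| \<le>o |Pow A|"
        by (rule card_of_Pow_mono[OF ordIso_imp_ordLeq[OF A(2)]])
      then show ?thesis using X[OF A(1) AT] by (rule ordLeq_transitive)
    qed
    then have "|SIGMA t:T. Pow (lists (T \<inter> {..<t}) \<times> Q)| \<le>o |X|"
      by (intro card_of_Sigma_ordLeq_infinite[OF Xinf TX] ballI)
    with card_le_if_short_branches[OF init short] have "|M| \<le>o |X|"
      by (rule ordLeq_transitive)
    then show False using M by (simp add: ordLess_not_ordLeq)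
  qed
  \<comment> \<open>Minimality of \<open>\<delta>\<close> makes its branch exactly as long as
    \<open>T\<close>: every predecessor is smaller than \<open>\<delta>\<close> and so has fewer
    than \<open>|T|\<close> predecessors itself.\<close>
  from iffD1[OF exists_least_iff this]
  obtain \<delta> where \<delta>: "\<delta> \<in> M" "\<not> |?P \<delta>| <o |T|"
    and least: "\<And>y. y < \<delta> \<Longrightarrow> \<not> (y \<in> M \<and> \<not> |?P y| <o |T| )"
    by blast
  define A where "A = ?P \<delta>"
  have preds: "?P x = A \<inter> {..<x}" if "x \<in> A" for x
    using preds_of_pred that unfolding A_def by blast
  have A: "x \<in> M" "x < \<delta>" "same_type sat Q (A \<inter> {..<x}) x \<delta>" if "x \<in> A" for x
    using that preds[OF that] preds_iff[of x M sat Q \<delta>] unfolding A_def by auto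
  have small: "|A \<inter> {..<x}| <o |T|" if "x \<in> A" for x
    using least[of x] A[OF that] preds[OF that] by auto
  have AT: "|A| =o |T|"
    using \<delta>(2) card_le_if_initial_small[OF small] unfolding A_def[symmetric]
    by (auto simp: ordIso_iff_ordLeq ordLess_not_ordLeq)
  show ?thesis
  proof (rule that[OF \<delta>(1) _ AT])
    show "A \<subseteq> M" using A by blast
    show "x < \<delta>" if "x \<in> A" for x using A that by blast
    show "|A \<inter> {..<x}| <o |A|" if "x \<in> A" for x
      using small[OF that] AT ordLess_ordIso_trans ordIso_symmetric by blast
    show "sat x l q \<longleftrightarrow> sat \<delta> l q" if "x \<in> A" "set l \<subseteq> A \<inter> {..<x}" "q \<in> Q" for x l q
      using A(3)[OF that(1)] that unfolding same_type_def by (simp add: in_lists_conv_set subset_iff)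
  qed
qed

section \<open>Dimension one\<close>

lemma card_of_Func_mono:
  assumes "|D| =o |R|" "|B| \<le>o |C|"
  shows "|Func D B| \<le>o |Func R C|"
proof -
  have "|B| ^c |D| \<le>o |C| ^c |R|"
  proof (rule cexp_mono[OF assms(2) ordIso_imp_ordLeq[OF assms(1)]])
    have "D = {} \<longleftrightarrow> R = {}"
      using assms(1) unfolding card_of_ordIso[symmetric] by (metis bij_betw_empty1 bij_betw_empty2)
    then show "|D| =o czero \<Longrightarrow> |R| =o czero"
      by (simp add: card_of_ordIso_czero_iff_empty)
  qed (rule card_of_Card_order)
  then show ?thesis by (simp add: cexp_def Field_card_of)
qed

lemma card_of_Pow_le_Func:
  assumes "a \<noteq> b"
  shows "|Pow D| \<le>o |Func D {a, b}|"
proof (rule card_of_ordLeqI)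
  let ?\<chi> = "\<lambda>S i. if i \<in> D then if i \<in> S then a else b else undefined"
  show "inj_on ?\<chi> (Pow D)"
    using assms by (auto simp: inj_on_def fun_eq_iff split: if_splits)
  show "?\<chi> S \<in> Func D {a, b}" for S by (auto simp: Func_def)
qed

section \<open>Transfinite closing off and the Delta-system lemma\<close>

function chain_union :: "('v set \<Rightarrow> 'v set) \<Rightarrow> 'a::wellorder set \<Rightarrow> 'a \<Rightarrow> 'v set" where
  "chain_union E M y = (\<Union>w\<in>{w \<in> {..<y}. w \<in> M}. E (chain_union E M w))"
  by auto
termination
  by (relation "inv_image {(x, y). x < y} (\<lambda>(E, M, x). x)") (auto intro: wf)

declare chain_union.simps [simp del]

lemma chain_union_eq: "chain_union E M y = (\<Union>w\<in>M \<inter> {..<y}. E (chain_union E M w))"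
  by (subst chain_union.simps) auto

text \<open>By regularity the points of \<open>M\<close> that fail to lie above all of
  \<open>B\<close> form a small set, which cannot contain \<open>S\<close>.\<close>

lemma above_small:
  fixes M :: "'a::wellorder set"
  assumes reg: "uncountable_regular M"
    and init: "\<And>x. x \<in> M \<Longrightarrow> |M \<inter> {..<x}| <o |M|"
    and B: "B \<subseteq> M" "|B| <o |M|" and S: "S \<subseteq> M" "\<not> |S| <o |M|"
  shows "\<exists>y\<in>S. \<forall>x\<in>B. x < y"
proof -
  have "|\<Union>x\<in>B. M \<inter> {..<x} \<union> {x}| <o |M|"
    by (rule UN_small[OF reg B(2)], rule Un_small[OF reg])
      (use B init finite_ordLess_reg[OF reg, of "{_}"] in auto)
  then have "\<not> S \<subseteq> (\<Union>x\<in>B. M \<inter> {..<x} \<union> {x})"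
    using S(2) card_of_mono1 ordLeq_ordLess_trans by blast
  then obtain y where y: "y \<in> S" "\<forall>x\<in>B. y \<notin> M \<inter> {..<x} \<union> {x}" by blast
  then have "\<forall>x\<in>B. x < y" using S(1) by force
  then show ?thesis using y by blast
qed

context
  fixes M :: "'a::wellorder set" and D :: "'i set" and h :: "'a \<Rightarrow> 'i \<Rightarrow> 'v"
  assumes reg: "uncountable_regular M"
    and init: "\<And>x. x \<in> M \<Longrightarrow> |M \<inter> {..<x}| <o |M|"
    and exp: "\<And>B :: 'v option set. |B| <o |M| \<Longrightarrow> |Func D B| <o |M|"
begin

text \<open>\<open>None\<close> marks a value outside \<open>C\<close>, whichever it is;
  \<open>undefined\<close> outside \<open>D\<close> makes the trace a member of \<open>Func\<close>,
  so that traces can be counted by \<open>exp\<close>.\<close>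

definition trace :: "'v set \<Rightarrow> 'a \<Rightarrow> 'i \<Rightarrow> 'v option" where
  "trace C x i = (if i \<in> D then if h x i \<in> C then Some (h x i) else None else undefined)"

definition traces :: "'v set \<Rightarrow> ('i \<Rightarrow> 'v option) set" where
  "traces C = Func D (insert None (Some ` C))"

lemma trace_in: "trace C x \<in> traces C"
  unfolding trace_def traces_def Func_def by auto

lemma traces_small:
  assumes "|C| <o |M|"
  shows "|traces C| <o |M|"
proof -
  have "|Some ` C| <o |M|" by (rule ordLeq_ordLess_trans[OF card_of_image assms])
  then have "|{None} \<union> Some ` C| <o |M|"
    using Un_small[OF reg] finite_ordLess_reg[OF reg, of "{None}"] by blast
  then show ?thesis unfolding traces_def using exp[of "{None} \<union> Some ` C"] by simp
qed

lemma trace_eq_if_new_values_avoided: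
  assumes "B \<subseteq> C" "\<And>i. i \<in> D \<Longrightarrow> h x i \<in> C \<Longrightarrow> h x i \<in> B"
  shows "trace C x = trace B x"
  using assms unfolding trace_def by (auto simp: fun_eq_iff)

text \<open>If every \<open>B\<close> and \<open>t\<close> had a small counterexample \<open>C\<close>, then closing off along an initial segment
  of \<open>M\<close> of size above \<open>|D|\<close> would give some \<open>x\<close> with a new index \<open>i\<close> at every stage.\<close>

lemma stationary_trace:
  obtains B t where "|B| <o |M|" "t \<in> traces B"
    "\<And>C. \<lbrakk>B \<subseteq> C; |C| <o |M|\<rbrakk> \<Longrightarrow> \<not> |{x\<in>M. trace C x = t}| <o |M|"
proof (rule ccontr)
  assume no_trace: "\<not> thesis"
  define P where "P B t C \<longleftrightarrow> ( |B| <o |M| \<and> t \<in> traces B \<longrightarrow>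
      B \<subseteq> C \<and> |C| <o |M| \<and> |{x\<in>M. trace C x = t}| <o |M| )" for B t C
  have "\<exists>C. P B t C" for B t
    using that[of B t] no_trace unfolding P_def by blast
  then obtain Z where "\<And>B t. P B t (Z B t)" by metis
  then have Z: "\<And>B t. |B| <o |M| \<Longrightarrow> t \<in> traces B \<Longrightarrow>
      B \<subseteq> Z B t \<and> |Z B t| <o |M| \<and> |{x\<in>M. trace (Z B t) x = t}| <o |M|"
    unfolding P_def by blast
  \<comment> \<open>One small set that refutes every trace over \<open>B\<close> simultaneously:
    outside a small set of exceptions, each \<open>x\<close> takes a value in
    \<open>E B - B\<close>.\<close>
  define E where "E B = (\<Union>t\<in>traces B. Z B t)" for B
  define Bs where "Bs = chain_union E M"
  have Bs_eq: "Bs y = (\<Union>w\<in>M \<inter> {..<y}. E (Bs w))" for y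
    unfolding Bs_def by (rule chain_union_eq)
  have E_small: "|E B| <o |M|" if "|B| <o |M|" for B
    unfolding E_def by (rule UN_small[OF reg traces_small[OF that]]) (use Z that in blast)
  have Bs_small: "|Bs y| <o |M|" if "y \<in> M" for y
    using that
  proof (induction y rule: less_induct)
    case (less y)
    then have "|\<Union>w\<in>M \<inter> {..<y}. E (Bs w)| <o |M|"
      by (intro UN_small[OF reg init] E_small) auto
    then show ?case by (subst Bs_eq)
  qed
  define bad where "bad y = (\<Union>t\<in>traces (Bs y). {x\<in>M. trace (Z (Bs y) t) x = t})" for y
  have bad_small: "|bad y| <o |M|" if "y \<in> M" for y
    unfolding bad_def
    by (rule UN_small[OF reg traces_small[OF Bs_small[OF that]]]) (use Z Bs_small that in blast)
  have new: "\<exists>i\<in>D. h x i \<in> E (Bs y) - Bs y" if "x \<in> M" "y \<in> M" "x \<notin> bad y" for x y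
  proof (rule ccontr)
    assume *: "\<not> ?thesis"
    let ?t = "trace (Bs y) x"
    have t: "?t \<in> traces (Bs y)" by (rule trace_in)
    have "trace (Z (Bs y) ?t) x = ?t"
    proof (rule trace_eq_if_new_values_avoided)
      show "Bs y \<subseteq> Z (Bs y) ?t" using Z Bs_small that(2) t by blast
      show "h x i \<in> Bs y" if "i \<in> D" "h x i \<in> Z (Bs y) ?t" for i
        using * that t unfolding E_def by blast
    qed
    then show False using that t unfolding bad_def by blast
  qed
  \<comment> \<open>Functions into two values already show that \<open>|Pow D|\<close> is small, so
    \<open>M\<close> has a proper initial segment with more stages than there are indices.\<close>
  have "|Pow D| \<le>o |Func D {None, Some undefined :: 'v option}|"
    by (rule card_of_Pow_le_Func) simp
  then have PowD: "|Pow D| <o |M|"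
    using exp[of "{None, Some undefined}"] finite_ordLess_reg[OF reg, of "{None, Some undefined}"]
      ordLeq_ordLess_trans by blast
  obtain W where W: "W \<subseteq> M" "|Pow D| =o |W|"
    using obtain_subset_of_card[OF ordLess_imp_ordLeq[OF PowD]] by metis
  have "|W| <o |M|" using W(2) PowD ordIso_symmetric ordIso_ordLess_trans by blast
  then obtain z where z: "z \<in> M" "\<forall>x\<in>W. x < z"
    using above_small[OF reg init W(1), of M] ordLess_irreflexive by blast
  then have "W \<subseteq> M \<inter> {..<z}" using W(1) by auto
  then have PowDz: "|Pow D| \<le>o |M \<inter> {..<z}|"
    using W(2) card_of_mono1 ordIso_ordLeq_trans by blast
  have "|\<Union>y\<in>M \<inter> {..<z}. bad y| <o |M|"
    by (rule UN_small[OF reg init[OF z(1)]]) (use bad_small in blast)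
  then have "\<not> M \<subseteq> (\<Union>y\<in>M \<inter> {..<z}. bad y)"
    using card_of_mono1 ordLess_not_ordLeq by blast
  then obtain x where x: "x \<in> M" "\<And>y. y \<in> M \<Longrightarrow> y < z \<Longrightarrow> x \<notin> bad y" by blast
  then have "\<exists>i. y \<in> M \<inter> {..<z} \<longrightarrow> i \<in> D \<and> h x i \<in> E (Bs y) - Bs y" for y
    using new[of x y] by blast
  then obtain \<iota> where \<iota>: "\<And>y. y \<in> M \<inter> {..<z} \<Longrightarrow> \<iota> y \<in> D \<and> h x (\<iota> y) \<in> E (Bs y) - Bs y"
    by metis
  \<comment> \<open>The value found at stage \<open>y\<close> belongs to every later
    \<open>Bs w\<close>, whereas the one found at stage \<open>w\<close> lies outside
    \<open>Bs w\<close>.\<close>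
  have "\<iota> y \<noteq> \<iota> w" if "y < w" "y \<in> M \<inter> {..<z}" "w \<in> M \<inter> {..<z}" for y w
  proof -
    have "E (Bs y) \<subseteq> Bs w" using that Bs_eq[of w] by blast
    then show ?thesis using \<iota>[OF that(2)] \<iota>[OF that(3)] by auto
  qed
  then have "inj_on \<iota> (M \<inter> {..<z})"
    unfolding inj_on_def by (metis neqE)
  then have "|M \<inter> {..<z}| \<le>o |D|"
    using card_of_ordLeq \<iota> by (metis image_subsetI)
  then have "|Pow D| \<le>o |D|" using PowDz ordLeq_transitive by blast
  then show False using card_of_Pow ordLess_not_ordLeq by blast
qed

text \<open>A stationary trace \<open>t\<close> recurs over every small extension of
  \<open>B\<close>. Points are therefore picked with trace \<open>t\<close> over \<open>B\<close>
  together with all values of earlier points. Where \<open>t\<close> is \<open>Some\<close>, the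
  value is constant; where it is \<open>None\<close>, the value avoids \<open>B\<close> and
  everything earlier. So \<open>J\<close> indexes the root.\<close>

lemma delta_system:
  assumes inj: "\<And>x. x \<in> M \<Longrightarrow> inj_on (h x) D"
  obtains H J where "H \<subseteq> M" "|H| =o |M|"
    "\<And>x y i j. \<lbrakk>x \<in> H; y \<in> H; i \<in> D; j \<in> D\<rbrakk> \<Longrightarrow> h x i = h y j \<longleftrightarrow> i = j \<and> (i \<in> J \<or> x = y)"
proof -
  obtain B t where B: "|B| <o |M|" and t: "t \<in> traces B"
    and large: "\<And>C. \<lbrakk>B \<subseteq> C; |C| <o |M|\<rbrakk> \<Longrightarrow> \<not> |{x\<in>M. trace C x = t}| <o |M|"
    using stationary_trace by blast
  define V where "V S = B \<union> (\<Union>x\<in>S. h x ` D)" for S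
  have Dsmall: "|D| <o |M|"
  proof -
    have "|Pow D| \<le>o |Func D {None, Some undefined :: 'v option}|"
      by (rule card_of_Pow_le_Func) simp
    then show ?thesis
      using exp[of "{None, Some undefined}"] finite_ordLess_reg[OF reg, of "{None, Some undefined}"]
        ordLeq_ordLess_trans card_of_Pow ordLess_transitive by blast
  qed
  have "\<exists>y\<in>M. (\<forall>x\<in>S. x < y) \<and> trace (V S) y = t" if S: "S \<subseteq> M" "|S| <o |M|" for S
  proof -
    have "|\<Union>x\<in>S. h x ` D| <o |M|"
      by (rule UN_small[OF reg S(2)]) (use Dsmall card_of_image ordLeq_ordLess_trans in blast)
    then have "|V S| <o |M|" unfolding V_def using B Un_small[OF reg] by blast
    then have "\<not> |{x\<in>M. trace (V S) x = t}| <o |M|" using large unfolding V_def by blast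
    then show ?thesis using above_small[OF reg init S, of "{x\<in>M. trace (V S) x = t}"] by blast
  qed
  then obtain H where H: "H \<subseteq> M" "|M| \<le>o |H|"
    and tr: "\<And>y. y \<in> H \<Longrightarrow> trace (V (H \<inter> {..<y})) y = t"
    using greedy_subset[of M M "\<lambda>S y. trace (V S) y = t"] by metis
  define J where "J = {i\<in>D. t i \<noteq> None}"
  have inJ: "t i = Some (h x i)" "h x i \<in> B" if "x \<in> H" "i \<in> J" for x i
  proof -
    have "t i = trace (V (H \<inter> {..<x})) x i" using tr that by simp
    then show "t i = Some (h x i)" using that unfolding J_def trace_def by (auto split: if_splits)
    then show "h x i \<in> B" using that t unfolding J_def traces_def Func_def by auto
  qed
  have notJ: "h x i \<notin> V (H \<inter> {..<x})" if "x \<in> H" "i \<in> D - J" for x i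
  proof -
    have "t i = trace (V (H \<inter> {..<x})) x i" using tr that by simp
    then show ?thesis using that unfolding J_def trace_def by (auto split: if_splits)
  qed
  have less: "h x i = h y j \<longleftrightarrow> i = j \<and> i \<in> J" if "x \<in> H" "y \<in> H" "i \<in> D" "j \<in> D" "x < y" for x y i j
  proof (cases "j \<in> J")
    case True
    then have eq: "h y j = h x j" using inJ that by (metis option.inject)
    show ?thesis
    proof (cases "i \<in> J")
      case True
      then show ?thesis using eq inj[of x] that H(1) by (auto dest: inj_onD)
    next
      case False
      then show ?thesis using notJ[OF that(1), of i] inJ[OF that(2) True] that(3) True unfolding V_def by auto
    qed
  next
    case False
    have "h x i \<in> V (H \<inter> {..<y})" using that unfolding V_def by auto
    then show ?thesis using notJ[OF that(2), of j] that False by auto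
  qed
  show ?thesis
  proof (rule that[OF H(1)])
    show "|H| =o |M|" using H card_of_mono1 ordIso_iff_ordLeq by blast
    show "h x i = h y j \<longleftrightarrow> i = j \<and> (i \<in> J \<or> x = y)" if "x \<in> H" "y \<in> H" "i \<in> D" "j \<in> D" for x y i j
    proof (cases x y rule: linorder_cases)
      case equal
      then show ?thesis using inj[of x] that H(1) by (auto dest: inj_onD)
    qed (use less[of x y i j] less[of y x j i] that in auto)
  qed
qed

end

section \<open>Canonical families of tuples\<close>

text \<open>For finite sets this is the index that \<open>elem_at\<close> and \<open>is_pos\<close>
  speak about (\<open>finite_is_pos\<close>). The combinatorial part works with this cardinality
  alone; order types return only in the last section.\<close>

definition position :: "'a::linorder set \<Rightarrow> 'a \<Rightarrow> nat" where
  "position a x = card (a \<inter> {..<x})"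

definition at_positions :: "nat set \<Rightarrow> 'a::linorder set \<Rightarrow> 'a set" where
  "at_positions m a = {x \<in> a. position a x \<in> m}"

definition same_positions :: "'a::linorder set \<Rightarrow> 'a set \<Rightarrow> bool" where
  "same_positions a b \<longleftrightarrow> (\<forall>x\<in>a \<inter> b. position a x = position b x)"

lemma position_less:
  assumes "finite a" "x \<in> a" "x < y"
  shows "position a x < position a y"
  unfolding position_def by (rule psubset_card_mono) (use assms in auto)

lemma position_less_card:
  assumes "finite a" "x \<in> a"
  shows "position a x < card a"
  unfolding position_def by (rule psubset_card_mono) (use assms in auto)

lemma position_less_iff:
  assumes "finite a" "x \<in> a" "y \<in> a"
  shows "position a x < position a y \<longleftrightarrow> x < y"
  using position_less[OF assms(1)] assms by (metis linorder_cases order_less_asym order_less_irrefl)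

lemma position_eq_iff:
  assumes "finite a" "x \<in> a" "y \<in> a"
  shows "position a x = position a y \<longleftrightarrow> x = y"
  using position_less[OF assms(1)] assms by (metis linorder_cases order_less_irrefl)

lemma position_image:
  assumes "finite a"
  shows "position a ` a = {..<card a}"
proof (rule card_subset_eq)
  show "position a ` a \<subseteq> {..<card a}" using position_less_card assms by blast
  have "inj_on (position a) a" using position_eq_iff assms by (auto simp: inj_on_def)
  then show "card (position a ` a) = card {..<card a}" by (simp add: card_image)
qed simp

lemma position_cong: "a \<inter> {..<x} = b \<inter> {..<x} \<Longrightarrow> position a x = position b x"
  by (simp add: position_def)

lemma position_insert_top:
  assumes "\<forall>x\<in>a. x < \<alpha>"
  shows "x \<in> a \<Longrightarrow> position (insert \<alpha> a) x = position a x"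
    and "position (insert \<alpha> a) \<alpha> = card a"
proof -
  show "position (insert \<alpha> a) x = position a x" if "x \<in> a"
    by (rule position_cong) (use assms that in force)
  have "insert \<alpha> a \<inter> {..<\<alpha>} = a" using assms by auto
  then show "position (insert \<alpha> a) \<alpha> = card a" by (simp add: position_def)
qed

lemma nsetsD: "a \<in> [H]\<^bsup>n\<^esup> \<Longrightarrow> a \<subseteq> H \<and> finite a \<and> card a = n"
  by (simp add: nsets_def)

lemma nsets_Suc_topE:
  fixes c :: "'a::linorder set"
  assumes "c \<in> [H]\<^bsup>Suc n\<^esup>"
  obtains \<alpha> a where "c = insert \<alpha> a" "a \<in> [H]\<^bsup>n\<^esup>" "\<alpha> \<in> H" "\<forall>x\<in>a. x < \<alpha>" "\<alpha> \<notin> a"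
proof -
  have c: "c \<subseteq> H" "finite c" "card c = Suc n" using nsetsD[OF assms] by auto
  then have "c \<noteq> {}" by auto
  then have Max: "Max c \<in> c" using c by simp
  show ?thesis
  proof (rule that[of "Max c" "c - {Max c}"])
    show "c = insert (Max c) (c - {Max c})" using Max by blast
    show "c - {Max c} \<in> [H]\<^bsup>n\<^esup>" using c Max by (auto simp: nsets_def)
    show "\<forall>x\<in>c - {Max c}. x < Max c" using c Max by (simp add: order_less_le)
  qed (use Max c in auto)
qed

lemma insert_in_nsets:
  fixes \<alpha> :: "'a::linorder"
  assumes "a \<in> [H]\<^bsup>n\<^esup>" "\<alpha> \<in> H" "\<forall>x\<in>a. x < \<alpha>"
  shows "insert \<alpha> a \<in> [H]\<^bsup>Suc n\<^esup>"
proof -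
  have "\<alpha> \<notin> a" using assms(3) less_irrefl by metis
  then show ?thesis using assms by (simp add: nsets_def)
qed

text \<open>\<open>m i\<close> is the set of coordinates on which \<open>f b i\<close> depends.\<close>

definition canonical :: "nat \<Rightarrow> 'a::linorder set \<Rightarrow> ('a set \<Rightarrow> 'i \<Rightarrow> 'v) \<Rightarrow> 'i set \<Rightarrow> ('i \<Rightarrow> nat set) \<Rightarrow> bool" where
  "canonical n H f D m \<longleftrightarrow> (\<forall>i\<in>D. m i \<subseteq> {..<n})
     \<and> (\<forall>a\<in>[H]\<^bsup>n\<^esup>. \<forall>b\<in>[H]\<^bsup>n\<^esup>. \<forall>i\<in>D. \<forall>j\<in>D. same_positions a b \<longrightarrow>
          (f a i = f b j \<longleftrightarrow> i = j \<and> m i \<subseteq> position a ` (a \<inter> b)))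
     \<and> (\<forall>a\<in>[H]\<^bsup>n\<^esup>. \<forall>b\<in>[H]\<^bsup>n\<^esup>. \<forall>i\<in>D. at_positions (m i) a = at_positions (m i) b \<longrightarrow> f a i = f b i)"

text \<open>The last conclusion of the theorem, with the shared member \<open>x\<close> in place of
  its index: agreement of positions from \<open>x\<close> upwards expresses alignment above that
  index together with the common member there. Common members below \<open>x\<close> may sit at
  different positions, so the comparison clause of \<open>canonical\<close> does not apply.\<close>

definition shift_invariant :: "nat \<Rightarrow> 'a::linorder set \<Rightarrow> ('a set \<Rightarrow> 'i \<Rightarrow> 'v) \<Rightarrow> 'i set \<Rightarrow> bool" where
  "shift_invariant n H f D \<longleftrightarrow> (\<forall>a\<in>[H]\<^bsup>n\<^esup>. \<forall>b\<in>[H]\<^bsup>n\<^esup>. \<forall>x\<in>a \<inter> b. \<forall>z\<in>H.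
     (\<forall>y\<in>a \<inter> b. x \<le> y \<longrightarrow> position a y = position b y) \<longrightarrow>
     (\<forall>w\<in>a \<union> b. (w < x \<longrightarrow> w < z) \<and> (x < w \<longrightarrow> z < w)) \<longrightarrow>
     (\<forall>i\<in>D. \<forall>j\<in>D. f a i = f b j \<longleftrightarrow> f (insert z (a - {x})) i = f (insert z (b - {x})) j))"

lemma shift_invariantD:
  assumes "shift_invariant n H f D" "a \<in> [H]\<^bsup>n\<^esup>" "b \<in> [H]\<^bsup>n\<^esup>" "x \<in> a" "x \<in> b" "z \<in> H"
    "\<And>y. \<lbrakk>y \<in> a; y \<in> b; x \<le> y\<rbrakk> \<Longrightarrow> position a y = position b y"
    "\<And>w. \<lbrakk>w \<in> a \<union> b; w < x\<rbrakk> \<Longrightarrow> w < z" "\<And>w. \<lbrakk>w \<in> a \<union> b; x < w\<rbrakk> \<Longrightarrow> z < w" "i \<in> D" "j \<in> D"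
  shows "f a i = f b j \<longleftrightarrow> f (insert z (a - {x})) i = f (insert z (b - {x})) j"
  by (rule assms(1)[unfolded shift_invariant_def, rule_format, OF assms(2,3) _ assms(6) _ _ assms(10,11)])
    (use assms(4-9) in auto)

text \<open>The arithmetic hypothesis in the form the induction needs. The index set depends on the
  colour \<open>c\<close>, because the colour fixes the order type of \<open>u b\<close>.\<close>

definition small_indexing :: "'l set \<Rightarrow> 'c set \<Rightarrow> ('c \<Rightarrow> 'i set) \<Rightarrow> bool" where
  "small_indexing L N D \<longleftrightarrow> |N| <o |L| \<and>
     (\<forall>c\<in>N. \<forall>\<Theta> :: 'l set. |\<Theta>| <o |L| \<longrightarrow> |Func (D c) \<Theta>| <o |L| )"

lemma small_indexing_Func:
  fixes L :: "'l set" and B :: "'v set"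
  assumes "small_indexing L N D" "c \<in> N" "|B| <o |L|"
  shows "|Func (D c) B| <o |L|"
proof -
  obtain \<Theta> where \<Theta>: "\<Theta> \<subseteq> L" "|B| =o |\<Theta>|"
    using obtain_subset_of_card[OF ordLess_imp_ordLeq[OF assms(3)]] by metis
  have "|\<Theta>| <o |L|" by (rule ordIso_ordLess_trans[OF ordIso_symmetric[OF \<Theta>(2)] assms(3)])
  then have *: "|Func (D c) \<Theta>| <o |L|" using assms unfolding small_indexing_def by blast
  show ?thesis
    by (rule ordLeq_ordLess_trans[OF card_of_Func_mono[OF card_of_refl ordIso_imp_ordLeq[OF \<Theta>(2)]] *])
qed

lemma small_indexing_Pow:
  assumes "small_indexing L N D" "c \<in> N" "uncountable_regular L"
  shows "|Pow (D c)| <o |L|" "|D c| <o |L|"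
proof -
  have "|{True, False}| <o |L|" by (rule finite_ordLess_reg[OF assms(3)]) simp
  then have F: "|Func (D c) {True, False}| <o |L|" by (rule small_indexing_Func[OF assms(1,2)])
  show *: "|Pow (D c)| <o |L|"
    by (rule ordLeq_ordLess_trans[OF card_of_Pow_le_Func F]) simp
  show "|D c| <o |L|" by (rule ordLess_transitive[OF card_of_Pow *])
qed

text \<open>Pigeonhole makes the colour constant on a set of full size, and then the Delta-system
  lemma applies to \<open>f {x}\<close>.\<close>

lemma dimension_one:
  fixes M :: "'a::wellorder set" and f :: "'a set \<Rightarrow> 'i \<Rightarrow> 'v" and N :: "'c set"
  assumes reg: "uncountable_regular L" and M_L: "|M| =o |L|"
    and init: "\<And>x. x \<in> M \<Longrightarrow> |M \<inter> {..<x}| <o |M|"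
    and idx: "small_indexing L N D"
    and g: "\<And>b. b \<in> [M]\<^bsup>Suc 0\<^esup> \<Longrightarrow> g b \<in> N \<and> inj_on (f b) (D (g b))"
  obtains H k m where "H \<subseteq> M" "|H| =o |L|" "k \<in> N" "\<And>b. b \<in> [H]\<^bsup>Suc 0\<^esup> \<Longrightarrow> g b = k"
    "canonical (Suc 0) H f (D k) m" "shift_invariant (Suc 0) H f (D k)"
proof -
  have regM: "uncountable_regular M" by (rule uncountable_regular_cong[OF reg M_L])
  have NM: "|N| <o |M|" using idx M_L ordLess_ordIso_trans ordIso_symmetric
    unfolding small_indexing_def by blast
  have g1: "g {x} \<in> N" "inj_on (f {x}) (D (g {x}))" if "x \<in> M" for x
    using g[of "{x}"] that by (auto simp: nsets_one)
  have "\<exists>k\<in>N. \<not> |{x\<in>M. g {x} = k}| <o |M|"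
  proof (rule ccontr)
    assume "\<not> ?thesis"
    then have "|\<Union>k\<in>N. {x\<in>M. g {x} = k}| <o |M|" by (intro UN_small[OF regM NM]) blast
    moreover have "(\<Union>k\<in>N. {x\<in>M. g {x} = k}) = M" using g1 by blast
    ultimately have "|M| <o |M|" by simp
    then show False using ordLess_irreflexive by blast
  qed
  then obtain k where k: "k \<in> N" "\<not> |{x\<in>M. g {x} = k}| <o |M|" by blast
  define M' where "M' = {x\<in>M. g {x} = k}"
  have M': "M' \<subseteq> M" "|M'| =o |M|"
    using k(2) card_of_mono1[of M' M] unfolding M'_def by (auto simp: ordIso_iff_ordLeq ordLess_not_ordLeq)
  have M'L: "|M'| =o |L|" using M'(2) M_L ordIso_transitive by blast
  have init': "|M' \<inter> {..<x}| <o |M'|" if "x \<in> M'" for x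
  proof -
    have "|M' \<inter> {..<x}| \<le>o |M \<inter> {..<x}|" using M'(1) by (intro card_of_mono1) blast
    moreover have "|M \<inter> {..<x}| <o |M'|"
      using init M' that ordLess_ordIso_trans ordIso_symmetric by blast
    ultimately show ?thesis by (rule ordLeq_ordLess_trans)
  qed
  have exp: "|Func (D k) B| <o |M'|" if "|B| <o |M'|" for B :: "'v option set"
  proof -
    have "|Func (D k) B| <o |L|"
      by (rule small_indexing_Func[OF idx k(1) ordLess_ordIso_trans[OF that M'L]])
    then show ?thesis using M'L ordLess_ordIso_trans ordIso_symmetric by blast
  qed
  have inj: "inj_on (f {x}) (D k)" if "x \<in> M'" for x
    using g1[of x] that unfolding M'_def by auto
  have "\<exists>H J. H \<subseteq> M' \<and> |H| =o |M'| \<and> (\<forall>x\<in>H. \<forall>y\<in>H. \<forall>i\<in>D k. \<forall>j\<in>D k.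
      f {x} i = f {y} j \<longleftrightarrow> i = j \<and> (i \<in> J \<or> x = y))"
  proof (rule delta_system[OF uncountable_regular_cong[OF regM M'(2)] init' exp,
        where h = "\<lambda>x. f {x}", OF _ _ inj])
    fix H J assume "H \<subseteq> M'" "|H| =o |M'|"
      and "\<And>x y i j. \<lbrakk>x \<in> H; y \<in> H; i \<in> D k; j \<in> D k\<rbrakk> \<Longrightarrow>
        f {x} i = f {y} j \<longleftrightarrow> i = j \<and> (i \<in> J \<or> x = y)"
    then show ?thesis by (intro exI[of _ H] exI[of _ J] conjI ballI) simp_all
  qed
  then obtain H J where H: "H \<subseteq> M'" "|H| =o |M'|"
    and eqs: "\<forall>x\<in>H. \<forall>y\<in>H. \<forall>i\<in>D k. \<forall>j\<in>D k.
      f {x} i = f {y} j \<longleftrightarrow> i = j \<and> (i \<in> J \<or> x = y)"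
    by (elim exE conjE)
  have eq: "f {x} i = f {y} j \<longleftrightarrow> i = j \<and> (i \<in> J \<or> x = y)"
    if "x \<in> H" "y \<in> H" "i \<in> D k" "j \<in> D k" for x y i j
    using eqs that by simp
  \<comment> \<open>Root indices depend on no coordinate, all others on the only one.\<close>
  define m where "m i = (if i \<in> J then {} else {0::nat})" for i
  have pos: "position {x} x = 0" for x :: 'a by (simp add: position_def)
  show ?thesis
  proof (rule that[of H k m])
    show "H \<subseteq> M" using H M' by blast
    show "|H| =o |L|" using H(2) M'L ordIso_transitive by blast
    show "g b = k" if "b \<in> [H]\<^bsup>Suc 0\<^esup>" for b
      using that H(1) unfolding M'_def by (auto simp: nsets_one)
    have ns: "b \<in> [H]\<^bsup>Suc 0\<^esup> \<longleftrightarrow> (\<exists>x\<in>H. b = {x})" for b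
      by (auto simp: nsets_one)
    show "canonical (Suc 0) H f (D k) m"
      unfolding canonical_def
    proof (intro conjI ballI impI)
      fix a b i j assume ab: "a \<in> [H]\<^bsup>Suc 0\<^esup>" "b \<in> [H]\<^bsup>Suc 0\<^esup>" and ij: "i \<in> D k" "j \<in> D k"
      from ab obtain x y where xy: "x \<in> H" "y \<in> H" "a = {x}" "b = {y}" unfolding ns by blast
      show "f a i = f b j \<longleftrightarrow> i = j \<and> m i \<subseteq> position a ` (a \<inter> b)"
        using eq[OF xy(1,2) ij] xy(3,4) by (auto simp: m_def pos)
    next
      fix a b i assume ab: "a \<in> [H]\<^bsup>Suc 0\<^esup>" "b \<in> [H]\<^bsup>Suc 0\<^esup>" and i: "i \<in> D k"
        and at: "at_positions (m i) a = at_positions (m i) b"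
      from ab obtain x y where xy: "x \<in> H" "y \<in> H" "a = {x}" "b = {y}" unfolding ns by blast
      have "at_positions {0} {w} = {w}" for w :: 'a by (auto simp: at_positions_def pos)
      then have "i \<in> J \<or> x = y" using at unfolding xy(3,4) m_def by (cases "i \<in> J") simp_all
      then show "f a i = f b i" using eq[OF xy(1,2) i i] xy(3,4) by simp
    qed (simp add: m_def)
    show "shift_invariant (Suc 0) H f (D k)"
      unfolding shift_invariant_def
    proof (intro ballI impI)
      fix a b x z i j assume "a \<in> [H]\<^bsup>Suc 0\<^esup>" "b \<in> [H]\<^bsup>Suc 0\<^esup>" "x \<in> a \<inter> b"
        and z: "z \<in> H" and ij: "i \<in> D k" "j \<in> D k"
      then have "x \<in> H" "a = {x}" "b = {x}" unfolding ns by auto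
      then show "f a i = f b j \<longleftrightarrow> f (insert z (a - {x})) i = f (insert z (b - {x})) j"
        using eq[of x x i j] eq[of z z i j] z ij by simp
    qed
  qed (rule k(1))
qed

lemma canonicalD:
  assumes "canonical n H f D m"
  shows "i \<in> D \<Longrightarrow> m i \<subseteq> {..<n}"
    and "\<lbrakk>a \<in> [H]\<^bsup>n\<^esup>; b \<in> [H]\<^bsup>n\<^esup>; i \<in> D; j \<in> D; same_positions a b\<rbrakk> \<Longrightarrow>
      f a i = f b j \<longleftrightarrow> i = j \<and> m i \<subseteq> position a ` (a \<inter> b)"
    and "\<lbrakk>a \<in> [H]\<^bsup>n\<^esup>; b \<in> [H]\<^bsup>n\<^esup>; i \<in> D; at_positions (m i) a = at_positions (m i) b\<rbrakk> \<Longrightarrow> f a i = f b i"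
  using assms[unfolded canonical_def, THEN conjunct1] assms[unfolded canonical_def, THEN conjunct2, THEN conjunct1]
    assms[unfolded canonical_def, THEN conjunct2, THEN conjunct2]
  by blast+

lemma canonical_subset: "canonical n H f D m \<Longrightarrow> H' \<subseteq> H \<Longrightarrow> canonical n H' f D m"
  using nsets_mono[of H' H n] unfolding canonical_def by (simp add: subset_iff)

lemma shift_invariant_subset:
  assumes "shift_invariant n H f D" "H' \<subseteq> H"
  shows "shift_invariant n H' f D"
  using assms(1) nsets_mono[OF assms(2), of n] assms(2) unfolding shift_invariant_def by (simp add: subset_iff)

lemma at_positions_insert_top:
  assumes "finite a" "\<forall>x\<in>a. x < \<alpha>"
  shows "at_positions m (insert \<alpha> a) = at_positions m a \<union> (if card a \<in> m then {\<alpha>} else {})"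
  using position_insert_top[OF assms(2)] unfolding at_positions_def by auto

lemma at_positions_initial_eq:
  fixes b c :: "'a::linorder set"
  assumes "finite b" "finite c" "z \<in> b" "b \<inter> {..z} = c \<inter> {..z}" "m \<subseteq> {..position b z}"
  shows "at_positions m b = at_positions m c"
proof -
  have pos: "position b x = position c x" if "x \<le> z" for x
  proof (rule position_cong)
    have "{..<x} \<subseteq> {..z}" using that by auto
    then show "b \<inter> {..<x} = c \<inter> {..<x}" using assms(4) by blast
  qed
  have *: "at_positions m b \<subseteq> at_positions m c"
    if "finite b" "z \<in> b" "b \<inter> {..z} = c \<inter> {..z}" "\<And>x. x \<le> z \<Longrightarrow> position b x = position c x"
      "m \<subseteq> {..position b z}" for b c
  proof
    fix x assume x: "x \<in> at_positions m b"
    then have xb: "x \<in> b" "position b x \<le> position b z" using that(5) by (auto simp: at_positions_def)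
    then have "x \<le> z" using position_less_iff[OF that(1,2) xb(1)] by auto
    then show "x \<in> at_positions m c" using x xb(1) that(3) that(4)[of x] by (auto simp: at_positions_def)
  qed
  have "z \<in> c" using assms(3,4) by auto
  then show ?thesis
    using *[of b c] *[of c b] assms pos by (simp add: subset_antisym)
qed

text \<open>Replacing the part of \<open>b\<close> above \<open>z\<close> by a common set far above makes two tuples aligned, so
  the value of \<open>F b j\<close> determines the last coordinate on which it depends.\<close>

lemma canonical_last_unique:
  fixes H :: "'a::linorder set"
  assumes can: "canonical n H F D m" and j: "j \<in> D"
    and above: "\<And>q. \<lbrakk>finite q; q \<subseteq> H\<rbrakk> \<Longrightarrow> \<exists>R\<in>[H]\<^bsup>n\<^esup>. \<forall>x\<in>q. \<forall>y\<in>R. x < y"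
    and b: "b \<in> [H]\<^bsup>n\<^esup>" "z \<in> b" and b': "b' \<in> [H]\<^bsup>n\<^esup>" "z' \<in> b'"
    and init: "b \<inter> {..<z} = b' \<inter> {..<z'}"
    and last: "position b z \<in> m j" "m j \<subseteq> {..position b z}"
    and eq: "F b j = F b' j"
  shows "z = z'"
proof (rule ccontr)
  assume neq: "z \<noteq> z'"
  define s where "s = b \<inter> {..<z}"
  have s': "s = b' \<inter> {..<z'}" using init s_def by simp
  have fin: "finite b" "finite b'" "b \<subseteq> H" "b' \<subseteq> H" "card b = n" "card b' = n"
    using nsetsD[OF b(1)] nsetsD[OF b'(1)] by auto
  have pz: "position b z = card s" "position b' z' = card s"
    unfolding position_def using s_def s' by simp_all
  have "card s < n" using position_less_card[OF fin(1) b(2)] pz fin by simp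
  obtain R where R: "R \<in> [H]\<^bsup>n\<^esup>" "\<forall>x\<in>b \<union> b'. \<forall>y\<in>R. x < y"
    using above[of "b \<union> b'"] fin by auto
  have "n - Suc (card s) \<le> card R" using nsetsD[OF R(1)] by simp
  then obtain R1 where R1: "R1 \<subseteq> R" "card R1 = n - Suc (card s)" "finite R1"
    by (rule obtain_subset_with_card_n)
  have R1_above: "x < y" if "x \<in> b \<union> b'" "y \<in> R1" for x y
    using R(2) subsetD[OF R1(1) that(2)] that(1) by simp
  \<comment> \<open>\<open>c z\<close> and \<open>c z'\<close> share everything except the member at
    position \<open>card s\<close>, so they are aligned. Their values at \<open>j\<close> are those
    of \<open>b\<close> and \<open>b'\<close>, as \<open>m j\<close> does not reach beyond that
    position. But that position is in \<open>m j\<close> and is not a common one, so the values must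
    differ.\<close>
  define c where "c w = insert w s \<union> R1" for w
  have cw: "c w \<in> [H]\<^bsup>n\<^esup>" "b0 \<inter> {..w} = c w \<inter> {..w}" "w \<in> c w" "at_positions (m j) b0 = at_positions (m j) (c w)"
    "position (c w) w = card s" "\<And>x. x \<in> s \<Longrightarrow> position (c w) x = position s x"
    "\<And>x. x \<in> R1 \<Longrightarrow> position (c w) x = Suc (card s) + card (R1 \<inter> {..<x})"
    if b0: "b0 \<subseteq> b \<union> b'" "w \<in> b0" "s = b0 \<inter> {..<w}" "finite b0" "b0 \<subseteq> H" for w b0
  proof -
    have sub: "insert w s \<subseteq> b0" "insert w s \<subseteq> b \<union> b'" using b0(1,2,3) by blast+
    have sR: "insert w s \<inter> R1 = {}"
    proof (rule equals0I)
      fix x assume "x \<in> insert w s \<inter> R1"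
      then have "x < x" using R1_above[of x x] sub(2) by blast
      then show False by simp
    qed
    have "finite s" using finite_subset[OF sub(1) b0(4)] by simp
    moreover have "w \<notin> s" unfolding b0(3) by simp
    ultimately have ws: "w \<notin> s" "finite s" by blast+
    have "card (c w) = n"
      unfolding c_def using card_Un_disjoint[OF _ R1(3) sR] R1(2) \<open>card s < n\<close> ws by simp
    moreover have "c w \<subseteq> H" unfolding c_def using b0(5) sub(1) R1(1) nsetsD[OF R(1)] by blast
    ultimately show "c w \<in> [H]\<^bsup>n\<^esup>" unfolding nsets_def c_def using ws R1(3) by simp
    show bc: "b0 \<inter> {..w} = c w \<inter> {..w}"
    proof -
      have "R1 \<inter> {..w} = {}" using R1_above[of w] b0(1,2) by (fastforce simp: not_le)
      moreover have "b0 \<inter> {..w} = insert w s" unfolding b0(3) using b0(2) by (auto simp: order_le_less)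
      moreover have "insert w s \<subseteq> {..w}" unfolding b0(3) by auto
      ultimately show ?thesis unfolding c_def by blast
    qed
    show "w \<in> c w" by (simp add: c_def)
    have "position b0 w = card s" using b0(3) by (simp add: position_def)
    then show "at_positions (m j) b0 = at_positions (m j) (c w)"
      by (intro at_positions_initial_eq[OF b0(4) _ b0(2) bc]) (use last(2) pz ws R1(3) in \<open>simp_all add: c_def\<close>)
    show "position (c w) w = card s"
    proof -
      have "c w \<inter> {..<w} = b0 \<inter> {..<w}" using bc by force
      then show ?thesis using b0(3) by (simp add: position_def)
    qed
    show "position (c w) x = position s x" if "x \<in> s" for x
    proof (rule position_cong)
      have "x < w" using that b0(3) by auto
      then have "c w \<inter> {..<x} = b0 \<inter> {..<w} \<inter> {..<x}" using bc by force
      then show "c w \<inter> {..<x} = s \<inter> {..<x}" using b0(3) by simp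
    qed
    show "position (c w) x = Suc (card s) + card (R1 \<inter> {..<x})" if "x \<in> R1" for x
    proof -
      have "c w \<inter> {..<x} = insert w s \<union> (R1 \<inter> {..<x})"
      proof -
        have "insert w s \<subseteq> {..<x}" using R1_above[OF _ that] sub(2) by blast
        then show ?thesis unfolding c_def by blast
      qed
      moreover have "insert w s \<inter> (R1 \<inter> {..<x}) = {}" using sR by blast
      ultimately show ?thesis unfolding position_def
        using card_Un_disjoint[of "insert w s" "R1 \<inter> {..<x}"] ws R1(3) by simp
    qed
  qed
  note cz = cw[of b z, OF _ b(2) s_def fin(1,3), simplified]
  note cz' = cw[of b' z', OF _ b'(2) s' fin(2,4), simplified]
  have "z \<notin> s" "z' \<notin> s" using s_def s' by auto
  moreover have "z \<notin> R1" "z' \<notin> R1" using R1_above b(2) b'(2) by blast+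
  ultimately have zc: "z \<notin> c z'" and inter: "c z \<inter> c z' \<subseteq> s \<union> R1" unfolding c_def using neq by auto
  have "same_positions (c z) (c z')"
    unfolding same_positions_def
  proof
    fix x assume "x \<in> c z \<inter> c z'"
    then have "x \<in> s \<or> x \<in> R1" using inter by blast
    then show "position (c z) x = position (c z') x"
      using cz(6,7)[of x] cz'(6,7)[of x] by auto
  qed
  moreover have "F (c z) j = F (c z') j"
    using canonicalD(3)[OF can b(1) cz(1) j cz(4)] canonicalD(3)[OF can b'(1) cz'(1) j cz'(4)] eq by simp
  ultimately have "m j \<subseteq> position (c z) ` (c z \<inter> c z')"
    using canonicalD(2)[OF can cz(1) cz'(1) j j] by blast
  then obtain x where x: "x \<in> c z" "x \<in> c z'" "position (c z) x = position (c z) z"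
    using last(1) pz cz(5) by auto
  then have "x = z" using position_eq_iff[of "c z" x z] cz(3) nsetsD[OF cz(1)] by blast
  then show False using x zc by simp
qed

text \<open>Members of \<open>b\<close> from \<open>y\<close> on occupy no position in
  \<open>m j\<close>, so they may be exchanged for members of \<open>R\<close> just below
  \<open>y\<close>; the last clause of \<open>canonical\<close> preserves the value.\<close>

lemma canonical_move_down:
  fixes H :: "'a::linorder set"
  assumes can: "canonical n H F D m" and j: "j \<in> D" and b: "b \<in> [H]\<^bsup>n\<^esup>"
    and below: "\<forall>x\<in>at_positions (m j) b. x < y"
    and R: "R \<in> [H]\<^bsup>n\<^esup>" "\<forall>x\<in>b. x < y \<longrightarrow> (\<forall>w\<in>R. x < w)" "\<forall>w\<in>R. w < y"
  obtains c where "c \<in> [H]\<^bsup>n\<^esup>" "\<forall>x\<in>c. x < y" "F c j = F b j"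
proof -
  have fin: "finite b" "b \<subseteq> H" "card b = n" using nsetsD[OF b] by auto
  define q where "q = b \<inter> {..<y}"
  have q: "finite q" "q \<subseteq> b" "card q \<le> n" using fin card_mono[of b q] by (auto simp: q_def)
  have "n - card q \<le> card R" using nsetsD[OF R(1)] by simp
  then obtain R1 where R1: "R1 \<subseteq> R" "card R1 = n - card q" "finite R1"
    by (rule obtain_subset_with_card_n)
  have qR: "x < w" if "x \<in> q" "w \<in> R1" for x w using that R(2) R1 q_def by auto
  define c where "c = q \<union> R1"
  have "q \<inter> R1 = {}" using qR by force
  then have "card c = n" unfolding c_def using card_Un_disjoint[of q R1] q R1 by simp
  then have c: "c \<in> [H]\<^bsup>n\<^esup>" unfolding nsets_def c_def using q R1 fin nsetsD[OF R(1)] by auto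
  have pos_q: "position c x = position b x" "position b x < card q" if "x \<in> q" for x
  proof -
    have "c \<inter> {..<x} = q \<inter> {..<x}" unfolding c_def using qR[OF that] by force
    also have "\<dots> = b \<inter> {..<x}" using that unfolding q_def by auto
    finally show "position c x = position b x" by (rule position_cong)
    have "b \<inter> {..<x} \<subset> q" using that unfolding q_def by auto
    then show "position b x < card q" unfolding position_def using q(1) by (rule psubset_card_mono[rotated])
  qed
  have pos_R1: "card q \<le> position c x" if "x \<in> R1" for x
    unfolding position_def by (rule card_mono) (use q(1) R1(3) qR that in \<open>auto simp: c_def\<close>)
  have "at_positions (m j) b = at_positions (m j) c"
  proof
    show "at_positions (m j) b \<subseteq> at_positions (m j) c"
    proof
      fix x assume x: "x \<in> at_positions (m j) b"
      then have "x \<in> q" using below by (auto simp: q_def at_positions_def)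
      then show "x \<in> at_positions (m j) c" using x pos_q(1)[of x] by (simp add: at_positions_def c_def)
    qed
    show "at_positions (m j) c \<subseteq> at_positions (m j) b"
    proof
      fix x assume x: "x \<in> at_positions (m j) c"
      then have xm: "position c x \<in> m j" "x \<in> c" by (auto simp: at_positions_def)
      \<comment> \<open>\<open>m j\<close> holds only positions below \<open>n\<close>, so
        \<open>b\<close> has a member at this position. That member lies in \<open>q\<close>, and
        the positions of \<open>R1\<close> start at \<open>card q\<close>.\<close>
      then have "position c x \<in> position b ` b"
        using canonicalD(1)[OF can j] position_image[OF fin(1)] fin(3) by auto
      then obtain x' where x': "x' \<in> b" "position b x' = position c x" by auto
      then have "x' \<in> at_positions (m j) b" using xm by (simp add: at_positions_def)
      then have "x' \<in> q" using below by (auto simp: q_def at_positions_def)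
      then have "x \<in> q" using pos_q(2)[of x'] pos_R1[of x] x' xm(2) by (auto simp: c_def)
      then show "x \<in> at_positions (m j) b" using xm(1) pos_q(1)[of x] q(2) by (auto simp: at_positions_def)
    qed
  qed
  then have "F c j = F b j" using canonicalD(3)[OF can b c j] by simp
  moreover have "\<forall>x\<in>c. x < y" unfolding c_def q_def using R(3) R1(1) by auto
  ultimately show ?thesis using that c by blast
qed

text \<open>\<open>F a\<close> is to be thought of as \<open>f (insert \<delta> a)\<close> for a fixed top element \<open>\<delta>\<close>
  above \<open>H\<close>, and \<open>J\<close> as the set of indices at which the value does not depend on the top.\<close>

context
  fixes n :: nat and H :: "'a::linorder set" and f F :: "'a set \<Rightarrow> 'i \<Rightarrow> 'v"
    and D J :: "'i set" and m :: "'i \<Rightarrow> nat set"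
  assumes stable_val: "\<And>a \<alpha> i. \<lbrakk>a \<in> [H]\<^bsup>n\<^esup>; \<alpha> \<in> H; \<forall>x\<in>a. x < \<alpha>; i \<in> D; i \<in> J\<rbrakk> \<Longrightarrow> f (insert \<alpha> a) i = F a i"
    and same_top: "\<And>a b \<alpha> i j. \<lbrakk>a \<in> [H]\<^bsup>n\<^esup>; b \<in> [H]\<^bsup>n\<^esup>; \<alpha> \<in> H; \<forall>x\<in>a. x < \<alpha>; \<forall>x\<in>b. x < \<alpha>; i \<in> D; j \<in> D\<rbrakk>
      \<Longrightarrow> f (insert \<alpha> a) i = f (insert \<alpha> b) j \<longleftrightarrow> F a i = F b j"
    and diff_top: "\<And>a b \<alpha> \<beta> i j. \<lbrakk>a \<in> [H]\<^bsup>n\<^esup>; b \<in> [H]\<^bsup>n\<^esup>; \<alpha> \<in> H; \<beta> \<in> H; \<forall>x\<in>a. x < \<alpha>; \<forall>x\<in>b. x < \<beta>;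
        \<alpha> \<noteq> \<beta>; \<alpha> \<notin> b; \<beta> \<notin> a; i \<in> D; j \<in> D\<rbrakk>
      \<Longrightarrow> f (insert \<alpha> a) i = f (insert \<beta> b) j \<longleftrightarrow> i \<in> J \<and> j \<in> J \<and> F a i = F b j"
begin

text \<open>Position \<open>n\<close> is common to two aligned tuples exactly when their tops
  coincide. With equal tops \<open>same_top\<close> reduces the claim to \<open>F\<close>; with
  different tops \<open>diff_top\<close> does, and it rejects exactly the indices whose coordinate
  set contains \<open>n\<close>.\<close>

lemma canonical_Suc:
  assumes can: "canonical n H F D m"
  shows "canonical (Suc n) H f D (\<lambda>i. if i \<in> J then m i else insert n (m i))"
    (is "canonical _ _ _ _ ?m")
  unfolding canonical_def
proof (intro conjI ballI impI)
  fix i assume "i \<in> D"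
  then have "m i \<subseteq> {..<n}" by (rule canonicalD(1)[OF can])
  then show "?m i \<subseteq> {..<Suc n}" by (auto simp: lessThan_Suc)
next
  fix c c' i j assume c: "c \<in> [H]\<^bsup>Suc n\<^esup>" and c': "c' \<in> [H]\<^bsup>Suc n\<^esup>" and ij: "i \<in> D" "j \<in> D"
    and same: "same_positions c c'"
  obtain \<alpha> a where a: "c = insert \<alpha> a" "a \<in> [H]\<^bsup>n\<^esup>" "\<alpha> \<in> H" "\<forall>x\<in>a. x < \<alpha>" "\<alpha> \<notin> a"
    by (rule nsets_Suc_topE[OF c])
  obtain \<beta> b where b: "c' = insert \<beta> b" "b \<in> [H]\<^bsup>n\<^esup>" "\<beta> \<in> H" "\<forall>x\<in>b. x < \<beta>" "\<beta> \<notin> b"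
    by (rule nsets_Suc_topE[OF c'])
  have fin: "finite a" "card a = n" "finite b" "card b = n" using nsetsD[OF a(2)] nsetsD[OF b(2)] by auto
  note pos_a = position_insert_top[OF a(4)] and pos_b = position_insert_top[OF b(4)]
  have less_a: "position a x < n" if "x \<in> a" for x using position_less_card[OF fin(1) that] fin by simp
  have less_b: "position b x < n" if "x \<in> b" for x using position_less_card[OF fin(3) that] fin by simp
  have mi: "n \<notin> m i" using canonicalD(1)[OF can ij(1)] by blast
  have same_ab: "same_positions a b"
    unfolding same_positions_def
  proof
    fix x assume x: "x \<in> a \<inter> b"
    then have "position c x = position c' x" using same a(1) b(1) by (auto simp: same_positions_def)
    then show "position a x = position b x" using pos_a(1)[of x] pos_b(1)[of x] x a(1) b(1) by simp
  qed
  let ?S = "position a ` (a \<inter> b)"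
  have Sn: "n \<notin> ?S" using less_a by auto
  have Sc: "position c ` (a \<inter> b) = ?S"
    unfolding a(1) using pos_a(1) by (intro image_cong) auto
  have Fab: "F a i = F b j \<longleftrightarrow> i = j \<and> m i \<subseteq> ?S" by (rule canonicalD(2)[OF can a(2) b(2) ij same_ab])
  show "f c i = f c' j \<longleftrightarrow> i = j \<and> ?m i \<subseteq> position c ` (c \<inter> c')"
  proof (cases "\<alpha> = \<beta>")
    case True
    have "f c i = f c' j \<longleftrightarrow> F a i = F b j"
      using same_top[OF a(2) b(2) a(3) a(4) _ ij] b True a(1) by simp
    moreover have "c \<inter> c' = insert \<alpha> (a \<inter> b)" using a(1) b(1) True by blast
    then have "position c ` (c \<inter> c') = insert n ?S" using Sc pos_a(2) a(1) fin(2) by simp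
    moreover have "?m i \<subseteq> insert n S \<longleftrightarrow> m i \<subseteq> S" for S using mi by (simp add: subset_insert)
    ultimately show ?thesis using Fab by simp
  next
    case False
    \<comment> \<open>Alignment keeps a top out of the other tuple: it would have position
      \<open>n\<close> in one and a smaller position in the other.\<close>
    have \<alpha>b: "\<alpha> \<notin> b"
    proof
      assume "\<alpha> \<in> b"
      then have "position c \<alpha> = position c' \<alpha>" using same a(1) b(1) by (auto simp: same_positions_def)
      then show False using pos_a(2) pos_b(1)[OF \<open>\<alpha> \<in> b\<close>] less_b[OF \<open>\<alpha> \<in> b\<close>] a(1) b(1) fin by simp
    qed
    have \<beta>a: "\<beta> \<notin> a"
    proof
      assume "\<beta> \<in> a"
      then have "position c \<beta> = position c' \<beta>" using same a(1) b(1) by (auto simp: same_positions_def)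
      then show False using pos_b(2) pos_a(1)[OF \<open>\<beta> \<in> a\<close>] less_a[OF \<open>\<beta> \<in> a\<close>] a(1) b(1) fin by simp
    qed
    have "f c i = f c' j \<longleftrightarrow> i \<in> J \<and> j \<in> J \<and> F a i = F b j"
      using diff_top[OF a(2) b(2) a(3) b(3) a(4) b(4) False \<alpha>b \<beta>a ij] a(1) b(1) by simp
    moreover have "c \<inter> c' = a \<inter> b" using a(1) b(1) False \<alpha>b \<beta>a by auto
    then have "position c ` (c \<inter> c') = ?S" using Sc by simp
    moreover have "?m i \<subseteq> ?S \<longleftrightarrow> i \<in> J \<and> m i \<subseteq> ?S" using Sn by simp
    moreover have "i = j \<Longrightarrow> i \<in> J \<longleftrightarrow> j \<in> J" by simp
    ultimately show ?thesis using Fab by blast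
  qed
next
  fix c c' i assume c: "c \<in> [H]\<^bsup>Suc n\<^esup>" and c': "c' \<in> [H]\<^bsup>Suc n\<^esup>" and i: "i \<in> D"
    and at: "at_positions (?m i) c = at_positions (?m i) c'"
  obtain \<alpha> a where a: "c = insert \<alpha> a" "a \<in> [H]\<^bsup>n\<^esup>" "\<alpha> \<in> H" "\<forall>x\<in>a. x < \<alpha>" "\<alpha> \<notin> a"
    by (rule nsets_Suc_topE[OF c])
  obtain \<beta> b where b: "c' = insert \<beta> b" "b \<in> [H]\<^bsup>n\<^esup>" "\<beta> \<in> H" "\<forall>x\<in>b. x < \<beta>" "\<beta> \<notin> b"
    by (rule nsets_Suc_topE[OF c'])
  have fin: "finite a" "card a = n" "finite b" "card b = n" using nsetsD[OF a(2)] nsetsD[OF b(2)] by auto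
  note at_a = at_positions_insert_top[OF fin(1) a(4)] and at_b = at_positions_insert_top[OF fin(3) b(4)]
  have mi: "n \<notin> m i" using canonicalD(1)[OF can i] by blast
  have sub: "at_positions M a \<subseteq> a" "at_positions M b \<subseteq> b" for M by (auto simp: at_positions_def)
  show "f c i = f c' i"
  proof (cases "i \<in> J")
    case True
    then have "at_positions (m i) a = at_positions (m i) b" using at at_a at_b a(1) b(1) mi fin by simp
    then have "F a i = F b i" by (rule canonicalD(3)[OF can a(2) b(2) i])
    then show ?thesis using stable_val a b True i by simp
  next
    case False
    have ins: "at_positions (insert n (m i)) a = at_positions (m i) a"
      "at_positions (insert n (m i)) b = at_positions (m i) b"
    proof -
      have "position a x \<noteq> n" if "x \<in> a" for x using position_less_card[OF fin(1) that] fin by simp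
      moreover have "position b x \<noteq> n" if "x \<in> b" for x using position_less_card[OF fin(3) that] fin by simp
      ultimately show "at_positions (insert n (m i)) a = at_positions (m i) a"
        "at_positions (insert n (m i)) b = at_positions (m i) b"
        unfolding at_positions_def by blast+
    qed
    have eq: "insert \<alpha> (at_positions (m i) a) = insert \<beta> (at_positions (m i) b)"
      using at at_a at_b a(1) b(1) fin False ins by simp
    have "\<alpha> = \<beta>"
    proof (rule antisym)
      have "\<alpha> = \<beta> \<or> \<alpha> \<in> b" using eq sub by blast
      then show "\<alpha> \<le> \<beta>" using b(4) by auto
      have "\<beta> = \<alpha> \<or> \<beta> \<in> a" using eq sub by blast
      then show "\<beta> \<le> \<alpha>" using a(4) by auto
    qed
    have notin: "\<alpha> \<notin> at_positions (m i) a" "\<alpha> \<notin> at_positions (m i) b" using a(5) b(5) sub \<open>\<alpha> = \<beta>\<close> by blast+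
    then have "at_positions (m i) a = at_positions (m i) b"
      using eq \<open>\<alpha> = \<beta>\<close> by (metis insert_ident)
    then have "F a i = F b i" by (rule canonicalD(3)[OF can a(2) b(2) i])
    then show ?thesis using same_top[OF a(2) b(2) a(3) a(4) _ i i] b \<open>\<alpha> = \<beta>\<close> a(1) by simp
  qed
qed

text \<open>When the top itself moves, \<open>same_top\<close> is applied before and after the move.
  When a lower member moves, the tops stay, and either top rule reduces the claim to the invariant
  for \<open>F\<close>.\<close>

lemma shift_invariant_Suc:
  assumes shift: "shift_invariant n H F D"
  shows "shift_invariant (Suc n) H f D"
  unfolding shift_invariant_def
proof (intro ballI impI)
  fix c c' x z i j assume c: "c \<in> [H]\<^bsup>Suc n\<^esup>" and c': "c' \<in> [H]\<^bsup>Suc n\<^esup>" and x: "x \<in> c \<inter> c'"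
    and z: "z \<in> H" and ij: "i \<in> D" "j \<in> D"
    and same: "\<forall>y\<in>c \<inter> c'. x \<le> y \<longrightarrow> position c y = position c' y"
    and between: "\<forall>w\<in>c \<union> c'. (w < x \<longrightarrow> w < z) \<and> (x < w \<longrightarrow> z < w)"
  obtain \<alpha> a where a: "c = insert \<alpha> a" "a \<in> [H]\<^bsup>n\<^esup>" "\<alpha> \<in> H" "\<forall>x\<in>a. x < \<alpha>" "\<alpha> \<notin> a"
    by (rule nsets_Suc_topE[OF c])
  obtain \<beta> b where b: "c' = insert \<beta> b" "b \<in> [H]\<^bsup>n\<^esup>" "\<beta> \<in> H" "\<forall>x\<in>b. x < \<beta>" "\<beta> \<notin> b"
    by (rule nsets_Suc_topE[OF c'])
  have fin: "finite a" "card a = n" "finite b" "card b = n" "a \<subseteq> H" "b \<subseteq> H"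
    using nsetsD[OF a(2)] nsetsD[OF b(2)] by auto
  note pos_a = position_insert_top[OF a(4)] and pos_b = position_insert_top[OF b(4)]
  have less_a: "position a x < n" if "x \<in> a" for x using position_less_card[OF fin(1) that] fin by simp
  have less_b: "position b x < n" if "x \<in> b" for x using position_less_card[OF fin(3) that] fin by simp
  have \<alpha>b: "\<alpha> \<notin> b" if "x \<le> \<alpha>"
  proof
    assume "\<alpha> \<in> b"
    then have "position c \<alpha> = position c' \<alpha>" using same that a(1) b(1) by auto
    then show False using pos_a(2) pos_b(1)[OF \<open>\<alpha> \<in> b\<close>] less_b[OF \<open>\<alpha> \<in> b\<close>] a(1) b(1) fin by simp
  qed
  have \<beta>a: "\<beta> \<notin> a" if "x \<le> \<beta>"
  proof
    assume "\<beta> \<in> a"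
    then have "position c \<beta> = position c' \<beta>" using same that a(1) b(1) by auto
    then show False using pos_b(2) pos_a(1)[OF \<open>\<beta> \<in> a\<close>] less_a[OF \<open>\<beta> \<in> a\<close>] a(1) b(1) fin by simp
  qed
  show "f c i = f c' j \<longleftrightarrow> f (insert z (c - {x})) i = f (insert z (c' - {x})) j"
  proof (cases "x \<in> a \<and> x \<in> b")
    case False
    \<comment> \<open>A common \<open>x\<close> that is the top of one tuple is also the top of the
      other, since its position is the same in both.\<close>
    then have top: "x = \<alpha>" "x = \<beta>" using x a(1) b(1) \<alpha>b \<beta>a by auto
    have "insert z (c - {x}) = insert z a" "insert z (c' - {x}) = insert z b"
      using a(1,5) b(1,5) top by auto
    moreover have "\<forall>w\<in>a. w < z" "\<forall>w\<in>b. w < z"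
      using between top a(1,4) b(1,4) by auto
    ultimately show ?thesis
      using same_top[OF a(2) b(2) a(3,4) _ ij] same_top[OF a(2) b(2) z _ _ ij] a b top by simp
  next
    case True
    then have lt: "x < \<alpha>" "x < \<beta>" using a(4) b(4) by auto
    then have zlt: "z < \<alpha>" "z < \<beta>" using between a(1) b(1) by auto
    define a' where "a' = insert z (a - {x})"
    define b' where "b' = insert z (b - {x})"
    have notin: "z \<notin> a - {x}" "z \<notin> b - {x}"
    proof -
      have "w \<noteq> z" if "w \<in> a \<union> b" "w \<noteq> x" for w
        using between that a(1) b(1) by (metis UnCI UnE insertCI linorder_neqE order_less_irrefl)
      then show "z \<notin> a - {x}" "z \<notin> b - {x}" by auto
    qed
    have cards: "card (a - {x}) = n - 1" "card (b - {x}) = n - 1" "n > 0"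
      using True fin by (auto simp: card_gt_0_iff)
    have a': "a' \<in> [H]\<^bsup>n\<^esup>" "\<forall>w\<in>a'. w < \<alpha>" and b': "b' \<in> [H]\<^bsup>n\<^esup>" "\<forall>w\<in>b'. w < \<beta>"
      unfolding a'_def b'_def nsets_def using notin cards fin z zlt a(4) b(4) by (auto simp: card_insert_if)
    have ins: "insert z (c - {x}) = insert \<alpha> a'" "insert z (c' - {x}) = insert \<beta> b'"
      unfolding a'_def b'_def using a(1) b(1) lt by auto
    have Feq: "F a i = F b j \<longleftrightarrow> F a' i = F b' j"
      unfolding a'_def b'_def
    proof (rule shift_invariantD[OF shift a(2) b(2) _ _ z _ _ _ ij])
      show "x \<in> a" "x \<in> b" using True by auto
      show "position a y = position b y" if "y \<in> a" "y \<in> b" "x \<le> y" for y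
        using same that a(1) b(1) pos_a(1)[OF that(1)] pos_b(1)[OF that(2)] by auto
    qed (use between a(1) b(1) in auto)
    show ?thesis
    proof (cases "\<alpha> = \<beta>")
      case True
      then show ?thesis
        unfolding ins using same_top[OF a(2) b(2) a(3,4) _ ij] same_top[OF a'(1) b'(1) a(3) a'(2) _ ij] Feq a(1) b b'
        by simp
    next
      case False
      have \<alpha>b: "\<alpha> \<notin> b" and \<beta>a: "\<beta> \<notin> a" using \<alpha>b \<beta>a lt by simp_all
      then have "\<alpha> \<notin> b'" "\<beta> \<notin> a'" unfolding a'_def b'_def using zlt by auto
      then show ?thesis
        unfolding ins using diff_top[OF a(2) b(2) a(3) b(3) a(4) b(4) False \<alpha>b \<beta>a ij]
          diff_top[OF a'(1) b'(1) a(3) b(3) a'(2) b'(2) False _ _ ij] Feq a(1) b(1)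
        by simp
    qed
  qed
qed

end

section \<open>Raising the dimension\<close>

text \<open>By \<open>canonical_last_unique\<close>, for the last conclusion each choice of \<open>j\<close>, \<open>i\<close>, \<open>p\<close> and of the part of \<open>b\<close>
  below \<open>z\<close> excludes at most one \<open>z\<close>; the other one only needs gaps of size \<open>n\<close> in \<open>H'\<close>.\<close>

lemma thin_values:
  fixes H :: "'a::wellorder set" and F f :: "'a set \<Rightarrow> 'i \<Rightarrow> 'v"
  assumes reg: "uncountable_regular H"
    and init: "\<And>x. x \<in> H \<Longrightarrow> |H \<inter> {..<x}| <o |H|"
    and D: "|D| <o |H|"
    and can: "canonical n H F D m"
  obtains H' where "H' \<subseteq> H" "|H'| =o |H|"
    "\<And>y b j. \<lbrakk>y \<in> H'; b \<in> [H']\<^bsup>n\<^esup>; j \<in> D; \<forall>x\<in>at_positions (m j) b. x < y\<rbrakk>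
      \<Longrightarrow> \<exists>c\<in>[H]\<^bsup>n\<^esup>. (\<forall>x\<in>c. x < y) \<and> F c j = F b j"
    "\<And>b z p i j. \<lbrakk>b \<in> [H']\<^bsup>n\<^esup>; z \<in> b; j \<in> D; position b z \<in> m j; m j \<subseteq> {..position b z};
        finite p; p \<subseteq> H'; \<forall>x\<in>p. x < z; i \<in> D\<rbrakk> \<Longrightarrow> F b j \<noteq> f p i"
proof -
  have above: "\<exists>R\<in>[H]\<^bsup>n\<^esup>. \<forall>x\<in>q. \<forall>y\<in>R. x < y" if q: "finite q" "q \<subseteq> H" for q
  proof -
    have "infinite {y\<in>H. \<forall>x\<in>q. x < y}"
    proof
      assume "finite {y\<in>H. \<forall>x\<in>q. x < y}"
      then have fin: "finite (q \<union> {y\<in>H. \<forall>x\<in>q. x < y})" using q by simp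
      have "\<exists>y\<in>H. \<forall>x\<in>q \<union> {y\<in>H. \<forall>x\<in>q. x < y}. x < y"
        by (rule above_small[OF reg init _ finite_ordLess_reg[OF reg fin]]) (use q ordLess_irreflexive in auto)
      then obtain y where y: "y \<in> H" "\<forall>x\<in>q \<union> {y\<in>H. \<forall>x\<in>q. x < y}. x < y" ..
      then have "y \<in> {y\<in>H. \<forall>x\<in>q. x < y}" by simp
      then have "y < y" using y(2) by blast
      then show False by simp
    qed
    from infinite_arbitrarily_large[OF this, of n]
    obtain R where R: "R \<subseteq> {y\<in>H. \<forall>x\<in>q. x < y}" "finite R" "card R = n" by blast
    then have "R \<in> [H]\<^bsup>n\<^esup>" "\<forall>x\<in>q. \<forall>y\<in>R. x < y" by (auto simp: nsets_def)
    then show ?thesis by blast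
  qed
  \<comment> \<open>\<open>X q\<close> will exclude every point up to \<open>R q\<close>, so the
    next point of \<open>H'\<close> leaves \<open>n\<close> points of \<open>H\<close> above
    \<open>q\<close> as filler for \<open>canonical_move_down\<close>.\<close>
  define R where "R q = (SOME R. R \<in> [H]\<^bsup>n\<^esup> \<and> (\<forall>x\<in>q. \<forall>y\<in>R. x < y))" for q
  have R: "R q \<in> [H]\<^bsup>n\<^esup>" "\<forall>x\<in>q. \<forall>y\<in>R q. x < y" if "finite q" "q \<subseteq> H" for q
  proof -
    have "\<exists>R. R \<in> [H]\<^bsup>n\<^esup> \<and> (\<forall>x\<in>q. \<forall>y\<in>R. x < y)" using above[OF that] by (simp only: Bex_def)
    then have "R q \<in> [H]\<^bsup>n\<^esup> \<and> (\<forall>x\<in>q. \<forall>y\<in>R q. x < y)" unfolding R_def by (rule someI_ex)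
    then show "R q \<in> [H]\<^bsup>n\<^esup>" "\<forall>x\<in>q. \<forall>y\<in>R q. x < y" by simp_all
  qed
  \<comment> \<open>The members of \<open>b\<close> above \<open>z\<close> are quantified away, so
    each set is described by data below \<open>z\<close>, which the greedy choice already knows when
    it reaches \<open>z\<close>.\<close>
  define E where "E = (\<lambda>(j, i, p, s). {z. \<exists>b\<in>[H]\<^bsup>n\<^esup>. z \<in> b \<and> b \<inter> {..<z} = s \<and> position b z \<in> m j \<and>
      m j \<subseteq> {..position b z} \<and> F b j = f p i})"
  have E_iff: "z \<in> E (j, i, p, s) \<longleftrightarrow> (\<exists>b\<in>[H]\<^bsup>n\<^esup>. z \<in> b \<and> b \<inter> {..<z} = s \<and> position b z \<in> m j \<and>
      m j \<subseteq> {..position b z} \<and> F b j = f p i)" for z j i p s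
    unfolding E_def by simp
  define X where "X q = (\<Union>w\<in>R q. {y. y \<le> w}) \<union> (\<Union>e\<in>D \<times> D \<times> Pow q \<times> Pow q. E e)" for q
  have E_small: "|E e| <o |H|" if e: "e \<in> D \<times> D \<times> Pow q \<times> Pow q" for e q
  proof -
    obtain j i p s where e': "e = (j, i, p, s)" "j \<in> D" using e by auto
    have "z = z'" if zs: "z \<in> E e" "z' \<in> E e" for z z'
    proof -
      obtain b where b: "b \<in> [H]\<^bsup>n\<^esup>" "z \<in> b" "b \<inter> {..<z} = s" "position b z \<in> m j"
        "m j \<subseteq> {..position b z}" "F b j = f p i"
        using zs(1) unfolding E_iff e' by blast
      obtain b' where b': "b' \<in> [H]\<^bsup>n\<^esup>" "z' \<in> b'" "b' \<inter> {..<z'} = s" "F b' j = f p i"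
        using zs(2) unfolding E_iff e' by blast
      show ?thesis
        by (rule canonical_last_unique[OF can e'(2) above b(1,2) b'(1,2) _ b(4,5)]) (use b b' in simp_all)
    qed
    then have "E e \<subseteq> {SOME z. z \<in> E e}" by (metis singletonI someI subsetI)
    then have "finite (E e)" by (rule finite_subset) simp
    then show ?thesis by (rule finite_ordLess_reg[OF reg])
  qed
  have X_small: "|H \<inter> X q| <o |H|" if q: "finite q" "q \<subseteq> H" for q
  proof -
    have "|H \<inter> {y. y \<le> w}| <o |H|" if "w \<in> R q" for w
    proof -
      have w: "w \<in> H" using that nsetsD[OF R(1)[OF q]] by blast
      have "|(H \<inter> {..<w}) \<union> {w}| <o |H|"
        by (rule Un_small[OF reg init[OF w] finite_ordLess_reg[OF reg]]) simp
      moreover have "H \<inter> {y. y \<le> w} \<subseteq> (H \<inter> {..<w}) \<union> {w}" by auto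
      ultimately show ?thesis using card_of_mono1 ordLeq_ordLess_trans by blast
    qed
    then have 1: "|\<Union>w\<in>R q. H \<inter> {y. y \<le> w}| <o |H|"
      using nsetsD[OF R(1)[OF q]] by (intro UN_small[OF reg finite_ordLess_reg[OF reg]]) auto
    have "|D \<times> D \<times> Pow q \<times> Pow q| <o |H|"
      by (intro Sigma_small[OF reg] D finite_ordLess_reg[OF reg]) (use q in auto)
    then have 2: "|\<Union>e\<in>D \<times> D \<times> Pow q \<times> Pow q. E e| <o |H|"
      by (rule UN_small[OF reg _ E_small])
    have "H \<inter> X q \<subseteq> (\<Union>w\<in>R q. H \<inter> {y. y \<le> w}) \<union> (\<Union>e\<in>D \<times> D \<times> Pow q \<times> Pow q. E e)"
      unfolding X_def by blast
    then show ?thesis using Un_small[OF reg 1 2] card_of_mono1 ordLeq_ordLess_trans by blast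
  qed
  from greedy_avoid[of H X, OF reg init X_small]
  obtain H' where H': "H' \<subseteq> H" "|H'| =o |H|"
    and avoids: "\<forall>y\<in>H'. \<forall>q. finite q \<and> q \<subseteq> H' \<and> (\<forall>x\<in>q. x < y) \<longrightarrow> y \<notin> X q"
    by blast
  have avoid: "y \<notin> X q" if "y \<in> H'" "finite q" "q \<subseteq> H'" "\<forall>x\<in>q. x < y" for y q
    using avoids that by simp
  show ?thesis
  proof (rule that[OF H'])
    fix y b j assume y: "y \<in> H'" and b: "b \<in> [H']\<^bsup>n\<^esup>" and j: "j \<in> D"
      and below: "\<forall>x\<in>at_positions (m j) b. x < y"
    have bH: "b \<in> [H]\<^bsup>n\<^esup>" using b nsets_mono[OF H'(1)] by blast
    define q where "q = b \<inter> {..<y}"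
    have q: "finite q" "q \<subseteq> H'" "\<forall>x\<in>q. x < y" using nsetsD[OF b] unfolding q_def by auto
    then have qH: "q \<subseteq> H" using H'(1) by blast
    have "y \<notin> X q" by (rule avoid[OF y q])
    then have Ry: "\<forall>w\<in>R q. w < y" unfolding X_def by (auto simp: not_le)
    show "\<exists>c\<in>[H]\<^bsup>n\<^esup>. (\<forall>x\<in>c. x < y) \<and> F c j = F b j"
    proof (rule canonical_move_down[OF can j bH below R(1)[OF q(1) qH] _ Ry])
      show "\<forall>x\<in>b. x < y \<longrightarrow> (\<forall>w\<in>R q. x < w)" using R(2)[OF q(1) qH] by (simp add: q_def)
    qed blast
  next
    fix b z p i j assume b: "b \<in> [H']\<^bsup>n\<^esup>" and z: "z \<in> b" and j: "j \<in> D" and last: "position b z \<in> m j"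
      "m j \<subseteq> {..position b z}" and p: "finite p" "p \<subseteq> H'" "\<forall>x\<in>p. x < z" and i: "i \<in> D"
    have bH: "b \<in> [H]\<^bsup>n\<^esup>" using b nsets_mono[OF H'(1)] by blast
    \<comment> \<open>One finite set below \<open>z\<close> that contains both \<open>p\<close> and
      the lower part of \<open>b\<close>.\<close>
    define q where "q = p \<union> (b \<inter> {..<z})"
    have "z \<notin> X q" by (rule avoid) (use nsetsD[OF b] z p in \<open>auto simp: q_def\<close>)
    moreover have "(j, i, p, b \<inter> {..<z}) \<in> D \<times> D \<times> Pow q \<times> Pow q"
      using i j by (auto simp: q_def)
    ultimately have "z \<notin> E (j, i, p, b \<inter> {..<z})" unfolding X_def by blast
    then show "F b j \<noteq> f p i" unfolding E_iff using bH z last by blast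
  qed
qed

lemma initial_small_subset:
  fixes A M :: "'a::wellorder set"
  assumes "A \<subseteq> M" "|A| =o |M|" "\<And>x. x \<in> M \<Longrightarrow> |M \<inter> {..<x}| <o |M|" "x \<in> A"
  shows "|A \<inter> {..<x}| <o |A|"
proof -
  have "|A \<inter> {..<x}| \<le>o |M \<inter> {..<x}|" by (rule card_of_mono1) (use assms(1) in blast)
  moreover have "|M \<inter> {..<x}| <o |A|"
    by (rule ordLess_ordIso_trans[OF assms(3) ordIso_symmetric[OF assms(2)]]) (use assms in blast)
  ultimately show ?thesis by (rule ordLeq_ordLess_trans)
qed

text \<open>The ramification tree for the three kinds of question the induction asks about a top
  \<open>x\<close>: the colour, equality of two values under \<open>x\<close>, and equality with a
  value fixed below \<open>x\<close>.\<close>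

lemma end_homogeneous_tuples:
  fixes M :: "'a::wellorder set" and T :: "'t::wellorder set"
    and g :: "'a set \<Rightarrow> 'c" and f :: "'a set \<Rightarrow> 'i \<Rightarrow> 'v"
  assumes reg: "uncountable_regular T"
    and init: "\<And>t. t \<in> T \<Longrightarrow> |T \<inter> {..<t}| <o |T|"
    and N: "|N| <o |T|" and I: "|I| <o |T|"
    and X: "\<And>A. \<lbrakk>A \<subseteq> T; |A| <o |T|\<rbrakk> \<Longrightarrow> |Pow A| \<le>o |X|"
    and M: "|X| <o |M|"
    and gN: "\<And>b. b \<in> [M]\<^bsup>Suc n\<^esup> \<Longrightarrow> g b \<in> N"
  obtains \<delta> A where "\<delta> \<in> M" "A \<subseteq> M" "|A| =o |T|" "\<And>x. x \<in> A \<Longrightarrow> x < \<delta>"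
    "\<And>x. x \<in> A \<Longrightarrow> |A \<inter> {..<x}| <o |A|"
    "\<And>x a. \<lbrakk>x \<in> A; a \<in> [A \<inter> {..<x}]\<^bsup>n\<^esup>\<rbrakk> \<Longrightarrow> g (insert x a) = g (insert \<delta> a)"
    "\<And>x a b i j. \<lbrakk>x \<in> A; a \<in> [A \<inter> {..<x}]\<^bsup>n\<^esup>; b \<in> [A \<inter> {..<x}]\<^bsup>n\<^esup>; i \<in> I; j \<in> I\<rbrakk> \<Longrightarrow>
      f (insert x a) i = f (insert x b) j \<longleftrightarrow> f (insert \<delta> a) i = f (insert \<delta> b) j"
    "\<And>x a c i j. \<lbrakk>x \<in> A; a \<in> [A \<inter> {..<x}]\<^bsup>n\<^esup>; c \<in> [A \<inter> {..<x}]\<^bsup>Suc n\<^esup>; i \<in> I; j \<in> I\<rbrakk> \<Longrightarrow>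
      f (insert x a) i = f c j \<longleftrightarrow> f (insert \<delta> a) i = f c j"
proof -
  \<comment> \<open>For the last two kinds one list codes two sets: its first \<open>n\<close>
    entries and the remaining ones.\<close>
  define sat :: "'a \<Rightarrow> 'a list \<Rightarrow> 'c + ('i \<times> 'i) + ('i \<times> 'i) \<Rightarrow> bool" where
    "sat x l q = (case q of Inl c \<Rightarrow> g (insert x (set l)) = c
      | Inr (Inl (i, j)) \<Rightarrow> f (insert x (set (take n l))) i = f (insert x (set (drop n l))) j
      | Inr (Inr (i, j)) \<Rightarrow> f (insert x (set (take n l))) i = f (set (drop n l)) j)" for x l q
  define Q where "Q = N <+> ((I \<times> I) <+> (I \<times> I))"
  have II: "|I \<times> I| <o |T|" by (rule Sigma_small[OF reg I I])
  have Q: "|Q| <o |T|"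
    unfolding Q_def
    by (intro card_of_Plus_ordLess_infinite[OF reg_infinite[OF reg]] N II)
  obtain \<delta> A where *: "\<delta> \<in> M" "A \<subseteq> M" "|A| =o |T|" "\<And>x. x \<in> A \<Longrightarrow> x < \<delta>"
    "\<And>x. x \<in> A \<Longrightarrow> |A \<inter> {..<x}| <o |A|"
    "\<And>x l q. \<lbrakk>x \<in> A; set l \<subseteq> A \<inter> {..<x}; q \<in> Q\<rbrakk> \<Longrightarrow> sat x l q \<longleftrightarrow> sat \<delta> l q"
    using end_homogeneous[of T Q X M sat, OF reg init Q X M] by blast
  have enum: "\<exists>l. set l = a \<and> length l = card a" if "finite a" for a :: "'a set"
    using finite_distinct_list[OF that] distinct_card by metis
  show ?thesis
  proof (rule that[OF *(1-5)])
    fix x a assume x: "x \<in> A" and a: "a \<in> [A \<inter> {..<x}]\<^bsup>n\<^esup>"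
    obtain l where l: "set l = a" "length l = n" using enum nsetsD[OF a] by metis
    have "insert \<delta> a \<in> [M]\<^bsup>Suc n\<^esup>"
      by (rule insert_in_nsets) (use a *(1,2,4) nsetsD[OF a] in \<open>auto simp: nsets_def\<close>)
    then have "Inl (g (insert \<delta> a)) \<in> Q" unfolding Q_def using gN by blast
    then show "g (insert x a) = g (insert \<delta> a)"
      using *(6)[OF x, of l "Inl (g (insert \<delta> a))"] l nsetsD[OF a] by (simp add: sat_def)
  next
    fix x a b i j assume x: "x \<in> A" and a: "a \<in> [A \<inter> {..<x}]\<^bsup>n\<^esup>" and b: "b \<in> [A \<inter> {..<x}]\<^bsup>n\<^esup>"
      and ij: "i \<in> I" "j \<in> I"
    obtain l where l: "set l = a" "length l = n" using enum nsetsD[OF a] by metis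
    obtain l' where l': "set l' = b" "length l' = n" using enum nsetsD[OF b] by metis
    have "Inr (Inl (i, j)) \<in> Q" unfolding Q_def using ij by blast
    then show "f (insert x a) i = f (insert x b) j \<longleftrightarrow> f (insert \<delta> a) i = f (insert \<delta> b) j"
      using *(6)[OF x, of "l @ l'" "Inr (Inl (i, j))"] l l' nsetsD[OF a] nsetsD[OF b] by (simp add: sat_def)
  next
    fix x a c i j assume x: "x \<in> A" and a: "a \<in> [A \<inter> {..<x}]\<^bsup>n\<^esup>" and c: "c \<in> [A \<inter> {..<x}]\<^bsup>Suc n\<^esup>"
      and ij: "i \<in> I" "j \<in> I"
    obtain l where l: "set l = a" "length l = n" using enum nsetsD[OF a] by metis
    obtain l' where l': "set l' = c" "length l' = Suc n" using enum nsetsD[OF c] by metis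
    have "Inr (Inr (i, j)) \<in> Q" unfolding Q_def using ij by blast
    then show "f (insert x a) i = f c j \<longleftrightarrow> f (insert \<delta> a) i = f c j"
      using *(6)[OF x, of "l @ l'" "Inr (Inr (i, j))"] l l' nsetsD[OF a] nsetsD[OF c] by (simp add: sat_def)
  qed
qed

text \<open>Colours are elements of \<open>'l\<close> so that one statement, at fixed types, serves
  in all dimensions although each step refines the colouring.\<close>

definition delta_property :: "'l set \<Rightarrow> nat \<Rightarrow> 'a::wellorder set \<Rightarrow> ('a set \<Rightarrow> 'l) \<Rightarrow>
    ('a set \<Rightarrow> 'i \<Rightarrow> 'v) \<Rightarrow> 'l set \<Rightarrow> ('l \<Rightarrow> 'i set) \<Rightarrow> bool" where
  "delta_property L n M g f N D \<longleftrightarrow> (\<exists>H k m. H \<subseteq> M \<and> |H| =o |L| \<and> k \<in> N \<and> (\<forall>b\<in>[H]\<^bsup>n\<^esup>. g b = k) \<and>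
     canonical n H f (D k) m \<and> shift_invariant n H f (D k))"

text \<open>The values \<open>F a i\<close> with \<open>i \<in> J a\<close> are those already attained below \<open>\<delta>\<close>; after the first thinning they
  are attained by \<open>f (insert \<alpha> a) i\<close> for every later \<open>\<alpha>\<close>. The remaining values are new at each \<open>\<alpha>\<close>, and
  the second thinning prevents them from reappearing as values \<open>F b j\<close> of the first kind.\<close>

lemma dimension_step:
  fixes M :: "'a::wellorder set" and T :: "'t::wellorder set" and L :: "'l set"
    and g :: "'a set \<Rightarrow> 'l" and f :: "'a set \<Rightarrow> 'i \<Rightarrow> 'v"
  assumes regL: "uncountable_regular L" and regT: "uncountable_regular T" and LT: "|L| \<le>o |T|"
    and init: "\<And>t. t \<in> T \<Longrightarrow> |T \<inter> {..<t}| <o |T|"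
    and X: "\<And>A. \<lbrakk>A \<subseteq> T; |A| <o |T|\<rbrakk> \<Longrightarrow> |Pow A| \<le>o |X|" and M: "|X| <o |M|"
    and idx: "small_indexing L N D"
    and g: "\<And>b. b \<in> [M]\<^bsup>Suc n\<^esup> \<Longrightarrow> g b \<in> N \<and> inj_on (f b) (D (g b))"
    and IH: "\<And>A g' (F :: 'a set \<Rightarrow> 'i \<Rightarrow> 'v) N' D'.
      \<lbrakk>|A| =o |T|; \<And>x. x \<in> A \<Longrightarrow> |A \<inter> {..<x}| <o |A|; small_indexing L N' D';
       \<And>b. b \<in> [A]\<^bsup>n\<^esup> \<Longrightarrow> g' b \<in> N' \<and> inj_on (F b) (D' (g' b))\<rbrakk> \<Longrightarrow> delta_property L n A g' F N' D'"
  shows "delta_property L (Suc n) M g f N D"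
proof -
  define I where "I = (\<Union>c\<in>N. D c)"
  have NL: "|N| <o |L|" using idx by (simp add: small_indexing_def)
  have DL: "|D c| <o |L|" if "c \<in> N" for c by (rule small_indexing_Pow(2)[OF idx that regL])
  have IL: "|I| <o |L|" unfolding I_def by (rule UN_small[OF regL NL DL])
  obtain \<delta> A where \<delta>: "\<delta> \<in> M" and A: "A \<subseteq> M" "|A| =o |T|" and A\<delta>: "\<And>x. x \<in> A \<Longrightarrow> x < \<delta>"
    and initA: "\<And>x. x \<in> A \<Longrightarrow> |A \<inter> {..<x}| <o |A|"
    and g_top: "\<And>x a. \<lbrakk>x \<in> A; a \<in> [A \<inter> {..<x}]\<^bsup>n\<^esup>\<rbrakk> \<Longrightarrow> g (insert x a) = g (insert \<delta> a)"
    and f_top: "\<And>x a b i j. \<lbrakk>x \<in> A; a \<in> [A \<inter> {..<x}]\<^bsup>n\<^esup>; b \<in> [A \<inter> {..<x}]\<^bsup>n\<^esup>; i \<in> I; j \<in> I\<rbrakk> \<Longrightarrow>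
      f (insert x a) i = f (insert x b) j \<longleftrightarrow> f (insert \<delta> a) i = f (insert \<delta> b) j"
    and f_below: "\<And>x a c i j. \<lbrakk>x \<in> A; a \<in> [A \<inter> {..<x}]\<^bsup>n\<^esup>; c \<in> [A \<inter> {..<x}]\<^bsup>Suc n\<^esup>; i \<in> I; j \<in> I\<rbrakk> \<Longrightarrow>
      f (insert x a) i = f c j \<longleftrightarrow> f (insert \<delta> a) i = f c j"
    by (rule end_homogeneous_tuples[of T N I X M n g f, OF regT init ordLess_ordLeq_trans[OF NL LT]
          ordLess_ordLeq_trans[OF IL LT] X M]) (use g in blast)+
  have regA: "uncountable_regular A" by (rule uncountable_regular_cong[OF regT A(2)])
  have LA: "|L| \<le>o |A|" by (rule ordLeq_ordIso_trans[OF LT ordIso_symmetric[OF A(2)]])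
  define F where "F a = f (insert \<delta> a)" for a
  define G where "G a = g (insert \<delta> a)" for a
  have top: "insert \<delta> a \<in> [M]\<^bsup>Suc n\<^esup>" if "a \<in> [A]\<^bsup>n\<^esup>" for a
    by (rule insert_in_nsets) (use that A(1) \<delta> A\<delta> nsets_mono[OF A(1), of n] nsetsD[OF that] in auto)
  have G: "G a \<in> N" "inj_on (F a) (D (G a))" if "a \<in> [A]\<^bsup>n\<^esup>" for a
    using g[OF top[OF that]] by (simp_all add: F_def G_def)
  have DI: "i \<in> I" if "i \<in> D c" "c \<in> N" for i c using that unfolding I_def by blast
  define V where "V B = (\<Union>c\<in>[B]\<^bsup>Suc n\<^esup>. f c ` D (g c))" for B
  define J where "J a = {i \<in> D (G a). F a i \<in> V A}" for a
  have V_mono: "V B \<subseteq> V B'" if "B \<subseteq> B'" for B B' unfolding V_def using nsets_mono[OF that] by blast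

  \<comment> \<open>For \<open>i \<in> J a\<close> some tuple \<open>c\<close> from \<open>A\<close>
    attains \<open>F a i\<close>, and every \<open>y\<close> above \<open>c\<close> sees it. Hence
    only the points up to \<open>Max c\<close> are lost for each such \<open>i\<close>.\<close>
  define Y where "Y a = (if card a = n then \<Union>i\<in>J a. {y. F a i \<notin> V (A \<inter> {..<y})} else {})" for a
  have Y_small: "|A \<inter> Y a| <o |A|" if a: "finite a" "a \<subseteq> A" for a
  proof (cases "card a = n")
    case True
    then have aA: "a \<in> [A]\<^bsup>n\<^esup>" using a by (simp add: nsets_def)
    have "|A \<inter> {y. F a i \<notin> V (A \<inter> {..<y})}| <o |A|" if i: "i \<in> J a" for i
    proof -
      obtain c j where c: "c \<in> [A]\<^bsup>Suc n\<^esup>" "j \<in> D (g c)" "F a i = f c j"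
        using i unfolding J_def V_def by blast
      define w where "w = Max c"
      have "c \<noteq> {}" using nsetsD[OF c(1)] by auto
      then have w: "w \<in> A" "\<And>x. x \<in> c \<Longrightarrow> x \<le> w"
        using nsetsD[OF c(1)] subsetD[OF _ Max_in[of c], of A] unfolding w_def by auto
      have "y \<in> A \<inter> {..<w} \<union> {w}" if y: "y \<in> A" "F a i \<notin> V (A \<inter> {..<y})" for y
      proof (rule ccontr)
        assume "y \<notin> A \<inter> {..<w} \<union> {w}"
        then have "w < y" using y(1) by auto
        then have "c \<in> [A \<inter> {..<y}]\<^bsup>Suc n\<^esup>" using w(2) nsetsD[OF c(1)] by (fastforce simp: nsets_def)
        then show False using y(2) c(2,3) unfolding V_def by blast
      qed
      then have "A \<inter> {y. F a i \<notin> V (A \<inter> {..<y})} \<subseteq> A \<inter> {..<w} \<union> {w}" by blast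
      moreover have "|A \<inter> {..<w} \<union> {w}| <o |A|"
        by (rule Un_small[OF regA initA[OF w(1)] finite_ordLess_reg[OF regA]]) simp
      ultimately show ?thesis by (rule ordLeq_ordLess_trans[OF card_of_mono1])
    qed
    moreover have "|J a| <o |A|"
    proof -
      have "|J a| \<le>o |D (G a)|" by (rule card_of_mono1) (auto simp: J_def)
      then show ?thesis
        by (rule ordLeq_ordLess_trans[OF _ ordLess_ordLeq_trans[OF DL[OF G(1)[OF aA]] LA]])
    qed
    ultimately have "|\<Union>i\<in>J a. A \<inter> {y. F a i \<notin> V (A \<inter> {..<y})}| <o |A|" by (intro UN_small[OF regA])
    then show ?thesis unfolding Y_def if_P[OF True] Int_UN_distrib .
  next
    case False
    then show ?thesis using finite_ordLess_reg[OF regA, of "{}"] by (simp add: Y_def)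
  qed
  from greedy_avoid[of A Y, OF regA initA Y_small]
  obtain A' where A': "A' \<subseteq> A" "|A'| =o |A|"
    and avoidY: "\<forall>y\<in>A'. \<forall>q. finite q \<and> q \<subseteq> A' \<and> (\<forall>x\<in>q. x < y) \<longrightarrow> y \<notin> Y q"
    by blast
  have V_early: "F a i \<in> V (A \<inter> {..<y})" if "a \<in> [A']\<^bsup>n\<^esup>" "y \<in> A'" "\<forall>x\<in>a. x < y" "i \<in> J a" for a y i
  proof -
    have "y \<notin> Y a" using avoidY that nsetsD[OF that(1)] by blast
    then show ?thesis using that(4) nsetsD[OF that(1)] unfolding Y_def by auto
  qed
  have nA': "a \<in> [A]\<^bsup>n\<^esup>" if "a \<in> [A']\<^bsup>n\<^esup>" for a using nsets_mono[OF A'(1)] that by blast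

  \<comment> \<open>Colours refined by the set of indices independent of the top. They are coded
    back into \<open>L\<close> by \<open>\<phi>\<close>, and \<open>D'\<close> recovers the index
    set from the first component.\<close>
  define C where "C = (SIGMA c:N. Pow (D c))"
  have CL: "|C| <o |L|"
    unfolding C_def by (rule Sigma_small[OF regL NL small_indexing_Pow(1)[OF idx _ regL]])
  then obtain \<phi> where \<phi>: "inj_on \<phi> C" "\<phi> ` C \<subseteq> L"
    using ordLess_imp_ordLeq[OF CL] unfolding card_of_ordLeq[symmetric] by blast
  define D' where "D' l = D (fst (inv_into C \<phi> l))" for l
  have D'\<phi>: "D' (\<phi> x) = D (fst x)" if "x \<in> C" for x
    unfolding D'_def using inv_into_f_f[OF \<phi>(1) that] by simp
  have GJ: "(G a, J a) \<in> C" if "a \<in> [A']\<^bsup>n\<^esup>" for a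
    unfolding C_def using G(1)[OF nA'[OF that]] by (auto simp: J_def)
  have "small_indexing L (\<phi> ` C) D'"
    unfolding small_indexing_def
  proof (intro conjI ballI allI impI)
    show "|\<phi> ` C| <o |L|" by (rule ordLeq_ordLess_trans[OF card_of_image CL])
    fix c and \<Theta> :: "'l set" assume "c \<in> \<phi> ` C" and \<Theta>: "|\<Theta>| <o |L|"
    then obtain x where "x \<in> C" "c = \<phi> x" by blast
    then show "|Func (D' c) \<Theta>| <o |L|"
      using D'\<phi> small_indexing_Func[OF idx _ \<Theta>, of "fst x"] by (auto simp: C_def)
  qed
  then have "delta_property L n A' (\<lambda>a. \<phi> (G a, J a)) F (\<phi> ` C) D'"
  proof (rule IH[rotated 2])
    show "|A'| =o |T|" by (rule ordIso_transitive[OF A'(2) A(2)])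
    show "|A' \<inter> {..<x}| <o |A'|" if "x \<in> A'" for x
      by (rule initial_small_subset[OF A' initA that])
    show "\<phi> (G b, J b) \<in> \<phi> ` C \<and> inj_on (F b) (D' (\<phi> (G b, J b)))" if "b \<in> [A']\<^bsup>n\<^esup>" for b
      using GJ[OF that] D'\<phi>[OF GJ[OF that]] G(2)[OF nA'[OF that]] by simp
  qed
  then obtain H0 k' m where H0: "H0 \<subseteq> A'" "|H0| =o |L|" and k': "k' \<in> \<phi> ` C" "\<forall>b\<in>[H0]\<^bsup>n\<^esup>. \<phi> (G b, J b) = k'"
    and can0: "canonical n H0 F (D' k') m" and shift0: "shift_invariant n H0 F (D' k')"
    unfolding delta_property_def by blast
  obtain k K where kK: "(k, K) \<in> C" "k' = \<phi> (k, K)" using k'(1) by auto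
  have kN: "k \<in> N" and KD: "K \<subseteq> D k" using kK(1) by (auto simp: C_def)
  have D'k: "D' k' = D k" using D'\<phi>[OF kK(1)] kK(2) by simp
  have GJ0: "G b = k" "J b = K" if b: "b \<in> [H0]\<^bsup>n\<^esup>" for b
  proof -
    have "b \<in> [A']\<^bsup>n\<^esup>" using b nsets_mono[OF H0(1)] by blast
    then have "(G b, J b) = (k, K)"
      using inj_onD[OF \<phi>(1) _ GJ kK(1)] k'(2) b kK(2) by simp
    then show "G b = k" "J b = K" by simp_all
  qed

  \<comment> \<open>The size of \<open>H0\<close> says nothing about its initial segments, which
    must be small for \<open>thin_values\<close>.\<close>
  obtain H1 where H1: "H1 \<subseteq> H0" "|H1| =o |H0|" and init1: "\<And>x. x \<in> H1 \<Longrightarrow> |H1 \<inter> {..<x}| <o |H1|"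
    by (rule obtain_initial_of_same_card[of H0]) (rule that)
  have H1L: "|H1| =o |L|" by (rule ordIso_transitive[OF H1(2) H0(2)])
  have regH1: "uncountable_regular H1" by (rule uncountable_regular_cong[OF regL H1L])
  have DH1: "|D k| <o |H1|" by (rule ordLess_ordIso_trans[OF DL[OF kN] ordIso_symmetric[OF H1L]])
  have can1: "canonical n H1 F (D k) m" using canonical_subset[OF can0 H1(1)] D'k by simp
  obtain H where H: "H \<subseteq> H1" "|H| =o |H1|"
    and down: "\<And>y b j. \<lbrakk>y \<in> H; b \<in> [H]\<^bsup>n\<^esup>; j \<in> D k; \<forall>x\<in>at_positions (m j) b. x < y\<rbrakk>
      \<Longrightarrow> \<exists>c\<in>[H1]\<^bsup>n\<^esup>. (\<forall>x\<in>c. x < y) \<and> F c j = F b j"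
    and fresh: "\<And>b z p i j. \<lbrakk>b \<in> [H]\<^bsup>n\<^esup>; z \<in> b; j \<in> D k; position b z \<in> m j; m j \<subseteq> {..position b z};
        finite p; p \<subseteq> H; \<forall>x\<in>p. x < z; i \<in> D k\<rbrakk> \<Longrightarrow> F b j \<noteq> f p i"
    by (rule thin_values[of H1 "D k" n F m f, OF regH1 init1 DH1 can1], assumption) (rule that)
  have HA': "H \<subseteq> A'" and H1A': "H1 \<subseteq> A'" and HH0: "H \<subseteq> H0" using H(1) H1(1) H0(1) by blast+
  have HA: "H \<subseteq> A" using HA' A'(1) by blast
  have canH: "canonical n H F (D k) m" by (rule canonical_subset[OF can1 H(1)])
  have shiftH: "shift_invariant n H F (D k)" using shift_invariant_subset[OF shift0 HH0] D'k by simp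
  have GJH: "G b = k" "J b = K" if "b \<in> [H]\<^bsup>n\<^esup>" for b
    using GJ0 nsets_mono[OF HH0] that by blast+
  have below: "a \<in> [A \<inter> {..<\<alpha>}]\<^bsup>n\<^esup>" if "a \<in> [H]\<^bsup>n\<^esup>" "\<forall>x\<in>a. x < \<alpha>" for a \<alpha>
    using that HA by (auto simp: nsets_def)
  have gk: "g (insert \<alpha> a) = k" if "a \<in> [H]\<^bsup>n\<^esup>" "\<alpha> \<in> H" "\<forall>x\<in>a. x < \<alpha>" for a \<alpha>
    using g_top[OF _ below[OF that(1,3)]] GJH[OF that(1)] that(2) HA unfolding G_def by auto
  have DkI: "i \<in> I" if "i \<in> D k" for i using DI[OF that kN] .

  \<comment> \<open>\<open>F a i\<close> equals some \<open>f c j\<close> with \<open>c\<close>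
    below \<open>\<alpha>\<close>, and over such a \<open>c\<close> the tops \<open>\<alpha>\<close>
    and \<open>\<delta>\<close> behave alike.\<close>
  have stable_val: "f (insert \<alpha> a) i = F a i"
    if a: "a \<in> [H]\<^bsup>n\<^esup>" "\<alpha> \<in> H" "\<forall>x\<in>a. x < \<alpha>" and i: "i \<in> K" for a \<alpha> i
  proof -
    have "F a i \<in> V (A \<inter> {..<\<alpha>})"
      by (rule V_early) (use a i GJH[OF a(1)] HA' nsets_mono[OF HA', of n] in auto)
    then obtain c j where c: "c \<in> [A \<inter> {..<\<alpha>}]\<^bsup>Suc n\<^esup>" "j \<in> D (g c)" "F a i = f c j"
      unfolding V_def by blast
    have "c \<in> [M]\<^bsup>Suc n\<^esup>" using c(1) A(1) by (auto simp: nsets_def)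
    then have "j \<in> I" using DI[OF c(2)] g by blast
    then show ?thesis
      using f_below[OF _ below[OF a(1,3)] c(1), of i j] a(2) HA DkI i KD c(3) unfolding F_def by auto
  qed
  \<comment> \<open>The same transfer backwards: a coincidence with an old value under
    \<open>\<alpha>\<close> would also hold under \<open>\<delta>\<close> and put \<open>i\<close>
    into \<open>J a\<close>.\<close>
  have unstable_val: "f (insert \<alpha> a) i \<notin> V (A \<inter> {..<\<alpha>})"
    if a: "a \<in> [H]\<^bsup>n\<^esup>" "\<alpha> \<in> H" "\<forall>x\<in>a. x < \<alpha>" and i: "i \<in> D k" "i \<notin> K" for a \<alpha> i
  proof
    assume "f (insert \<alpha> a) i \<in> V (A \<inter> {..<\<alpha>})"
    then obtain c j where c: "c \<in> [A \<inter> {..<\<alpha>}]\<^bsup>Suc n\<^esup>" "j \<in> D (g c)" "f (insert \<alpha> a) i = f c j"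
      unfolding V_def by blast
    have cM: "c \<in> [M]\<^bsup>Suc n\<^esup>" and cA: "c \<in> [A]\<^bsup>Suc n\<^esup>" using c(1) A(1) by (auto simp: nsets_def)
    then have "j \<in> I" using DI[OF c(2)] g by blast
    then have "F a i = f c j"
      using f_below[OF _ below[OF a(1,3)] c(1), of i j] a(2) HA DkI i c(3) unfolding F_def by auto
    then have "F a i \<in> V A" using cA c(2) unfolding V_def by blast
    then have "i \<in> J a" unfolding J_def using i(1) GJH(1)[OF a(1)] by simp
    then show False using i(2) GJH(2)[OF a(1)] by simp
  qed
  \<comment> \<open>If all coordinates relevant to \<open>F b j\<close> lie below
    \<open>\<alpha>\<close>, a tuple \<open>c\<close> from \<open>H1\<close> below
    \<open>\<alpha>\<close> has the same value, which is old at \<open>\<alpha>\<close>, unlike the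
    left side. Otherwise the last relevant coordinate exceeds \<open>\<alpha>\<close>, as
    \<open>\<alpha> \<notin> b\<close>, and \<open>fresh\<close> applies with
    \<open>p = insert \<alpha> a\<close>.\<close>
  have mixed: "f (insert \<alpha> a) i \<noteq> F b j"
    if a: "a \<in> [H]\<^bsup>n\<^esup>" "\<alpha> \<in> H" "\<forall>x\<in>a. x < \<alpha>" and b: "b \<in> [H]\<^bsup>n\<^esup>" "\<alpha> \<notin> b"
      and i: "i \<in> D k" "i \<notin> K" and j: "j \<in> K" for a b \<alpha> i j
  proof (cases "\<forall>x\<in>at_positions (m j) b. x < \<alpha>")
    case True
    obtain c where c: "c \<in> [H1]\<^bsup>n\<^esup>" "\<forall>x\<in>c. x < \<alpha>" "F c j = F b j"
      using down[OF a(2) b(1) _ True] j KD by blast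
    have "F c j \<in> V (A \<inter> {..<\<alpha>})"
      by (rule V_early) (use c(1,2) a(2) j GJ0(2)[of c] HA' nsets_mono[OF H1A', of n] nsets_mono[OF H1(1), of n] in auto)
    then show ?thesis using unstable_val[OF a i] c(3) by metis
  next
    case False
    have finb: "finite b" "card b = n" using nsetsD[OF b(1)] by auto
    define z where "z = Max (at_positions (m j) b)"
    have fin: "finite (at_positions (m j) b)" "at_positions (m j) b \<noteq> {}"
      using False finb by (auto simp: at_positions_def)
    have z: "z \<in> at_positions (m j) b" "\<And>x. x \<in> at_positions (m j) b \<Longrightarrow> x \<le> z"
      unfolding z_def using Max_in[OF fin] Max_ge[OF fin(1)] by auto
    then have zb: "z \<in> b" "position b z \<in> m j" by (auto simp: at_positions_def)
    have "\<alpha> \<le> z" using False z(2) by (meson leI order_trans)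
    then have "\<alpha> < z" using zb(1) b(2) by (metis order_le_imp_less_or_eq)
    have "m j \<subseteq> {..position b z}"
    proof
      fix p assume p: "p \<in> m j"
      then have "p \<in> position b ` b"
        using canonicalD(1)[OF canH] j KD position_image[OF finb(1)] finb(2) by blast
      then obtain x where x: "x \<in> b" "p = position b x" by blast
      then have "x \<le> z" using z(2) p by (simp add: at_positions_def)
      then show "p \<in> {..position b z}" using position_less_iff[OF finb(1) zb(1) x(1)] x(2) by auto
    qed
    then have "F b j \<noteq> f (insert \<alpha> a) i"
      by (intro fresh[OF b(1) zb(1) _ zb(2)])
        (use j KD i(1) \<open>\<alpha> < z\<close> a nsetsD[OF a(1)] in auto)
    then show ?thesis by simp
  qed
  have same_top: "f (insert \<alpha> a) i = f (insert \<alpha> b) j \<longleftrightarrow> F a i = F b j"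
    if "a \<in> [H]\<^bsup>n\<^esup>" "b \<in> [H]\<^bsup>n\<^esup>" "\<alpha> \<in> H" "\<forall>x\<in>a. x < \<alpha>" "\<forall>x\<in>b. x < \<alpha>" "i \<in> D k" "j \<in> D k" for a b \<alpha> i j
    unfolding F_def using f_top[OF _ below[OF that(1,4)] below[OF that(2,5)]] that HA DkI by auto
  \<comment> \<open>Only the index at the higher top has to be unstable: the value at the lower top
    is an old value for \<open>\<beta>\<close>.\<close>
  have both_unstable: "f (insert \<alpha> a) i \<noteq> f (insert \<beta> b) j"
    if a: "a \<in> [H]\<^bsup>n\<^esup>" "\<alpha> \<in> H" "\<forall>x\<in>a. x < \<alpha>" and b: "b \<in> [H]\<^bsup>n\<^esup>" "\<beta> \<in> H" "\<forall>x\<in>b. x < \<beta>"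
      and "\<alpha> < \<beta>" and i: "i \<in> D k" and j: "j \<in> D k" "j \<notin> K" for a b \<alpha> \<beta> i j
  proof -
    have "insert \<alpha> a \<in> [A \<inter> {..<\<beta>}]\<^bsup>Suc n\<^esup>"
      by (rule insert_in_nsets) (use a \<open>\<alpha> < \<beta>\<close> HA in \<open>auto simp: nsets_def\<close>)
    then have "f (insert \<alpha> a) i \<in> V (A \<inter> {..<\<beta>})" unfolding V_def using gk[OF a] i by blast
    then show ?thesis using unstable_val[OF b j] by metis
  qed
  have diff_top: "f (insert \<alpha> a) i = f (insert \<beta> b) j \<longleftrightarrow> i \<in> K \<and> j \<in> K \<and> F a i = F b j"
    if a: "a \<in> [H]\<^bsup>n\<^esup>" and b: "b \<in> [H]\<^bsup>n\<^esup>" and \<alpha>: "\<alpha> \<in> H" and \<beta>: "\<beta> \<in> H"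
      and a\<alpha>: "\<forall>x\<in>a. x < \<alpha>" and b\<beta>: "\<forall>x\<in>b. x < \<beta>" and neq: "\<alpha> \<noteq> \<beta>" and notin: "\<alpha> \<notin> b" "\<beta> \<notin> a"
      and i: "i \<in> D k" and j: "j \<in> D k" for a b \<alpha> \<beta> i j
  proof (cases "i \<in> K"; cases "j \<in> K")
    assume "i \<in> K" "j \<in> K"
    then show ?thesis using stable_val[OF a \<alpha> a\<alpha>] stable_val[OF b \<beta> b\<beta>] by simp
  next
    assume iK: "i \<in> K" and jK: "j \<notin> K"
    have "f (insert \<beta> b) j \<noteq> F a i" by (rule mixed[OF b \<beta> b\<beta> a notin(2) j jK iK])
    then show ?thesis using stable_val[OF a \<alpha> a\<alpha> iK] jK by simp
  next
    assume iK: "i \<notin> K" and jK: "j \<in> K"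
    have "f (insert \<alpha> a) i \<noteq> F b j" by (rule mixed[OF a \<alpha> a\<alpha> b notin(1) i iK jK])
    then show ?thesis using stable_val[OF b \<beta> b\<beta> jK] iK by simp
  next
    assume iK: "i \<notin> K" and jK: "j \<notin> K"
    have "f (insert \<alpha> a) i \<noteq> f (insert \<beta> b) j"
    proof (cases "\<alpha> < \<beta>")
      case True
      then show ?thesis by (rule both_unstable[OF a \<alpha> a\<alpha> b \<beta> b\<beta> _ i j jK])
    next
      case False
      then have "\<beta> < \<alpha>" using neq by simp
      then have "f (insert \<beta> b) j \<noteq> f (insert \<alpha> a) i" by (rule both_unstable[OF b \<beta> b\<beta> a \<alpha> a\<alpha> _ j i iK])
      then show ?thesis by simp
    qed
    then show ?thesis using iK by simp
  qed

  show ?thesis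
    unfolding delta_property_def
  proof (intro exI conjI)
    show "H \<subseteq> M" using HA A(1) by blast
    show "|H| =o |L|" by (rule ordIso_transitive[OF H(2) H1L])
    show "k \<in> N" by (rule kN)
    show "\<forall>b\<in>[H]\<^bsup>Suc n\<^esup>. g b = k" using gk by (metis nsets_Suc_topE)
    show "canonical (Suc n) H f (D k) (\<lambda>i. if i \<in> K then m i else insert n (m i))"
      by (rule canonical_Suc[OF stable_val same_top diff_top canH])
    show "shift_invariant (Suc n) H f (D k)"
      by (rule shift_invariant_Suc[OF stable_val same_top diff_top shiftH])
  qed
qed

section \<open>Induction along the values of sigma\<close>

lemma sigma_card_SucE:
  fixes S :: "'a set"
  assumes "sigma_card L (Suc (Suc n)) S"
  obtains T X :: "'a set" where "sigma_card L (Suc n) T" "|S| =o cardSuc |X|" "|T| \<le>o |X|"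
    "\<And>A :: 'a set. |A| <o |T| \<Longrightarrow> |Pow A| \<le>o |X|"
proof -
  obtain T X :: "'a set" where T: "sigma_card L (Suc n) T" "|S| =o cardSuc |X|"
    and sup: "is_sup_card {Pow A | A :: 'a set. |A| <o |T| } X"
    using assms by auto
  have X: "|Pow A| \<le>o |X|" if "|A| <o |T|" for A :: "'a set"
    using sup that unfolding is_sup_card_def by blast
  show ?thesis using that[OF T card_le_if_Pow_le X] X by blast
qed

lemma sigma_card_cong:
  fixes S S' :: "'a set"
  assumes "sigma_card L n S" "|S'| =o |S|"
  shows "sigma_card L n S'"
proof (cases n)
  case (Suc k)
  show ?thesis
  proof (cases k)
    case 0
    then show ?thesis using Suc assms(1) ordIso_transitive[OF assms(2)] by simp
  next
    case (Suc j)
    then show ?thesis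
      using \<open>n = Suc k\<close> assms(1) ordIso_transitive[OF assms(2)] unfolding Suc by (simp only: sigma_card.simps) blast
  qed
qed (use assms in simp)

text \<open>Successors of infinite cardinals are regular, and \<open>|T| \<le>o |X|\<close> makes
  the values of sigma increase.\<close>

lemma sigma_card_regular:
  fixes S :: "'a set"
  assumes reg: "uncountable_regular L"
  shows "sigma_card L (Suc n) S \<Longrightarrow> uncountable_regular S \<and> |L| \<le>o |S|"
proof (induction n arbitrary: S)
  case 0
  then have "|S| =o |L|" by simp
  then show ?case
    using uncountable_regular_cong[OF reg] ordIso_imp_ordLeq[OF ordIso_symmetric] by blast
next
  case (Suc n)
  obtain T X :: "'a set" where T: "sigma_card L (Suc n) T" "|S| =o cardSuc |X|" "|T| \<le>o |X|"
    and "\<And>A :: 'a set. |A| <o |T| \<Longrightarrow> |Pow A| \<le>o |X|"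
    by (rule sigma_card_SucE[OF Suc.prems]) (rule that)
  have regT: "uncountable_regular T" and LT: "|L| \<le>o |T|" using Suc.IH[OF T(1)] by auto
  have "infinite X" using reg_infinite[OF regT] card_of_ordLeq_infinite[OF T(3)] by blast
  then have cinf: "Cinfinite |X|" by (simp add: cinfinite_def Field_card_of card_of_card_order_on)
  then have "Cinfinite (cardSuc |X| )" by (rule Cinfinite_cardSuc)
  then have "stable (cardSuc |X| )"
    using regularCard_stable[of "cardSuc |X|"] regularCard_cardSuc[OF cinf] by (simp add: cinfinite_def)
  then have "stable |S|" by (rule stable_ordIso1[OF _ T(2)])
  have XS: "|X| <o |S|"
    by (rule ordLess_ordIso_trans[OF cardSuc_greater[OF card_of_Card_order] ordIso_symmetric[OF T(2)]])
  have TS: "|T| <o |S|" by (rule ordLeq_ordLess_trans[OF T(3) XS])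
  have "|UNIV :: nat set| <o |T|" using regT by (simp add: uncountable_regular_def)
  then have "|UNIV :: nat set| <o |S|" by (rule ordLess_transitive[OF _ TS])
  then show ?case
    using \<open>stable |S|\<close> ordLeq_transitive[OF LT ordLess_imp_ordLeq[OF TS]]
    by (simp add: uncountable_regular_def)
qed

lemma canonical_delta_system:
  fixes M :: "'a::wellorder set" and L :: "'l set" and f :: "'a set \<Rightarrow> 'i \<Rightarrow> 'v"
  assumes reg: "uncountable_regular L"
    and "sigma_card L (Suc n) M" "\<And>x. x \<in> M \<Longrightarrow> |M \<inter> {..<x}| <o |M|"
    and "small_indexing L N D"
    and "\<And>b. b \<in> [M]\<^bsup>Suc n\<^esup> \<Longrightarrow> g b \<in> N \<and> inj_on (f b) (D (g b))"
  shows "delta_property L (Suc n) M g f N D"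
  using assms(2-)
proof (induction n arbitrary: M g f N D)
  case 0
  have M_L: "|M| =o |L|" using 0(1) by simp
  show ?case
    unfolding delta_property_def
    by (rule dimension_one[OF reg M_L 0(2,3,4)], assumption+) blast
next
  case (Suc n)
  obtain T X :: "'a set" where T: "sigma_card L (Suc n) T" "|M| =o cardSuc |X|" "|T| \<le>o |X|"
    and X: "\<And>A :: 'a set. |A| <o |T| \<Longrightarrow> |Pow A| \<le>o |X|"
    by (rule sigma_card_SucE[OF Suc.prems(1)]) (rule that)
  \<comment> \<open>The ramification tree takes its ranks from this set, so its proper initial
    segments have to be small; \<open>T\<close> is given only up to cardinality.\<close>
  obtain T' where T': "T' \<subseteq> T" "|T'| =o |T|" "\<And>x. x \<in> T' \<Longrightarrow> |T' \<inter> {..<x}| <o |T'|"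
    by (rule obtain_initial_of_same_card[of T]) (rule that)
  have regT: "uncountable_regular T" and LT: "|L| \<le>o |T|" using sigma_card_regular[OF reg T(1)] by auto
  have XM: "|X| <o |M|"
    by (rule ordLess_ordIso_trans[OF cardSuc_greater[OF card_of_Card_order] ordIso_symmetric[OF T(2)]])
  show ?case
  proof (rule dimension_step[of L T' X M N D "Suc n" g f, OF reg uncountable_regular_cong[OF regT T'(2)]
        ordLeq_ordIso_trans[OF LT ordIso_symmetric[OF T'(2)]] T'(3) _ XM Suc.prems(3,4)])
    show "|Pow A| \<le>o |X|" if "A \<subseteq> T'" "|A| <o |T'|" for A
      by (rule X[OF ordLess_ordIso_trans[OF that(2) T'(2)]])
    show "delta_property L (Suc n) A g' F N' D'"
      if A: "|A| =o |T'|" "\<And>x. x \<in> A \<Longrightarrow> |A \<inter> {..<x}| <o |A|" "small_indexing L N' D'"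
        "\<And>b. b \<in> [A]\<^bsup>Suc n\<^esup> \<Longrightarrow> g' b \<in> N' \<and> inj_on (F b) (D' (g' b))"
      for A g' and F :: "'a set \<Rightarrow> 'i \<Rightarrow> 'v" and N' D'
      by (rule Suc.IH[OF sigma_card_cong[OF T(1) ordIso_transitive[OF A(1) T'(2)]] A(2-4)])
  qed
qed

section \<open>Order types and positions\<close>

lemma otp_eq_sym:
  assumes "otp_eq A B"
  shows "otp_eq B A"
proof -
  obtain f where f: "bij_betw f A B" "strict_mono_on A f" using assms unfolding otp_eq_def by blast
  define h where "h = inv_into A f"
  have "strict_mono_on B h"
  proof (rule strict_mono_onI)
    fix x y assume xy: "x \<in> B" "y \<in> B" "x < y"
    have h: "h x \<in> A" "h y \<in> A" "f (h x) = x" "f (h y) = y"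
      unfolding h_def using xy f(1) by (auto simp: bij_betw_def inv_into_into f_inv_into_f)
    show "h x < h y"
    proof (rule ccontr)
      assume "\<not> h x < h y"
      then have "h y = h x \<or> h y < h x" by auto
      then show False using strict_mono_onD[OF f(2) h(2,1)] h(3,4) xy(3) by auto
    qed
  qed
  then show ?thesis unfolding otp_eq_def h_def using bij_betw_inv_into[OF f(1)] by blast
qed

lemma otp_eq_trans:
  assumes "otp_eq A B" "otp_eq B C"
  shows "otp_eq A C"
proof -
  obtain f where f: "bij_betw f A B" "strict_mono_on A f" using assms(1) unfolding otp_eq_def by blast
  obtain h where h: "bij_betw h B C" "strict_mono_on B h" using assms(2) unfolding otp_eq_def by blast
  have "strict_mono_on A (h \<circ> f)"
    using f h unfolding strict_mono_on_def bij_betw_def by auto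
  then show ?thesis unfolding otp_eq_def using bij_betw_trans[OF f(1) h(1)] by blast
qed

lemma otp_eq_position:
  fixes A :: "'a::linorder set"
  assumes "finite A"
  shows "otp_eq A {..<card A}"
  unfolding otp_eq_def
proof (intro exI conjI)
  show "bij_betw (position A) A {..<card A}"
    unfolding bij_betw_def using position_image[OF assms] position_eq_iff[OF assms] by (auto simp: inj_on_def)
  show "strict_mono_on A (position A)"
    using position_less[OF assms] by (auto simp: strict_mono_on_def)
qed

lemma otp_eq_finite_iff:
  assumes "finite A" "finite B"
  shows "otp_eq A B \<longleftrightarrow> card A = card B"
proof
  show "otp_eq A B \<Longrightarrow> card A = card B" unfolding otp_eq_def using bij_betw_same_card by blast
  assume "card A = card B"
  then show "otp_eq A B"
    using otp_eq_trans[OF otp_eq_position[OF assms(1)]] otp_eq_sym[OF otp_eq_position[OF assms(2)]] by simp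
qed

lemma finite_is_pos:
  assumes "finite a"
  shows "otp_eq (a \<inter> {..<x}) {..<k::nat} \<longleftrightarrow> position a x = k"
  using otp_eq_finite_iff[of "a \<inter> {..<x}" "{..<k}"] assms by (simp add: position_def)

lemma is_pos_nat_iff:
  assumes "finite a"
  shows "is_pos a (k::nat) \<longleftrightarrow> k < card a"
proof -
  have "is_pos a k \<longleftrightarrow> k \<in> position a ` a"
    unfolding is_pos_def finite_is_pos[OF assms] by auto
  then show ?thesis using position_image[OF assms] by simp
qed

lemma elem_at_position:
  assumes "finite a" "x \<in> a"
  shows "elem_at a (position a x) = x"
  unfolding elem_at_def finite_is_pos[OF assms(1)]
  by (rule the_equality) (use assms position_eq_iff in auto)

lemma elem_at_nat:
  assumes "finite a" "k < card a"
  shows "elem_at a k \<in> a" "position a (elem_at a k) = k"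
proof -
  have "k \<in> position a ` a" using position_image[OF assms(1)] assms(2) by simp
  then obtain x where "x \<in> a" "position a x = k" by blast
  then show "elem_at a k \<in> a" "position a (elem_at a k) = k" using elem_at_position[OF assms(1)] by auto
qed

lemma aligned_finite_iff:
  assumes "finite a" "finite b" "card a = card b"
  shows "aligned a b \<longleftrightarrow> same_positions a b"
  unfolding aligned_def same_positions_def
  using otp_eq_finite_iff[OF assms(1,2)] assms by (simp add: otp_eq_finite_iff position_def)

lemma rset_finite:
  assumes "finite a"
  shows "rset a b = position a ` (a \<inter> b)"
proof -
  have "k \<in> rset a b \<longleftrightarrow> k \<in> position a ` (a \<inter> b)" for k
    unfolding rset_def using is_pos_nat_iff[OF assms] elem_at_nat[OF assms] position_image[OF assms]
      elem_at_position[OF assms] by (auto simp: image_iff) (metis IntI)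
  then show ?thesis by blast
qed

text \<open>Exactly \<open>m\<close> members of a tuple have position below \<open>m\<close>, so
  positions in the tuple and in its upper part differ by the constant \<open>m\<close>.\<close>

lemma aligned_above_positions:
  assumes ab: "a \<in> [H]\<^bsup>n\<^esup>" "b \<in> [H]\<^bsup>n\<^esup>" and al: "aligned_above n a b m" and m: "m < n"
    and y: "y \<in> a" "y \<in> b" "m \<le> position a y" "m \<le> position b y"
  shows "position a y = position b y"
proof -
  define upper where "upper c = {x \<in> c. m \<le> position c x}" for c :: "'a set"
  have sub: "sub_at c ({..<n} - {..<m}) = upper c" if "c \<in> [H]\<^bsup>n\<^esup>" for c
  proof -
    have c: "finite c" "card c = n" using nsetsD[OF that] by auto
    have "x \<in> (\<lambda>i. elem_at c i) ` ({..<n} - {..<m})" if "x \<in> upper c" for x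
      using that elem_at_position[OF c(1), of x] position_less_card[OF c(1), of x] c(2)
      by (intro image_eqI[of _ _ "position c x"]) (auto simp: upper_def)
    moreover have "elem_at c i \<in> upper c" if "i \<in> {..<n} - {..<m}" for i
      using that elem_at_nat[OF c(1), of i] c(2) by (simp add: upper_def)
    ultimately show ?thesis unfolding sub_at_def by blast
  qed
  have "position c y = m + position (upper c) y" if "c \<in> [H]\<^bsup>n\<^esup>" "y \<in> c" "m \<le> position c y" for c
  proof -
    have c: "finite c" "card c = n" using nsetsD[OF that(1)] by auto
    define lower where "lower = {x \<in> c. position c x < m}"
    have "position c ` lower = {..<m}"
    proof
      show "{..<m} \<subseteq> position c ` lower"
      proof
        fix k assume k: "k \<in> {..<m}"
        then have "k \<in> position c ` c" using position_image[OF c(1)] c(2) m by simp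
        then show "k \<in> position c ` lower" using k by (auto simp: lower_def)
      qed
    qed (auto simp: lower_def)
    moreover have "inj_on (position c) lower"
      using position_eq_iff[OF c(1)] unfolding lower_def by (auto simp: inj_on_def)
    ultimately have "card lower = m" using card_image by fastforce
    have "c \<inter> {..<y} = lower \<union> (upper c \<inter> {..<y})"
      unfolding lower_def upper_def using position_less_iff[OF c(1) _ that(2)] that(3)
      by (auto simp: not_less) (meson leI less_le_trans)+
    moreover have "lower \<inter> (upper c \<inter> {..<y}) = {}" unfolding lower_def upper_def by auto
    ultimately have "card (c \<inter> {..<y}) = card lower + card (upper c \<inter> {..<y})"
      using card_Un_disjoint[of lower "upper c \<inter> {..<y}"] c(1) unfolding lower_def upper_def by simp
    then show ?thesis using \<open>card lower = m\<close> by (simp add: position_def)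
  qed
  note pos = this[OF ab(1) y(1,3)] this[OF ab(2) y(2,4)]
  have fin: "finite (upper a)" "finite (upper b)" using nsetsD[OF ab(1)] nsetsD[OF ab(2)] by (auto simp: upper_def)
  have "aligned (upper a) (upper b)" using al unfolding aligned_above_def sub[OF ab(1)] sub[OF ab(2)] .
  then have "otp_eq (upper a \<inter> {..<y}) (upper b \<inter> {..<y})"
    unfolding aligned_def using y by (auto simp: upper_def)
  then have "position (upper a) y = position (upper b) y"
    using otp_eq_finite_iff fin unfolding position_def by (metis finite_Int)
  then show ?thesis using pos by simp
qed

text \<open>A strictly increasing map between initial segments never moves a point down, so
  \<open>j < i\<close> would give \<open>j \<le> f j < j\<close>.\<close>

lemma otp_eq_lessThan_imp_eq:
  fixes i j :: "'o::wellorder"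
  assumes "otp_eq {..<i} {..<j}"
  shows "i = j"
proof -
  have ge: "x \<le> f x" if f: "strict_mono_on {..<i} f" "f ` {..<i} \<subseteq> {..<j}" "j \<le> i" and "x < i"
    for f :: "'o \<Rightarrow> 'o" and i j x
    using \<open>x < i\<close>
  proof (induction x rule: less_induct)
    case (less x)
    show ?case
    proof (rule ccontr)
      assume "\<not> x \<le> f x"
      then have "f x < x" by simp
      moreover have "f x < i" using calculation less.prems by simp
      ultimately have "f x \<le> f (f x)" using less.IH by blast
      then show False using strict_mono_onD[OF f(1), of "f x" x] \<open>f x < x\<close> \<open>f x < i\<close> less.prems by auto
    qed
  qed
  have no: "\<not> j < i" if eq: "otp_eq {..<i} {..<j}" for i j :: 'o
  proof
    assume "j < i"
    obtain f where f: "bij_betw f {..<i} {..<j}" "strict_mono_on {..<i} f" using eq unfolding otp_eq_def by blast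
    have "f ` {..<i} \<subseteq> {..<j}" using f(1) by (simp add: bij_betw_def)
    moreover have "j \<in> {..<i}" "j \<le> i" using \<open>j < i\<close> by simp_all
    ultimately have "j \<le> f j" "f j < j" using ge[OF f(2), of j j] by auto
    then show False by simp
  qed
  show ?thesis using no[OF assms] no[OF otp_eq_sym[OF assms]] by auto
qed

section \<open>Order types of arbitrary sets, computed by ranks\<close>

context
  fixes u :: "'o::wellorder set"
begin

text \<open>The order type of \<open>u \<inter> {..<\<alpha>}\<close> as a point of the same type.
  It exists there because ranks never exceed their argument, which also guarantees that the
  \<open>LEAST\<close> has a candidate.\<close>

definition ordinal_rank :: "'o \<Rightarrow> 'o" where
  "ordinal_rank = tree_rank UNIV (\<lambda>_. u)"

lemma ordinal_rank_eq: "ordinal_rank \<alpha> = (LEAST t. t \<notin> ordinal_rank ` (u \<inter> {..<\<alpha>}))"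
proof -
  have "{y \<in> {..<\<alpha>}. y \<in> u} = u \<inter> {..<\<alpha>}" by auto
  then show ?thesis unfolding ordinal_rank_def by (subst tree_rank.simps) simp
qed

lemma ordinal_rank_le: "ordinal_rank \<alpha> \<le> \<alpha>"
proof (induction \<alpha> rule: less_induct)
  case (less \<alpha>)
  then have "ordinal_rank \<beta> \<noteq> \<alpha>" if "\<beta> < \<alpha>" for \<beta> using that by (metis leD)
  then have "\<alpha> \<notin> ordinal_rank ` (u \<inter> {..<\<alpha>})" by auto
  then show ?case by (subst ordinal_rank_eq) (rule Least_le)
qed

lemma ordinal_rank_notin: "ordinal_rank \<alpha> \<notin> ordinal_rank ` (u \<inter> {..<\<alpha>})"
proof -
  have "ordinal_rank \<beta> \<noteq> \<alpha>" if "\<beta> < \<alpha>" for \<beta> using that ordinal_rank_le by (metis leD)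
  then have "\<alpha> \<notin> ordinal_rank ` (u \<inter> {..<\<alpha>})" by auto
  then have "(LEAST t. t \<notin> ordinal_rank ` (u \<inter> {..<\<alpha>})) \<notin> ordinal_rank ` (u \<inter> {..<\<alpha>})" by (rule LeastI)
  then show ?thesis unfolding ordinal_rank_eq[symmetric] .
qed

lemma ordinal_rank_less:
  assumes "\<beta> \<in> u" "\<beta> < \<alpha>"
  shows "ordinal_rank \<beta> < ordinal_rank \<alpha>"
proof -
  have "u \<inter> {..<\<beta>} \<subseteq> u \<inter> {..<\<alpha>}" using assms(2) by auto
  then have "ordinal_rank \<alpha> \<notin> ordinal_rank ` (u \<inter> {..<\<beta>})" using ordinal_rank_notin[of \<alpha>] by blast
  then have "ordinal_rank \<beta> \<le> ordinal_rank \<alpha>"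
    unfolding ordinal_rank_eq[of \<beta>] by (rule Least_le)
  moreover have "ordinal_rank \<beta> \<noteq> ordinal_rank \<alpha>"
  proof
    assume "ordinal_rank \<beta> = ordinal_rank \<alpha>"
    moreover have "ordinal_rank \<beta> \<in> ordinal_rank ` (u \<inter> {..<\<alpha>})" using assms by (intro imageI) simp
    ultimately show False using ordinal_rank_notin[of \<alpha>] by simp
  qed
  ultimately show ?thesis by simp
qed

lemma ordinal_rank_image: "ordinal_rank ` (u \<inter> {..<\<alpha>}) = {..<ordinal_rank \<alpha>}"
proof
  show "ordinal_rank ` (u \<inter> {..<\<alpha>}) \<subseteq> {..<ordinal_rank \<alpha>}" using ordinal_rank_less by auto
  show "{..<ordinal_rank \<alpha>} \<subseteq> ordinal_rank ` (u \<inter> {..<\<alpha>})"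
    using not_less_Least[of _ "\<lambda>t. t \<notin> ordinal_rank ` (u \<inter> {..<\<alpha>})"] ordinal_rank_eq[of \<alpha>] by auto
qed

lemma ordinal_rank_strict_mono: "strict_mono_on u ordinal_rank"
  using ordinal_rank_less by (auto simp: strict_mono_on_def)

lemma otp_eq_ordinal_rank: "otp_eq (u \<inter> {..<\<alpha>}) {..<ordinal_rank \<alpha>}"
  unfolding otp_eq_def
proof (intro exI conjI)
  show mono: "strict_mono_on (u \<inter> {..<\<alpha>}) ordinal_rank"
    using ordinal_rank_less by (auto simp: strict_mono_on_def)
  show "bij_betw ordinal_rank (u \<inter> {..<\<alpha>}) {..<ordinal_rank \<alpha>}"
    unfolding bij_betw_def using strict_mono_on_imp_inj_on[OF mono] ordinal_rank_image by simp
qed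

lemma otp_eq_iff_ordinal_rank: "otp_eq (u \<inter> {..<\<alpha>}) {..<i} \<longleftrightarrow> ordinal_rank \<alpha> = i"
  using otp_eq_ordinal_rank otp_eq_lessThan_imp_eq otp_eq_trans[OF otp_eq_sym[OF otp_eq_ordinal_rank]] by blast

lemma is_pos_iff: "is_pos u i \<longleftrightarrow> i \<in> ordinal_rank ` u"
  unfolding is_pos_def otp_eq_iff_ordinal_rank by auto

lemma positions_eq: "(positions u :: 'o set) = ordinal_rank ` u"
  unfolding positions_def is_pos_iff by simp

lemma elem_at_ordinal_rank: "\<alpha> \<in> u \<Longrightarrow> elem_at u (ordinal_rank \<alpha>) = \<alpha>"
  unfolding elem_at_def otp_eq_iff_ordinal_rank
  using strict_mono_on_imp_inj_on[OF ordinal_rank_strict_mono] by (intro the_equality) (auto dest: inj_onD)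

lemma elem_at_in:
  fixes i :: 'o
  assumes "i \<in> positions u"
  shows "elem_at u i \<in> u" "otp_eq (u \<inter> {..<elem_at u i}) {..<i}"
  using assms elem_at_ordinal_rank otp_eq_ordinal_rank unfolding positions_eq by auto

lemma elem_at_inj: "inj_on (elem_at u) (positions u :: 'o set)"
  unfolding positions_eq inj_on_def using elem_at_ordinal_rank by auto

lemma elem_at_image: "elem_at u ` (positions u :: 'o set) = u"
  unfolding positions_eq image_image using elem_at_ordinal_rank by simp

lemma positions_initial:
  fixes i j :: 'o
  assumes "i \<in> positions u" "j < i"
  shows "j \<in> positions u"
proof -
  obtain \<alpha> where "i = ordinal_rank \<alpha>" using assms(1) positions_eq by blast
  then have "j \<in> ordinal_rank ` (u \<inter> {..<\<alpha>})" using ordinal_rank_image assms(2) by simp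
  then show ?thesis using positions_eq by blast
qed

lemma otp_eq_positions: "otp_eq u (positions u :: 'o set)"
  unfolding otp_eq_def positions_eq
  using ordinal_rank_strict_mono inj_on_imp_bij_betw[OF strict_mono_on_imp_inj_on[OF ordinal_rank_strict_mono]] by blast

lemma card_of_positions: "|positions u :: 'o set| =o |u|"
  unfolding positions_eq
  by (rule ordIso_symmetric, rule card_of_ordIsoI)
    (rule inj_on_imp_bij_betw[OF strict_mono_on_imp_inj_on[OF ordinal_rank_strict_mono]])

end

text \<open>Values of aligned tuples coincide only at equal indices, which yields alignment of
  \<open>u a\<close> and \<open>u b\<close>. The intersection law is immediate, since
  \<open>m i\<close> lies in an intersection iff it lies in both sets.\<close>

lemma canonical_imp_uniform_delta_system:
  fixes u :: "'a::wellorder set \<Rightarrow> 'o::wellorder set" and \<rho> :: "'o set"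
  assumes pos: "\<And>b. b \<in> [H]\<^bsup>n\<^esup> \<Longrightarrow> positions (u b) = \<rho>"
    and can: "canonical n H (\<lambda>b. elem_at (u b)) \<rho> m"
  shows "uniform_delta_system n H u"
  unfolding uniform_delta_system_def
proof (intro exI[of _ \<rho>] exI[of _ "\<lambda>M. {i\<in>\<rho>. m i \<subseteq> M}"] conjI ballI allI impI)
  fix a b and M :: "nat set" assume a: "a \<in> [H]\<^bsup>n\<^esup>" and b: "b \<in> [H]\<^bsup>n\<^esup>" and "aligned a b \<and> rset a b = M"
  then have same: "same_positions a b" and M: "position a ` (a \<inter> b) = M"
    using nsetsD[OF a] nsetsD[OF b] aligned_finite_iff[of a b] rset_finite[of a b] by simp_all
  have eq: "elem_at (u a) i = elem_at (u b) j \<longleftrightarrow> i = j \<and> m i \<subseteq> M" if "i \<in> \<rho>" "j \<in> \<rho>" for i j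
    using canonicalD(2)[OF can a b that same] M by simp
  have ia: "elem_at (u a) ` \<rho> = u a" and ib: "elem_at (u b) ` \<rho> = u b"
    using elem_at_image[of "u a"] elem_at_image[of "u b"] pos[OF a] pos[OF b] by simp_all
  have elem: "otp_eq (u c \<inter> {..<elem_at (u c) i}) {..<i}" if "i \<in> \<rho>" "c \<in> [H]\<^bsup>n\<^esup>" for c i
    using elem_at_in(2)[of i "u c"] that pos by simp
  have "otp_eq (u a) \<rho>" "otp_eq (u b) \<rho>"
    using otp_eq_positions[of "u a"] otp_eq_positions[of "u b"] pos[OF a] pos[OF b] by simp_all
  then have ab: "otp_eq (u a) (u b)" using otp_eq_trans otp_eq_sym by blast
  have init: "otp_eq (u a \<inter> {..<\<gamma>}) (u b \<inter> {..<\<gamma>})" if \<gamma>: "\<gamma> \<in> u a \<inter> u b" for \<gamma>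
  proof -
    obtain i where i: "i \<in> \<rho>" "\<gamma> = elem_at (u a) i" using \<gamma> ia by blast
    obtain j where j: "j \<in> \<rho>" "\<gamma> = elem_at (u b) j" using \<gamma> ib by blast
    have "i = j" using eq[OF i(1) j(1)] i(2) j(2) by simp
    then have "otp_eq (u b \<inter> {..<\<gamma>}) {..<i}" using elem[OF j(1) b] j(2) by simp
    then show ?thesis
      using otp_eq_trans[OF elem[OF i(1) a] otp_eq_sym] i(2) by simp
  qed
  show "aligned (u a) (u b)" unfolding aligned_def using ab init by blast
  have mem: "is_pos (u a) i \<longleftrightarrow> i \<in> \<rho>" for i
    using pos[OF a] by (auto simp: positions_def)
  have "elem_at (u a) i \<in> u b \<longleftrightarrow> m i \<subseteq> M" if "i \<in> \<rho>" for i
  proof -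
    have "elem_at (u a) i \<in> u b \<longleftrightarrow> elem_at (u a) i \<in> elem_at (u b) ` \<rho>" by (simp only: ib)
    then have "elem_at (u a) i \<in> u b \<longleftrightarrow> (\<exists>j\<in>\<rho>. elem_at (u a) i = elem_at (u b) j)" by blast
    then show ?thesis using eq[OF that] that by auto
  qed
  then show "rset (u a) (u b) = {i\<in>\<rho>. m i \<subseteq> M}" unfolding rset_def mem by blast
qed (use pos in auto)

lemma tp_int_shift:
  fixes u :: "'a::wellorder set \<Rightarrow> 'o::wellorder set" and \<rho> :: "'o set"
  assumes pos: "\<And>b. b \<in> [H]\<^bsup>n\<^esup> \<Longrightarrow> positions (u b) = \<rho>"
    and shift: "shift_invariant n H (\<lambda>b. elem_at (u b)) \<rho>"
    and ab: "a \<in> [H]\<^bsup>n\<^esup>" "b \<in> [H]\<^bsup>n\<^esup>" and m: "m < n"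
    and al: "aligned_above n a b m" "elem_at a m = elem_at b m"
    and \<alpha>: "\<alpha> \<in> H" "possible a m \<alpha>" "possible b m \<alpha>"
  shows "(tp_int (u a) (u b) :: ('o \<times> 'o) set) = tp_int (u (replace_at a m \<alpha>)) (u (replace_at b m \<alpha>))"
proof -
  define x where "x = elem_at a m"
  have fin: "finite a" "finite b" "card a = n" "card b = n" using nsetsD[OF ab(1)] nsetsD[OF ab(2)] by auto
  have x: "x \<in> a" "position a x = m" "x \<in> b" "position b x = m"
    using elem_at_nat[OF fin(1), of m] elem_at_nat[OF fin(2), of m] fin m al(2) unfolding x_def by auto
  \<comment> \<open>\<open>possible\<close> compares \<open>\<alpha>\<close> only with the two
    neighbours of \<open>x\<close>; all other members lie beyond these.\<close>
  have between: "(w < x \<longrightarrow> w < \<alpha>) \<and> (x < w \<longrightarrow> \<alpha> < w)"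
    if c: "finite c" "card c = n" "possible c m \<alpha>" "x \<in> c" "position c x = m" "w \<in> c" for c w
  proof (intro conjI impI)
    assume "w < x"
    then have pw: "position c w < m" using position_less[OF c(1,6), of x] c(5) by simp
    let ?e = "elem_at c (m - 1)"
    have e: "?e \<in> c" "position c ?e = m - 1" using elem_at_nat[OF c(1), of "m - 1"] c(2) m by auto
    have "\<not> m - 1 < position c w" using pw by simp
    then have "\<not> ?e < w" using position_less_iff[OF c(1) e(1) c(6)] e(2) by simp
    moreover have "?e < \<alpha>" using c(3) pw unfolding possible_def by simp
    ultimately show "w < \<alpha>" by simp
  next
    assume "x < w"
    then have pw: "m < position c w" using position_less[OF c(1,4), of w] c(5) by simp
    then have "Suc m < n" using position_less_card[OF c(1,6)] c(2) by simp
    let ?e = "elem_at c (m + 1)"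
    have e: "?e \<in> c" "position c ?e = m + 1" using elem_at_nat[OF c(1), of "m + 1"] c(2) \<open>Suc m < n\<close> by auto
    have "\<not> position c w < m + 1" using pw by simp
    then have "\<not> w < ?e" using position_less_iff[OF c(1) c(6) e(1)] e(2) by simp
    moreover have "\<alpha> < ?e"
      using c(3) is_pos_nat_iff[OF c(1), of "m + 1"] c(2) \<open>Suc m < n\<close> unfolding possible_def by simp
    ultimately show "\<alpha> < w" by simp
  qed
  note between_a = between[OF fin(1,3) \<alpha>(2) x(1,2)] and between_b = between[OF fin(2,4) \<alpha>(3) x(3,4)]
  have repl: "insert \<alpha> (c - {x}) \<in> [H]\<^bsup>n\<^esup>"
    if c: "c \<in> [H]\<^bsup>n\<^esup>" "x \<in> c" and bt: "\<And>w. w \<in> c \<Longrightarrow> (w < x \<longrightarrow> w < \<alpha>) \<and> (x < w \<longrightarrow> \<alpha> < w)" for c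
  proof -
    have "\<alpha> \<notin> c - {x}"
    proof
      assume "\<alpha> \<in> c - {x}"
      then have "\<alpha> < x \<or> x < \<alpha>" "\<alpha> \<in> c" by auto
      then show False using bt[of \<alpha>] by auto
    qed
    moreover have "card (c - {x}) = n - 1" using c nsetsD[OF c(1)] by simp
    ultimately show ?thesis using nsetsD[OF c(1)] \<alpha>(1) m by (auto simp: nsets_def)
  qed
  have rep: "replace_at a m \<alpha> = insert \<alpha> (a - {x})" "replace_at b m \<alpha> = insert \<alpha> (b - {x})"
    unfolding replace_at_def using al(2) x_def by auto
  have tp: "tp_int (u c) (u d) = {(i, j). i \<in> \<rho> \<and> j \<in> \<rho> \<and> elem_at (u c) i = elem_at (u d) j}"
    if "c \<in> [H]\<^bsup>n\<^esup>" "d \<in> [H]\<^bsup>n\<^esup>" for c d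
    using pos[OF that(1)] pos[OF that(2)] unfolding tp_int_def positions_def by blast
  have eq: "elem_at (u a) i = elem_at (u b) j \<longleftrightarrow>
      elem_at (u (insert \<alpha> (a - {x}))) i = elem_at (u (insert \<alpha> (b - {x}))) j"
    if ij: "i \<in> \<rho>" "j \<in> \<rho>" for i j
  proof (rule shift_invariantD[OF shift ab x(1,3) \<alpha>(1) _ _ _ ij])
    show "position a y = position b y" if y: "y \<in> a" "y \<in> b" "x \<le> y" for y
    proof (rule aligned_above_positions[OF ab al(1) m y(1,2)])
      show "m \<le> position a y" "m \<le> position b y"
        using position_less_iff[OF fin(1) y(1) x(1)] position_less_iff[OF fin(2) y(2) x(3)] x(2,4) y(3) by auto
    qed
    show "w < \<alpha>" if "w \<in> a \<union> b" "w < x" for w using that between_a between_b by blast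
    show "\<alpha> < w" if "w \<in> a \<union> b" "x < w" for w using that between_a between_b by blast
  qed
  have ab': "insert \<alpha> (a - {x}) \<in> [H]\<^bsup>n\<^esup>" "insert \<alpha> (b - {x}) \<in> [H]\<^bsup>n\<^esup>"
    using repl[OF ab(1) x(1)] repl[OF ab(2) x(3)] between_a between_b by blast+
  show ?thesis
    unfolding rep tp[OF ab] tp[OF ab']
    by (simp add: eq cong: conj_cong)
qed

text \<open>A proper initial segment is determined by the least point it omits.\<close>

lemma card_of_initial_segments:
  fixes S :: "'o::wellorder set set" and K :: "'k set" and L :: "'l set"
  assumes init: "\<And>\<rho> i j. \<lbrakk>\<rho> \<in> S; i \<in> \<rho>; j < i\<rbrakk> \<Longrightarrow> j \<in> \<rho>"
    and small: "\<And>\<rho>. \<rho> \<in> S \<Longrightarrow> |\<rho>| <o |K|"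
    and KL: "|K| <o |L|" and reg: "uncountable_regular L"
  shows "|S| <o |L|"
proof -
  define Z where "Z = \<Union>S"
  \<comment> \<open>Every proper initial segment of the union lies inside a single member of
    \<open>S\<close>.\<close>
  have "|Z| \<le>o |K|"
  proof (rule card_le_if_initial_small)
    fix z assume "z \<in> Z"
    then obtain \<rho> where \<rho>: "\<rho> \<in> S" "z \<in> \<rho>" unfolding Z_def by blast
    then have "Z \<inter> {..<z} \<subseteq> \<rho>" using init by blast
    then have "|Z \<inter> {..<z}| \<le>o |\<rho>|" by (rule card_of_mono1)
    then show "|Z \<inter> {..<z}| <o |K|" by (rule ordLeq_ordLess_trans[OF _ small[OF \<rho>(1)]])
  qed
  then have "|Z| <o |L|" by (rule ordLeq_ordLess_trans[OF _ KL])
  then have SZ: "|Some ` Z| <o |L|" by (rule ordLeq_ordLess_trans[OF card_of_image])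
  have ZL: "|{None} \<union> Some ` Z| <o |L|" by (rule Un_small[OF reg finite_ordLess_reg[OF reg] SZ]) simp
  define \<tau> where "\<tau> \<rho> = (if \<rho> = Z then None else Some (LEAST z. z \<in> Z \<and> z \<notin> \<rho>))" for \<rho>
  have sub: "\<rho> \<subseteq> Z" if "\<rho> \<in> S" for \<rho> using that unfolding Z_def by blast
  have least: "(LEAST z. z \<in> Z \<and> z \<notin> \<rho>) \<in> Z" "\<rho> = Z \<inter> {..<LEAST z. z \<in> Z \<and> z \<notin> \<rho>}" if "\<rho> \<in> S" "\<rho> \<noteq> Z" for \<rho>
  proof -
    let ?z = "LEAST z. z \<in> Z \<and> z \<notin> \<rho>"
    have "\<exists>z. z \<in> Z \<and> z \<notin> \<rho>" using that sub[OF that(1)] by blast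
    then have z: "?z \<in> Z \<and> ?z \<notin> \<rho>" by (rule LeastI_ex)
    then show "?z \<in> Z" by simp
    have "y < ?z" if "y \<in> \<rho>" for y
      using z init[OF \<open>\<rho> \<in> S\<close> that, of ?z] that by (metis linorder_neqE)
    moreover have "y \<in> \<rho>" if "y \<in> Z" "y < ?z" for y
      using not_less_Least[OF that(2)] that(1) by blast
    ultimately show "\<rho> = Z \<inter> {..<?z}" using sub[OF that(1)] by blast
  qed
  have "|S| \<le>o |{None} \<union> Some ` Z|"
  proof (rule card_of_ordLeqI[of \<tau>])
    show "inj_on \<tau> S"
    proof (rule inj_onI)
      fix \<rho> \<rho>' assume S: "\<rho> \<in> S" "\<rho>' \<in> S" and eq: "\<tau> \<rho> = \<tau> \<rho>'"
      show "\<rho> = \<rho>'"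
      proof (cases "\<rho> = Z")
        case True
        then show ?thesis using eq unfolding \<tau>_def by (simp split: if_splits)
      next
        case False
        then have "\<rho>' \<noteq> Z" using eq unfolding \<tau>_def by auto
        then have "(LEAST z. z \<in> Z \<and> z \<notin> \<rho>) = (LEAST z. z \<in> Z \<and> z \<notin> \<rho>')"
          using eq False unfolding \<tau>_def by simp
        then show ?thesis using least(2)[OF S(1) False] least(2)[OF S(2) \<open>\<rho>' \<noteq> Z\<close>] by metis
      qed
    qed
    show "\<tau> \<rho> \<in> {None} \<union> Some ` Z" if "\<rho> \<in> S" for \<rho>
      unfolding \<tau>_def using least(1)[OF that] by simp
  qed
  then show ?thesis by (rule ordLeq_ordLess_trans[OF _ ZL])
qed

theorem theorem3p8:
  fixes n :: nat
    and L :: "'l set" and K :: "'k set" and N :: "'c set"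
    and M :: "'a::wellorder set"
    and g :: "'a set \<Rightarrow> 'c"
    and u :: "'a set \<Rightarrow> 'o::wellorder set"
  assumes n_ge: "1 \<le> n"
    and K_inf: "infinite K" and N_inf: "infinite N"
    and K_lt: "|K| <o |L|" and N_lt: "|N| <o |L|"
    and L_reg: "regularCard |L|"
    and exp_hyp: "\<forall>\<Theta> :: 'l set. |\<Theta>| <o |L| \<longrightarrow> exp_lt_below \<Theta> K L"
    and M_card: "sigma_card L n M"
    and M_initial: "\<forall>x\<in>M. |{y\<in>M. y < x}| <o |M|"
    and g_range: "\<forall>b\<in>[M]\<^bsup>n\<^esup>. g b \<in> N"
    and u_small: "\<forall>b\<in>[M]\<^bsup>n\<^esup>. |u b| <o |K|"
  shows "\<exists>H k. H \<subseteq> M \<and> |H| =o |L| \<and> k \<in> N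
     \<and> (\<forall>b\<in>[H]\<^bsup>n\<^esup>. g b = k)
     \<and> uniform_delta_system n H u
     \<and> (\<forall>a\<in>[H]\<^bsup>n\<^esup>. \<forall>b\<in>[H]\<^bsup>n\<^esup>. \<forall>m<n.
          aligned_above n a b m \<and> elem_at a m = elem_at b m \<longrightarrow>
          (\<forall>\<alpha>\<in>H. possible a m \<alpha> \<and> possible b m \<alpha> \<longrightarrow>
             (tp_int (u a) (u b) :: ('o \<times> 'o) set)
               = tp_int (u (replace_at a m \<alpha>)) (u (replace_at b m \<alpha>))))"
proof -
  \<comment> \<open>\<open>L\<close> is uncountable because the infinite \<open>K\<close> lies
    strictly below it.\<close>
  have "|UNIV :: nat set| \<le>o |K|" using K_inf infinite_iff_card_of_nat by blast
  then have natL: "|UNIV :: nat set| <o |L|" by (rule ordLeq_ordLess_trans[OF _ K_lt])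
  have "infinite L" using card_of_ordLeq_infinite[OF ordLess_imp_ordLeq[OF K_lt] K_inf] .
  then have "stable |L|" using regularCard_stable[OF card_of_Card_order _ L_reg] by (simp add: Field_card_of)
  then have reg: "uncountable_regular L" using natL by (simp add: uncountable_regular_def)

  \<comment> \<open>The order types that occur. They are initial segments of size below
    \<open>|K|\<close>, so there are fewer than \<open>|L|\<close> of them, and pairing them with
    \<open>g\<close> still gives a small colouring.\<close>
  define S where "S = (\<lambda>b. positions (u b) :: 'o set) ` [M]\<^bsup>n\<^esup>"
  have S_small: "|\<rho>| <o |K|" if "\<rho> \<in> S" for \<rho>
    using that ordIso_ordLess_trans[OF card_of_positions] u_small unfolding S_def by blast
  have SL: "|S| <o |L|"
    by (rule card_of_initial_segments[OF _ S_small K_lt reg]) (auto simp: S_def intro: positions_initial)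
  have NSL: "|N \<times> S| <o |L|" by (rule Sigma_small[OF reg N_lt SL])
  obtain \<phi> where \<phi>: "inj_on \<phi> (N \<times> S)" "\<phi> ` (N \<times> S) \<subseteq> L"
    using ordLess_imp_ordLeq[OF NSL] unfolding card_of_ordLeq[symmetric] by blast
  define D where "D l = snd (inv_into (N \<times> S) \<phi> l)" for l
  have D\<phi>: "D (\<phi> (c, \<rho>)) = \<rho>" if "(c, \<rho>) \<in> N \<times> S" for c \<rho>
    unfolding D_def using inv_into_f_f[OF \<phi>(1) that] by simp
  have "small_indexing L (\<phi> ` (N \<times> S)) D"
    unfolding small_indexing_def
  proof (intro conjI ballI allI impI)
    show "|\<phi> ` (N \<times> S)| <o |L|" by (rule ordLeq_ordLess_trans[OF card_of_image NSL])
    fix l and \<Theta> :: "'l set" assume "l \<in> \<phi> ` (N \<times> S)" and \<Theta>: "|\<Theta>| <o |L|"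
    then obtain c \<rho> where "(c, \<rho>) \<in> N \<times> S" "l = \<phi> (c, \<rho>)" by auto
    then have Dl: "D l = \<rho>" "\<rho> \<in> S" using D\<phi> by auto
    \<comment> \<open>The hypothesis speaks of exponents inside \<open>'k\<close>, so
      \<open>\<rho>\<close> is first replaced by a subset \<open>R\<close> of \<open>K\<close> of
      the same size.\<close>
    obtain X :: "'l set" where sup: "is_sup_card {Func R \<Theta> | R :: 'k set. |R| <o |K| } X" and X: "|X| <o |L|"
      using exp_hyp \<Theta> unfolding exp_lt_below_def by blast
    obtain R where R: "R \<subseteq> K" "|\<rho>| =o |R|"
      using obtain_subset_of_card[OF ordLess_imp_ordLeq[OF S_small[OF Dl(2)]]] by metis
    have "|R| <o |K|" by (rule ordIso_ordLess_trans[OF ordIso_symmetric[OF R(2)] S_small[OF Dl(2)]])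
    then have "|Func R \<Theta>| \<le>o |X|" using sup unfolding is_sup_card_def by blast
    then have "|Func R \<Theta>| <o |L|" by (rule ordLeq_ordLess_trans[OF _ X])
    then show "|Func (D l) \<Theta>| <o |L|"
      unfolding Dl(1) by (rule ordLeq_ordLess_trans[OF card_of_Func_mono[OF R(2) ordLeq_refl[OF card_of_Card_order]]])
  qed
  moreover obtain n' where n': "n = Suc n'" using n_ge by (cases n) auto
  have color: "(g b, positions (u b)) \<in> N \<times> S" if "b \<in> [M]\<^bsup>n\<^esup>" for b
    using g_range that unfolding S_def by blast
  have initial: "|M \<inter> {..<x}| <o |M|" if "x \<in> M" for x
  proof -
    have "M \<inter> {..<x} = {y\<in>M. y < x}" by auto
    then show ?thesis using M_initial that by simp
  qed
  ultimately have "delta_property L n M (\<lambda>b. \<phi> (g b, positions (u b))) (\<lambda>b. elem_at (u b)) (\<phi> ` (N \<times> S)) D"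
    unfolding n'
  proof (intro canonical_delta_system[OF reg M_card[unfolded n'] initial])
    fix b assume "b \<in> [M]\<^bsup>Suc n'\<^esup>"
    then have "(g b, positions (u b)) \<in> N \<times> S" using color n' by simp
    then show "\<phi> (g b, positions (u b)) \<in> \<phi> ` (N \<times> S) \<and> inj_on (elem_at (u b)) (D (\<phi> (g b, positions (u b))))"
      using D\<phi> elem_at_inj by simp
  qed
  then obtain H l m where H: "H \<subseteq> M" "|H| =o |L|" and l: "l \<in> \<phi> ` (N \<times> S)"
    and const: "\<forall>b\<in>[H]\<^bsup>n\<^esup>. \<phi> (g b, positions (u b)) = l"
    and can: "canonical n H (\<lambda>b. elem_at (u b)) (D l) m" and shift: "shift_invariant n H (\<lambda>b. elem_at (u b)) (D l)"
    unfolding delta_property_def by blast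
  obtain k \<rho> where k: "(k, \<rho>) \<in> N \<times> S" "l = \<phi> (k, \<rho>)" using l by auto
  have "(g b, positions (u b)) = (k, \<rho>)" if "b \<in> [H]\<^bsup>n\<^esup>" for b
    using inj_onD[OF \<phi>(1) _ color k(1)] const k(2) that nsets_mono[OF H(1), of n] by auto
  then have gk: "\<And>b. b \<in> [H]\<^bsup>n\<^esup> \<Longrightarrow> g b = k" and pos: "\<And>b. b \<in> [H]\<^bsup>n\<^esup> \<Longrightarrow> positions (u b) = \<rho>" by simp_all
  have Dl: "D l = \<rho>" using D\<phi>[OF k(1)] k(2) by simp
  show ?thesis
  proof (intro exI[of _ H] exI[of _ k] conjI ballI allI impI)
    show "uniform_delta_system n H u"
      by (rule canonical_imp_uniform_delta_system[OF pos can[unfolded Dl]])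
    show "(tp_int (u a) (u b) :: ('o \<times> 'o) set) = tp_int (u (replace_at a m \<alpha>)) (u (replace_at b m \<alpha>))"
      if "a \<in> [H]\<^bsup>n\<^esup>" "b \<in> [H]\<^bsup>n\<^esup>" "m < n" "aligned_above n a b m \<and> elem_at a m = elem_at b m" "\<alpha> \<in> H"
        "possible a m \<alpha> \<and> possible b m \<alpha>" for a b m \<alpha>
      using tp_int_shift[of H n u \<rho>, OF pos shift[unfolded Dl] that(1-3)] that(4-6) by blast
  qed (use H gk k(1) in auto)
qed

end
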